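(* (1) Let $\mathcal{F}_\pi$ be the set of Fermat primes and $\mathcal{F}_c$ the set of composite Fermat numbers, and let $\mathcal{A}\in\{\mathcal{F}_\pi,\mathcal{F}_c\}$. Then the following conditions are equivalent: (a) $\mathcal{A}$ is finite; (b) $\prod_{F_n\in\mathcal{A}}\mathrm{SL}(F_n-1,\mathbb{Q}(i))$ is minimal; (c) $\prod_{F_n\in\mathcal{A}}\mathrm{ST}^+(F_n-1,\mathbb{Q}(i))$ is minimal. (2) Let $\mathcal{M}_\pi$ be the set of Mersenne primes and $\mathcal{M}_c$ the set of composite Mersenne numbers, and let $\mathcal{B}\in\{\mathcal{M}_\pi,\mathcal{M}_c\}$. Then the following conditions are equivalent: (a) $\mathcal{B}$ is finite; (b) $\prod_{M_p\in\mathcal{B}}\mathrm{SL}(M_p+1,\mathbb{Q}(i))$ is minimal; (c) $\prod_{M_p\in\mathcal{B}}\mathrm{ST}^+(M_p+1,\mathbb{Q}(i))$ is minimal.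
   Context: All topological groups are Hausdorff, and products of topological groups carry the product topology. A Fermat number is a number of the form $F_n=2^{2^n}+1$ with $n$ a non-negative integer; a Mersenne number is a number of the form $M_p=2^p-1$ with $p$ prime. A Fermat (Mersenne) prime is a Fermat (Mersenne) number that is prime. $\mathbb{Q}(i)\subset\mathbb{C}$ is the Gaussian rational field with the topology inherited from $\mathbb{C}$. For a topological field $\mathbb{F}$, $\mathrm{SL}(n,\mathbb{F})$ denotes the special linear group of degree $n$ over $\mathbb{F}$ with the topology inherited from $\mathbb{F}^{n^2}$, and $\mathrm{ST}^+(n,\mathbb{F})$ denotes its topological subgroup consisting of the upper triangular matrices. A topological group $G$ is minimal if every continuous group isomorphism $f\colon G\to H$ onto a (Hausdorff) topological group $H$ is a topological isomorphism; equivalently, if $G$ admits no strictly coarser Hausdorff group topology. *)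

theory Defs
  imports
    "HOL-Analysis.Function_Topology"
    "HOL-Analysis.T1_Spaces"
    "HOL-Algebra.Product_Groups"
    "HOL-Computational_Algebra.Primes"
    "Jordan_Normal_Form.Determinant"
begin

section \<open>Minimal topological groups\<close>

text \<open>All topological groups are Hausdorff by convention.\<close>

definition topological_group :: "('a, 'b) monoid_scheme \<Rightarrow> 'a topology \<Rightarrow> bool" where
  "topological_group G X \<longleftrightarrow>
     group G \<and> topspace X = carrier G \<and> Hausdorff_space X \<and>
     continuous_map (prod_topology X X) X (\<lambda>(x, y). x \<otimes>\<^bsub>G\<^esub> y) \<and>
     continuous_map X X (\<lambda>x. inv\<^bsub>G\<^esub> x)"

text \<open>Minimality says that there is no strictly coarser Hausdorff group topology. A formulation
  with continuous isomorphisms onto arbitrary topological groups would quantify over types. The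
  lemmas \<open>minimal_group_iso_homeomorphic\<close> and \<open>minimal_group_iff_iso\<close> below show that it is
  equivalent.\<close>

definition minimal_group :: "('a, 'b) monoid_scheme \<Rightarrow> 'a topology \<Rightarrow> bool" where
  "minimal_group G X \<longleftrightarrow>
     topological_group G X \<and>
     (\<forall>Y. topological_group G Y \<and> (\<forall>U. openin Y U \<longrightarrow> openin X U) \<longrightarrow> Y = X)"

lemma topological_group_pullback:
  assumes G: "group G" and H: "topological_group H Y" and f: "f \<in> iso G H"
  shows "topological_group G (pullback_topology (carrier G) f Y)" (is "topological_group G ?P")
proof -
  have grH: "group H" and tY: "topspace Y = carrier H" and hY: "Hausdorff_space Y"
    and mY: "continuous_map (prod_topology Y Y) Y (\<lambda>(x, y). x \<otimes>\<^bsub>H\<^esub> y)"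
    and iY: "continuous_map Y Y (\<lambda>x. inv\<^bsub>H\<^esub> x)"
    using H by (auto simp: topological_group_def)
  have fh: "f \<in> hom G H" and fi: "inj_on f (carrier G)" and fc: "f ` carrier G = carrier H"
    using f by (auto simp: iso_def bij_betw_def)
  have tP: "topspace ?P = carrier G"
    using fc tY by (auto simp: topspace_pullback_topology)
  have cf: "continuous_map ?P Y f"
    using continuous_map_pullback [of Y Y id "carrier G" f] by (simp add: id_def o_def)
  have hP: "Hausdorff_space ?P"
    using Hausdorff_space_injective_preimage [OF hY cf] fi tP by simp
  have "continuous_map (prod_topology ?P ?P) Y
          ((\<lambda>(x, y). x \<otimes>\<^bsub>H\<^esub> y) \<circ> (\<lambda>p. (f (fst p), f (snd p))))"
    by (rule continuous_map_compose [OF _ mY])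
       (auto intro!: continuous_map_pairedI continuous_map_compose [OF continuous_map_fst cf, unfolded o_def]
          continuous_map_compose [OF continuous_map_snd cf, unfolded o_def])
  then have m: "continuous_map (prod_topology ?P ?P) Y (f \<circ> (\<lambda>(x, y). x \<otimes>\<^bsub>G\<^esub> y))"
    by (rule continuous_map_eq) (use fh tP in \<open>auto simp: hom_def\<close>)
  have mP: "continuous_map (prod_topology ?P ?P) ?P (\<lambda>(x, y). x \<otimes>\<^bsub>G\<^esub> y)"
    by (rule continuous_map_pullback' [OF m])
       (use tP G in \<open>auto simp: group.is_monoid monoid.m_closed\<close>)
  have "continuous_map ?P Y ((\<lambda>x. inv\<^bsub>H\<^esub> x) \<circ> f)"
    by (rule continuous_map_compose [OF cf iY])
  then have i: "continuous_map ?P Y (f \<circ> (\<lambda>x. inv\<^bsub>G\<^esub> x))"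
    by (rule continuous_map_eq)
       (use tP fh G grH in \<open>auto simp: group_hom.hom_inv group_hom_def group_hom_axioms_def\<close>)
  have iP: "continuous_map ?P ?P (\<lambda>x. inv\<^bsub>G\<^esub> x)"
    by (rule continuous_map_pullback' [OF i]) (use tP G in \<open>auto simp: group.inv_closed\<close>)
  show ?thesis
    using G tP hP mP iP by (simp add: topological_group_def)
qed

lemma minimal_group_iso_homeomorphic:
  assumes G: "minimal_group G X" and H: "topological_group H Y"
    and f: "f \<in> iso G H" and c: "continuous_map X Y f"
  shows "homeomorphic_map X Y f"
proof -
  let ?P = "pullback_topology (carrier G) f Y"
  have gr: "group G" and tX: "topspace X = carrier G" and tY: "topspace Y = carrier H"
    using G H by (auto simp: minimal_group_def topological_group_def)
  have fi: "inj_on f (carrier G)" and fc: "f ` carrier G = carrier H"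
    using f by (auto simp: iso_def bij_betw_def)
  have "openin X U" if U: "openin ?P U" for U
  proof -
    obtain V where V: "openin Y V" "U = f -` V \<inter> carrier G"
      using U by (auto simp: openin_pullback_topology)
    have "openin X {x \<in> topspace X. f x \<in> V}"
      using c V(1) by (rule openin_continuous_map_preimage)
    moreover have "{x \<in> topspace X. f x \<in> V} = U"
      using V(2) tX by auto
    ultimately show ?thesis by simp
  qed
  then have P: "?P = X"
    using G topological_group_pullback [OF gr H f] by (auto simp: minimal_group_def)
  have "open_map X Y f"
    unfolding open_map_def
  proof (intro allI impI)
    fix U assume "openin X U"
    then obtain V where V: "openin Y V" "U = f -` V \<inter> carrier G"
      using openin_pullback_topology [of "carrier G" f Y U] P by auto
    have "V \<subseteq> f ` carrier G"
      using openin_subset [OF V(1)] tY fc by simp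
    then have "f ` U = V"
      using V(2) by auto
    then show "openin Y (f ` U)" using V(1) by simp
  qed
  then show ?thesis
    using c fi fc tX tY by (simp add: bijective_open_imp_homeomorphic_map)
qed

lemma minimal_group_iff_iso:
  fixes G :: "('a, 'b) monoid_scheme"
  shows "minimal_group G X \<longleftrightarrow>
    topological_group G X \<and>
    (\<forall>(H :: 'a monoid) Y f. topological_group H Y \<and> f \<in> iso G H \<and> continuous_map X Y f
       \<longrightarrow> homeomorphic_map X Y f)" (is "_ \<longleftrightarrow> ?R")
proof
  assume m: "minimal_group G X"
  then have "topological_group G X"
    by (simp add: minimal_group_def)
  then show ?R
    using minimal_group_iso_homeomorphic [OF m] by blast
next
  assume R: ?R
  define H :: "'a monoid" where
    "H = \<lparr>carrier = carrier G, monoid.mult = monoid.mult G, one = one G\<rparr>"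
  have inv: "inv\<^bsub>H\<^esub> x = inv\<^bsub>G\<^esub> x" for x
    by (simp add: H_def m_inv_def)
  have grH: "group H" if "group G"
    by (rule groupI)
      (use group.inv_closed [OF that] group.l_inv [OF that] monoid.m_assoc [OF group.is_monoid [OF that]]
         monoid.m_closed [OF group.is_monoid [OF that]] monoid.one_closed [OF group.is_monoid [OF that]]
         monoid.l_one [OF group.is_monoid [OF that]] in \<open>auto simp: H_def\<close>)
  have "Y = X" if Y: "topological_group G Y" and le: "\<forall>U. openin Y U \<longrightarrow> openin X U" for Y
  proof -
    have t: "topspace X = topspace Y"
      using R Y by (simp add: topological_group_def)
    have "topological_group H Y"
      using Y grH unfolding topological_group_def inv by (simp add: H_def)
    moreover have "id \<in> iso G H"
      by (auto simp: iso_def hom_def H_def)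
    moreover have "continuous_map X Y id"
      using le topology_finer_continuous_id [OF t [symmetric]] by blast
    ultimately have "homeomorphic_map X Y id"
      using R by blast
    then show ?thesis by simp
  qed
  then show "minimal_group G X"
    using R unfolding minimal_group_def by blast
qed

section \<open>Linear groups\<close>

definition gaussian_rationals :: "complex set" where
  "gaussian_rationals = {z. Re z \<in> \<rat> \<and> Im z \<in> \<rat>}"

text \<open>The coefficient field is a subfield \<open>K\<close> of the ambient type, with the inherited topology.\<close>

definition special_linear_group :: "nat \<Rightarrow> 'a::field set \<Rightarrow> 'a mat monoid" where
  "special_linear_group n K =
     \<lparr>carrier = {A \<in> carrier_mat n n. elements_mat A \<subseteq> K \<and> det A = 1},
      monoid.mult = (*), one = 1\<^sub>m n\<rparr>"

definition special_linear_topology ::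
    "nat \<Rightarrow> 'a::{field, topological_space} set \<Rightarrow> 'a mat topology" where
  "special_linear_topology n K =
     pullback_topology (carrier (special_linear_group n K))
       (\<lambda>A. \<lambda>p \<in> {..<n} \<times> {..<n}. A $$ p)
       (product_topology (\<lambda>_. top_of_set K) ({..<n} \<times> {..<n}))"

definition special_triangular_group :: "nat \<Rightarrow> 'a::field set \<Rightarrow> 'a mat monoid" where
  "special_triangular_group n K =
     (special_linear_group n K)
       \<lparr>carrier := {A \<in> carrier (special_linear_group n K). upper_triangular A}\<rparr>"

definition special_triangular_topology ::
    "nat \<Rightarrow> 'a::{field, topological_space} set \<Rightarrow> 'a mat topology" where
  "special_triangular_topology n K =
     subtopology (special_linear_topology n K) (carrier (special_triangular_group n K))"

section \<open>Fermat and Mersenne numbers\<close>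

definition composite :: "nat \<Rightarrow> bool" where
  "composite m \<longleftrightarrow> 1 < m \<and> \<not> prime m"

definition fermat_numbers :: "nat set" where
  "fermat_numbers = {2 ^ (2 ^ n) + 1 | n :: nat. True}"

definition mersenne_numbers :: "nat set" where
  "mersenne_numbers = {2 ^ p - 1 | p :: nat. prime p}"

definition "fermat_primes = {m \<in> fermat_numbers. prime m}"
definition "composite_fermat_numbers = {m \<in> fermat_numbers. composite m}"
definition "mersenne_primes = {m \<in> mersenne_numbers. prime m}"
definition "composite_mersenne_numbers = {m \<in> mersenne_numbers. composite m}"

end

theory Submission
  imports Defs "HOL-Analysis.Abstract_Topological_Spaces" "Jordan_Normal_Form.Spectral_Radius"
begin

(* Matrices are those whose dimension is a term: it varies over the factors of a product. *)
unbundle no vec_syntax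
hide_type (open) Finite_Cartesian_Product.vec
hide_const (open) Finite_Cartesian_Product.mat Finite_Cartesian_Product.vec

text \<open>
The degrees that occur are powers of two, and different numbers give different degrees. For any family of degrees
\<open>2\<^sup>k\<close> with distinct exponents \<open>k \<ge> 1\<close>, both products over the Gaussian rationals are minimal if and only if the
family is finite (\<open>finite_iff_minimal\<close>). Everything takes place in the product of the groups \<open>SL(2\<^sup>k, \<complex>)\<close>, in which
the products over \<open>\<rat>(\<i>)\<close> are subgroups with the inherited topology.

Infinite products fail because of their closure. The complex product has the central element with components
\<open>exp (2 \<pi> \<i> / 2\<^sup>k)\<close>. It lies in the closed subgroup of all compatible families of two-power roots of unity, which is
isomorphic to the 2-adic integers. Since \<open>\<rat>(\<i>)\<close> contains no primitive eighth root of unity, this subgroup meets the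
product over \<open>\<rat>(\<i>)\<close> trivially, so the quotient by it induces a Hausdorff group topology there. That topology is
strictly coarser, since the central element is a limit of elements with entries in \<open>\<rat>(\<i>)\<close>
(\<open>not_minimal_of_central_subgroup\<close>, \<open>not_minimal_infinite_product\<close>).

For finite products of triangular groups, let \<open>\<tau>\<close> be a coarser Hausdorff group topology, and let a net tend to the
identity for \<open>\<tau>\<close>. The subgroup of matrices that differ from the identity in the upper right corner only is the
additive group of the field, on which a torus acts by squares. This action forces \<open>\<tau>\<close> to be the usual topology on it
(\<open>corner_limit\<close>), and commutators with fixed elements extend this to the Heisenberg group, that is, to the first row
and the last column (\<open>heisenberg_limit\<close>). The conjugates of fixed elementary and torus matrices by the net can
therefore be computed entry by entry. They show that each component of the net tends to the identity up to a scalar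
which tends to roots of unity of order \<open>2\<^sup>k\<close> (\<open>conjugation_limit\<close>, \<open>limit_up_to_scalars\<close>). By repeated squaring
one may assume that these roots are \<open>\<plusminus>1\<close>. Since the degrees are even, the sign matrices are elements of the product
itself; there are finitely many of them, so the Hausdorff property of \<open>\<tau>\<close> excludes all but the identity
(\<open>scalars_tend_to_one\<close>).

Finite products of special linear groups reduce to the triangular case, because every complex matrix is
triangularized by a matrix of determinant one from a fixed compact set (\<open>bounded_triangularization\<close>), and because
conjugation by the elements of a compact set is uniformly continuous for the coarser topology
(\<open>coarser_topology_conjugation_transfer\<close>).
\<close>

section \<open>Limits in topological groups\<close>

lemma topological_groupD:
  assumes "topological_group G X"
  shows "group G" "topspace X = carrier G" "Hausdorff_space X"
  using assms by (auto simp: topological_group_def)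

lemma limitin_mult:
  assumes G: "topological_group G X" and f: "limitin X f a F" and g: "limitin X g b F"
  shows "limitin X (\<lambda>x. f x \<otimes>\<^bsub>G\<^esub> g x) (a \<otimes>\<^bsub>G\<^esub> b) F"
proof -
  have "limitin (prod_topology X X) (\<lambda>x. (f x, g x)) (a, b) F"
    using f g by (simp add: limitin_pairwise o_def)
  with G show ?thesis
    unfolding topological_group_def using continuous_map_limit by (fastforce simp: o_def)
qed

lemma limitin_inv:
  assumes G: "topological_group G X" and f: "limitin X f a F"
  shows "limitin X (\<lambda>x. inv\<^bsub>G\<^esub> f x) (inv\<^bsub>G\<^esub> a) F"
  using G f unfolding topological_group_def using continuous_map_limit by (fastforce simp: o_def)

lemma limitin_group_const:
  assumes "topological_group G X" "a \<in> carrier G"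
  shows "limitin X (\<lambda>x. a) a F"
  using assms by (simp add: topological_group_def)

lemma limitin_eventually_carrier:
  assumes "topological_group G X" "limitin X f a F"
  shows "eventually (\<lambda>x. f x \<in> carrier G) F" "a \<in> carrier G"
  using assms by (auto simp: topological_group_def limitin_def)

lemma limitin_coarser:
  assumes "\<And>U. openin Y U \<Longrightarrow> openin X U" "l \<in> topspace Y" "limitin X f l F"
  shows "limitin Y f l F"
  using assms unfolding limitin_def by blast

lemma limitin_filter_mono:
  "limitin X f l F \<Longrightarrow> F' \<le> F \<Longrightarrow> limitin X f l F'"
  unfolding limitin_def using filter_leD by blast

lemma limitin_nhdsin: "limitin X (\<lambda>x. x) l (nhdsin X l)" if "l \<in> topspace X"
  unfolding limitin_def
proof (intro conjI that allI impI, elim conjE)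
  fix U assume "openin X U" "l \<in> U"
  then show "eventually (\<lambda>x. x \<in> U) (nhdsin X l)"
    unfolding eventually_nhdsin by blast
qed

lemma limitin_filtercomap: "limitin X f l (filtercomap f (nhdsin X l))" if "l \<in> topspace X"
  using limitin_nhdsin[OF that] eventually_filtercomapI[of _ "nhdsin X l" f]
  unfolding limitin_def by blast

lemma limitin_atin_ident: "limitin X (\<lambda>x. x) a (atin X a)" if "a \<in> topspace X"
  using continuous_map_id[of X] that unfolding continuous_map_atin id_def by blast

lemma limitin_fst:
  assumes "a \<in> topspace X"
  shows "limitin X fst a (nhdsin X a \<times>\<^sub>F F)"
  unfolding limitin_def
proof (intro conjI assms allI impI, elim conjE)
  fix U assume "openin X U" "a \<in> U"
  then have "eventually (\<lambda>x. x \<in> U) (nhdsin X a)"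
    unfolding eventually_nhdsin by blast
  then show "eventually (\<lambda>p. fst p \<in> U) (nhdsin X a \<times>\<^sub>F F)"
    by (rule eventually_compose_filterlim[OF _ filterlim_fst])
qed

lemma limitin_snd:
  assumes "a \<in> topspace X"
  shows "limitin X snd a (F \<times>\<^sub>F nhdsin X a)"
  unfolding limitin_def
proof (intro conjI assms allI impI, elim conjE)
  fix U assume "openin X U" "a \<in> U"
  then have "eventually (\<lambda>x. x \<in> U) (nhdsin X a)"
    unfolding eventually_nhdsin by blast
  then show "eventually (\<lambda>p. snd p \<in> U) (F \<times>\<^sub>F nhdsin X a)"
    by (rule eventually_compose_filterlim[OF _ filterlim_snd])
qed

lemma limitin_pullback_topology:
  "limitin (pullback_topology A f T) g l F \<longleftrightarrow>
     l \<in> A \<and> eventually (\<lambda>x. g x \<in> A) F \<and> limitin T (\<lambda>x. f (g x)) (f l) F" (is "?L \<longleftrightarrow> ?R")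
proof
  assume L: ?L
  have "l \<in> A" "f l \<in> topspace T"
    using limitin_topspace[OF L] by (auto simp: topspace_pullback_topology)
  moreover have "eventually (\<lambda>x. g x \<in> A) F"
    using limitinD[OF L openin_topspace limitin_topspace[OF L]]
    by (auto simp: topspace_pullback_topology elim: eventually_mono)
  moreover have "eventually (\<lambda>x. f (g x) \<in> U) F" if "openin T U" "f l \<in> U" for U
  proof -
    have "openin (pullback_topology A f T) (f -` U \<inter> A)"
      using that by (auto simp: openin_pullback_topology)
    from limitinD[OF L this] show ?thesis
      using that \<open>l \<in> A\<close> by (auto elim: eventually_mono)
  qed
  ultimately show ?R by (simp add: limitin_def)
next
  assume R: ?R
  then have "l \<in> topspace (pullback_topology A f T)"
    by (auto simp: topspace_pullback_topology limitin_def)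
  moreover have "eventually (\<lambda>x. g x \<in> U) F"
    if "openin (pullback_topology A f T) U" "l \<in> U" for U
  proof -
    obtain V where V: "openin T V" "U = f -` V \<inter> A"
      using \<open>openin (pullback_topology A f T) U\<close> by (auto simp: openin_pullback_topology)
    have "eventually (\<lambda>x. f (g x) \<in> V) F"
      using R V that(2) by (auto simp: limitin_def)
    with R show ?thesis
      unfolding V(2) by (auto elim: eventually_elim2)
  qed
  ultimately show ?L by (simp add: limitin_def)
qed

lemma topological_groupI:
  fixes G :: "('a, 'b) monoid_scheme"
  assumes G: "group G" and X: "topspace X = carrier G" "Hausdorff_space X"
    and mult: "\<And>(F :: ('a \<times> 'a) filter) f g a b. limitin X f a F \<Longrightarrow> limitin X g b F \<Longrightarrow>
      limitin X (\<lambda>x. f x \<otimes>\<^bsub>G\<^esub> g x) (a \<otimes>\<^bsub>G\<^esub> b) F"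
    and inv: "\<And>(F :: 'a filter) f a. limitin X f a F \<Longrightarrow>
      limitin X (\<lambda>x. inv\<^bsub>G\<^esub> f x) (inv\<^bsub>G\<^esub> a) F"
  shows "topological_group G X"
proof -
  have "limitin X (\<lambda>(x, y). x \<otimes>\<^bsub>G\<^esub> y) (case p of (x, y) \<Rightarrow> x \<otimes>\<^bsub>G\<^esub> y) (atin (prod_topology X X) p)"
    if p: "p \<in> topspace (prod_topology X X)" for p
  proof -
    have "limitin X fst (fst p) (atin (prod_topology X X) p)"
      "limitin X snd (snd p) (atin (prod_topology X X) p)"
      using p continuous_map_fst[of X X] continuous_map_snd[of X X]
      unfolding continuous_map_atin by blast+
    from mult[OF this] show ?thesis by (simp add: case_prod_unfold)
  qed
  moreover have "limitin X (\<lambda>x. inv\<^bsub>G\<^esub> x) (inv\<^bsub>G\<^esub> a) (atin X a)" if "a \<in> topspace X" for a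
    using inv[OF limitin_atin_ident[OF that]] .
  ultimately show ?thesis
    using G X unfolding topological_group_def continuous_map_atin by blast
qed

lemma topological_group_subgroup:
  fixes G :: "('a, 'b) monoid_scheme"
  assumes G: "topological_group G X" and S: "subgroup S G"
  shows "topological_group (G\<lparr>carrier := S\<rparr>) (subtopology X S)"
proof (rule topological_groupI)
  note gr = topological_groupD(1)[OF G]
  show "group (G\<lparr>carrier := S\<rparr>)"
    using gr S by (rule subgroup.subgroup_is_group[rotated])
  show "topspace (subtopology X S) = carrier (G\<lparr>carrier := S\<rparr>)"
    using subgroup.subset[OF S] topological_groupD(2)[OF G] by auto
  show "Hausdorff_space (subtopology X S)"
    using topological_groupD(3)[OF G] by (rule Hausdorff_space_subtopology)
  show "limitin (subtopology X S) (\<lambda>x. f x \<otimes>\<^bsub>G\<lparr>carrier := S\<rparr>\<^esub> g x) (a \<otimes>\<^bsub>G\<lparr>carrier := S\<rparr>\<^esub> b) F"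
    if "limitin (subtopology X S) f a F" "limitin (subtopology X S) g b F"
    for F :: "('a \<times> 'a) filter" and f g a b
    using that limitin_mult[OF G, of f a F g b] subgroup.m_closed[OF S]
    by (auto simp: limitin_subtopology elim: eventually_elim2)
  show "limitin (subtopology X S) (\<lambda>x. inv\<^bsub>G\<lparr>carrier := S\<rparr>\<^esub> f x) (inv\<^bsub>G\<lparr>carrier := S\<rparr>\<^esub> a) F"
    if "limitin (subtopology X S) f a F"
    for F :: "'a filter" and f a
  proof -
    have a: "a \<in> S" and ev: "eventually (\<lambda>x. f x \<in> S) F" and l: "limitin X f a F"
      using that by (auto simp: limitin_subtopology)
    have i: "inv\<^bsub>G\<lparr>carrier := S\<rparr>\<^esub> x = inv\<^bsub>G\<^esub> x" if "x \<in> S" for x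
      using group.m_inv_consistent[OF gr S that] .
    have "eventually (\<lambda>x. inv\<^bsub>G\<^esub> f x = inv\<^bsub>G\<lparr>carrier := S\<rparr>\<^esub> f x) F"
      using ev by eventually_elim (simp add: i)
    then have "limitin X (\<lambda>x. inv\<^bsub>G\<lparr>carrier := S\<rparr>\<^esub> f x) (inv\<^bsub>G\<^esub> a) F"
      using limitin_inv[OF G l] by (rule limitin_transform_eventually)
    moreover have "eventually (\<lambda>x. inv\<^bsub>G\<lparr>carrier := S\<rparr>\<^esub> f x \<in> S) F"
      using ev by eventually_elim (simp add: i subgroup.m_inv_closed[OF S])
    ultimately show ?thesis
      using a i subgroup.m_inv_closed[OF S] by (simp add: limitin_subtopology)
  qed
qed

lemma topological_group_product:
  fixes G :: "'i \<Rightarrow> ('a, 'b) monoid_scheme"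
  assumes G: "\<And>i. i \<in> I \<Longrightarrow> topological_group (G i) (X i)"
  shows "topological_group (product_group I G) (product_topology X I)"
proof (rule topological_groupI)
  note gr = topological_groupD(1)[OF G]
  have tX: "topspace (X i) = carrier (G i)" if "i \<in> I" for i
    using topological_groupD(2)[OF G[OF that]] .
  show "group (product_group I G)"
    using gr by simp
  have tP: "topspace (product_topology X I) = carrier (product_group I G)"
    using tX by (auto simp: PiE_iff)
  then show "topspace (product_topology X I) = carrier (product_group I G)" .
  show "Hausdorff_space (product_topology X I)"
    using topological_groupD(3)[OF G] by (simp add: Hausdorff_space_product_topology)
  show "limitin (product_topology X I) (\<lambda>x. f x \<otimes>\<^bsub>product_group I G\<^esub> g x)
      (a \<otimes>\<^bsub>product_group I G\<^esub> b) F"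
    if "limitin (product_topology X I) f a F" "limitin (product_topology X I) g b F"
    for F :: "(('i \<Rightarrow> 'a) \<times> ('i \<Rightarrow> 'a)) filter" and f g a b
  proof -
    have "eventually (\<lambda>x. f x \<in> carrier (product_group I G)) F"
      "eventually (\<lambda>x. g x \<in> carrier (product_group I G)) F"
      using that tP unfolding limitin_componentwise by auto
    then have "eventually (\<lambda>x. f x \<otimes>\<^bsub>product_group I G\<^esub> g x \<in> carrier (product_group I G)) F"
      by eventually_elim (rule monoid.m_closed[OF group.is_monoid[OF product_group[OF gr]]])
    moreover have "limitin (X i) (\<lambda>c. f c i \<otimes>\<^bsub>G i\<^esub> g c i) (a i \<otimes>\<^bsub>G i\<^esub> b i) F" if "i \<in> I" for i
      using limitin_mult[OF G[OF that]] that \<open>limitin _ f a F\<close> \<open>limitin _ g b F\<close>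
      unfolding limitin_componentwise by blast
    ultimately show ?thesis
      unfolding limitin_componentwise tP by simp
  qed
  show "limitin (product_topology X I) (\<lambda>x. inv\<^bsub>product_group I G\<^esub> f x) (inv\<^bsub>product_group I G\<^esub> a) F"
    if l: "limitin (product_topology X I) f a F" for F :: "('i \<Rightarrow> 'a) filter" and f a
  proof -
    have a: "a \<in> carrier (product_group I G)"
      using limitin_topspace[OF l] tP by simp
    have ev: "eventually (\<lambda>x. f x \<in> carrier (product_group I G)) F"
      using l tP unfolding limitin_componentwise by auto
    then have 1: "eventually (\<lambda>x. inv\<^bsub>product_group I G\<^esub> f x \<in> carrier (product_group I G)) F"
      by eventually_elim (rule group.inv_closed[OF product_group[OF gr]])
    have "limitin (X i) (\<lambda>c. (inv\<^bsub>product_group I G\<^esub> f c) i) ((inv\<^bsub>product_group I G\<^esub> a) i) F"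
      if i: "i \<in> I" for i
    proof -
      have "limitin (X i) (\<lambda>c. inv\<^bsub>G i\<^esub> (f c i)) (inv\<^bsub>G i\<^esub> (a i)) F"
        using limitin_inv[OF G[OF i]] i l unfolding limitin_componentwise by blast
      moreover have "eventually (\<lambda>c. inv\<^bsub>G i\<^esub> (f c i) = (inv\<^bsub>product_group I G\<^esub> f c) i) F"
        using ev by eventually_elim (use i gr in \<open>simp add: inv_product_group\<close>)
      moreover have "(inv\<^bsub>product_group I G\<^esub> a) i = inv\<^bsub>G i\<^esub> (a i)"
        using a i gr by (simp add: inv_product_group)
      ultimately show ?thesis
        using limitin_transform_eventually by fastforce
    qed
    then show ?thesis
      unfolding limitin_componentwise tP
      using 1 group.inv_closed[OF product_group[OF gr] a] by (auto simp: PiE_iff)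
  qed
qed

lemma openin_left_translation:
  assumes G: "topological_group G X" and U: "openin X U" and a: "a \<in> carrier G"
  shows "openin X {x \<in> carrier G. a \<otimes>\<^bsub>G\<^esub> x \<in> U}"
proof -
  have "continuous_map X X (\<lambda>x. a \<otimes>\<^bsub>G\<^esub> x)"
    unfolding continuous_map_atin
    using limitin_mult[OF G limitin_group_const[OF G a] limitin_atin_ident] by blast
  from openin_continuous_map_preimage[OF this U] show ?thesis
    using topological_groupD(2)[OF G] by simp
qed

lemma openin_right_translation:
  assumes G: "topological_group G X" and U: "openin X U" and a: "a \<in> carrier G"
  shows "openin X {x \<in> carrier G. x \<otimes>\<^bsub>G\<^esub> a \<in> U}"
proof -
  have "continuous_map X X (\<lambda>x. x \<otimes>\<^bsub>G\<^esub> a)"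
    unfolding continuous_map_atin
    using limitin_mult[OF G limitin_atin_ident limitin_group_const[OF G a]] by blast
  from openin_continuous_map_preimage[OF this U] show ?thesis
    using topological_groupD(2)[OF G] by simp
qed

text \<open>By translation, a group topology is determined by the neighbourhoods of the identity, so
  minimality only has to be tested there.\<close>

lemma minimal_groupI:
  assumes X: "topological_group G X"
    and lim: "\<And>Y. topological_group G Y \<Longrightarrow> (\<And>U. openin Y U \<Longrightarrow> openin X U) \<Longrightarrow>
      limitin X (\<lambda>x. x) \<one>\<^bsub>G\<^esub> (nhdsin Y \<one>\<^bsub>G\<^esub>)"
  shows "minimal_group G X"
  unfolding minimal_group_def
proof (intro conjI allI impI, rule X, elim conjE)
  fix Y assume Y: "topological_group G Y" and le: "\<forall>U. openin Y U \<longrightarrow> openin X U"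
  have gr: "group G" and tX: "topspace X = carrier G" and tY: "topspace Y = carrier G"
    using topological_groupD[OF X] topological_groupD[OF Y] by auto
  interpret group G by (rule gr)
  have "openin Y U" if U: "openin X U" for U
  proof (subst openin_subopen, intro ballI)
    fix a assume aU: "a \<in> U"
    then have a: "a \<in> carrier G" using openin_subset[OF U] tX by auto
    have "openin X {x \<in> carrier G. a \<otimes>\<^bsub>G\<^esub> x \<in> U}"
      by (rule openin_left_translation[OF X U a])
    then have "eventually (\<lambda>x. x \<in> {x \<in> carrier G. a \<otimes>\<^bsub>G\<^esub> x \<in> U}) (nhdsin Y \<one>\<^bsub>G\<^esub>)"
      using le aU a by (intro limitinD[OF lim[OF Y]]) auto
    then have "eventually (\<lambda>x. a \<otimes>\<^bsub>G\<^esub> x \<in> U) (nhdsin Y \<one>\<^bsub>G\<^esub>)"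
      by (rule eventually_mono) simp
    then obtain V where V: "openin Y V" "\<one>\<^bsub>G\<^esub> \<in> V" "\<And>x. x \<in> V \<Longrightarrow> a \<otimes>\<^bsub>G\<^esub> x \<in> U"
      unfolding eventually_nhdsin using tY by auto
    have "openin Y {y \<in> carrier G. inv\<^bsub>G\<^esub> a \<otimes>\<^bsub>G\<^esub> y \<in> V}"
      using Y V(1) inv_closed[OF a] by (rule openin_left_translation)
    moreover have "{y \<in> carrier G. inv\<^bsub>G\<^esub> a \<otimes>\<^bsub>G\<^esub> y \<in> V} \<subseteq> U"
    proof
      fix y assume y: "y \<in> {y \<in> carrier G. inv\<^bsub>G\<^esub> a \<otimes>\<^bsub>G\<^esub> y \<in> V}"
      then have "a \<otimes>\<^bsub>G\<^esub> (inv\<^bsub>G\<^esub> a \<otimes>\<^bsub>G\<^esub> y) \<in> U" using V(3) by blast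
      then show "y \<in> U" using a y by (simp add: m_assoc[symmetric])
    qed
    ultimately show "\<exists>T. openin Y T \<and> a \<in> T \<and> T \<subseteq> U"
      using a V(2) by (intro exI[of _ "{y \<in> carrier G. inv\<^bsub>G\<^esub> a \<otimes>\<^bsub>G\<^esub> y \<in> V}"]) auto
  qed
  then show "Y = X"
    using le by (auto simp: topology_eq)
qed

lemma limit_at_one_neighbourhood:
  assumes G: "topological_group G X"
    and lim: "limitin X (\<lambda>p. h (fst p) (snd p)) l (nhdsin X \<one>\<^bsub>G\<^esub> \<times>\<^sub>F nhdsin X \<one>\<^bsub>G\<^esub>)"
    and V: "openin X V" "l \<in> V"
  obtains W where "openin X W" "\<one>\<^bsub>G\<^esub> \<in> W" "\<And>a b. a \<in> W \<Longrightarrow> b \<in> W \<Longrightarrow> h a b \<in> V"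
proof -
  have one: "\<one>\<^bsub>G\<^esub> \<in> topspace X"
    using topological_groupD[OF G] group.is_monoid monoid.one_closed by metis
  have "eventually (\<lambda>p. h (fst p) (snd p) \<in> V) (nhdsin X \<one>\<^bsub>G\<^esub> \<times>\<^sub>F nhdsin X \<one>\<^bsub>G\<^esub>)"
    using limitinD[OF lim V] .
  then obtain P Q where P: "eventually P (nhdsin X \<one>\<^bsub>G\<^esub>)" and Q: "eventually Q (nhdsin X \<one>\<^bsub>G\<^esub>)"
    and PQ: "\<And>x y. P x \<Longrightarrow> Q y \<Longrightarrow> h x y \<in> V"
    unfolding eventually_prod_filter by auto
  obtain A B where "openin X A" "\<one>\<^bsub>G\<^esub> \<in> A" "\<forall>x\<in>A. P x" "openin X B" "\<one>\<^bsub>G\<^esub> \<in> B" "\<forall>x\<in>B. Q x"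
    using P Q one unfolding eventually_nhdsin by blast
  then show ?thesis
    using that[of "A \<inter> B"] PQ by (simp add: openin_Int)
qed

lemma limitin_prod_nhdsin:
  assumes G: "topological_group G X"
  shows "limitin X fst \<one>\<^bsub>G\<^esub> (nhdsin X \<one>\<^bsub>G\<^esub> \<times>\<^sub>F nhdsin X \<one>\<^bsub>G\<^esub>)"
    "limitin X snd \<one>\<^bsub>G\<^esub> (nhdsin X \<one>\<^bsub>G\<^esub> \<times>\<^sub>F nhdsin X \<one>\<^bsub>G\<^esub>)"
proof -
  have "\<one>\<^bsub>G\<^esub> \<in> topspace X"
    using topological_groupD[OF G] group.is_monoid monoid.one_closed by metis
  then show "limitin X fst \<one>\<^bsub>G\<^esub> (nhdsin X \<one>\<^bsub>G\<^esub> \<times>\<^sub>F nhdsin X \<one>\<^bsub>G\<^esub>)"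
    "limitin X snd \<one>\<^bsub>G\<^esub> (nhdsin X \<one>\<^bsub>G\<^esub> \<times>\<^sub>F nhdsin X \<one>\<^bsub>G\<^esub>)"
    by (simp_all add: limitin_fst limitin_snd)
qed

section \<open>Comparing a group with a larger topological group\<close>

text \<open>The coarser topology is the one that \<open>S\<close> inherits from \<open>G / N\<close>: its open sets are the traces of open
  sets that are unions of cosets of \<open>N\<close>. It is Hausdorff because \<open>N\<close> is closed and meets \<open>S\<close> trivially.
  It is strictly coarser because elements of \<open>S\<close> that converge to \<open>c\<close> in \<open>G\<close> converge to the identity in
  \<open>G / N\<close>.\<close>

lemma not_minimal_of_central_subgroup:
  fixes G :: "('a, 'b) monoid_scheme" (structure)
  assumes G: "topological_group G X" and S: "subgroup S G" and N: "subgroup N G"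
    and cN: "closedin X N"
    and central: "\<And>n x. n \<in> N \<Longrightarrow> x \<in> carrier G \<Longrightarrow> n \<otimes> x = x \<otimes> n"
    and triv: "N \<inter> S = {\<one>}"
    and c: "c \<in> N" "c \<noteq> \<one>" "c \<in> X closure_of S"
  shows "\<not> minimal_group (G\<lparr>carrier := S\<rparr>) (subtopology X S)"
proof
  assume min: "minimal_group (G\<lparr>carrier := S\<rparr>) (subtopology X S)"
  have gr: "group G" and tX: "topspace X = carrier G"
    using topological_groupD[OF G] by auto
  interpret group G by (rule gr)
  have NG: "N \<subseteq> carrier G" and SG: "S \<subseteq> carrier G"
    using subgroup.subset N S by blast+
  define sat where "sat W \<longleftrightarrow> openin X W \<and> (\<forall>x\<in>W. \<forall>n\<in>N. x \<otimes> n \<in> W)" for W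
  define Y where "Y = topology (\<lambda>U. \<exists>W. sat W \<and> U = W \<inter> S)"
  have "istopology (\<lambda>U. \<exists>W. sat W \<and> U = W \<inter> S)"
    unfolding istopology_def
  proof (intro conjI allI impI)
    fix U V assume "\<exists>W. sat W \<and> U = W \<inter> S" "\<exists>W. sat W \<and> V = W \<inter> S"
    then obtain A B where "sat A" "U = A \<inter> S" "sat B" "V = B \<inter> S" by blast
    then show "\<exists>W. sat W \<and> U \<inter> V = W \<inter> S"
      by (intro exI[of _ "A \<inter> B"]) (auto simp: sat_def)
  next
    fix \<U> assume "\<forall>U\<in>\<U>. \<exists>W. sat W \<and> U = W \<inter> S"
    then obtain w where w: "\<And>U. U \<in> \<U> \<Longrightarrow> sat (w U) \<and> U = w U \<inter> S" by metis
    then have "sat (\<Union>U\<in>\<U>. w U)"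
      unfolding sat_def by blast
    moreover have "\<Union>\<U> = (\<Union>U\<in>\<U>. w U) \<inter> S" using w by blast
    ultimately show "\<exists>W. sat W \<and> \<Union>\<U> = W \<inter> S" by blast
  qed
  then have oY: "openin Y U \<longleftrightarrow> (\<exists>W. sat W \<and> U = W \<inter> S)" for U
    by (simp add: Y_def)
  have "sat (carrier G)"
    using NG tX openin_topspace[of X] by (auto simp: sat_def)
  then have "openin Y S"
    unfolding oY using SG by blast
  then have tY: "topspace Y = S"
    unfolding topspace_def oY by auto
  \<comment> \<open>The saturation of an open set is open, being a union of translates.\<close>
  define satur where "satur A = {x \<in> carrier G. \<exists>n\<in>N. x \<otimes> n \<in> A}" for A
  have sat_satur: "sat (satur A)" if A: "openin X A" for A
  proof -
    have "satur A = (\<Union>n\<in>N. {x \<in> carrier G. x \<otimes> n \<in> A})"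
      by (auto simp: satur_def)
    then have "openin X (satur A)"
      using NG openin_right_translation[OF G A] by (auto intro!: openin_Union)
    moreover have "x \<otimes> n \<in> satur A" if x: "x \<in> satur A" and n: "n \<in> N" for x n
    proof -
      obtain m where m: "x \<in> carrier G" "m \<in> N" "x \<otimes> m \<in> A"
        using x by (auto simp: satur_def)
      have "x \<otimes> n \<otimes> (inv n \<otimes> m) = x \<otimes> m"
        using m n NG by (simp add: m_assoc subset_iff) (simp add: m_assoc[symmetric] subset_iff)
      then have "x \<otimes> n \<otimes> (inv n \<otimes> m) \<in> A" using m(3) by simp
      moreover have "inv n \<otimes> m \<in> N"
        using m(2) n N by (simp add: subgroup.m_closed subgroup.m_inv_closed)
      ultimately show ?thesis
        using m(1) n NG unfolding satur_def by blast
    qed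
    ultimately show ?thesis by (simp add: sat_def)
  qed
  have satur_sub: "A \<subseteq> satur A" if "openin X A" for A
  proof
    fix x assume x: "x \<in> A"
    then have "x \<in> carrier G" using openin_subset[OF that] tX by blast
    then show "x \<in> satur A"
      using x subgroup.one_closed[OF N] by (auto simp: satur_def intro!: bexI[of _ "\<one>"])
  qed
  have gS: "group (G\<lparr>carrier := S\<rparr>)"
    using S gr by (rule subgroup.subgroup_is_group)
  have topY: "topological_group (G\<lparr>carrier := S\<rparr>) Y"
  proof (rule topological_groupI)
    show "Hausdorff_space Y"
      unfolding Hausdorff_space_def tY
    proof (intro allI impI, elim conjE)
      fix x y assume x: "x \<in> S" and y: "y \<in> S" and ne: "x \<noteq> y"
      have xy: "x \<in> carrier G" "y \<in> carrier G" using x y SG by auto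
      have nN: "inv x \<otimes> y \<notin> N"
      proof
        assume "inv x \<otimes> y \<in> N"
        moreover have "inv x \<otimes> y \<in> S"
          using x y S by (simp add: subgroup.m_closed subgroup.m_inv_closed)
        ultimately have "inv x \<otimes> y = \<one>" using triv by blast
        then show False using xy ne inv_equality inv_inv by fastforce
      qed
      have lim: "limitin X (\<lambda>p. inv (fst p) \<otimes> snd p) (inv x \<otimes> y)
          (nhdsin X x \<times>\<^sub>F nhdsin X y)"
      proof -
        have "limitin X fst x (nhdsin X x \<times>\<^sub>F nhdsin X y)"
          "limitin X snd y (nhdsin X x \<times>\<^sub>F nhdsin X y)"
          using xy tX by (simp_all add: limitin_fst limitin_snd)
        then show ?thesis
          using limitin_mult[OF G limitin_inv[OF G]] by blast
      qed
      have "openin X (topspace X - N)" using cN by blast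
      then have "eventually (\<lambda>p. inv (fst p) \<otimes> snd p \<in> topspace X - N) (nhdsin X x \<times>\<^sub>F nhdsin X y)"
        by (rule limitinD[OF lim]) (use nN xy tX in simp)
      then obtain P Q where P: "eventually P (nhdsin X x)" and Q: "eventually Q (nhdsin X y)"
        and PQ: "\<And>a b. P a \<Longrightarrow> Q b \<Longrightarrow> inv a \<otimes> b \<notin> N"
        unfolding eventually_prod_filter by auto
      obtain A B where A: "openin X A" "x \<in> A" "\<forall>a\<in>A. P a" and B: "openin X B" "y \<in> B" "\<forall>b\<in>B. Q b"
        using P Q xy tX unfolding eventually_nhdsin by blast
      have "disjnt (satur A \<inter> S) (satur B \<inter> S)"
        unfolding disjnt_iff
      proof (intro allI notI)
        fix z assume "z \<in> satur A \<inter> S \<and> z \<in> satur B \<inter> S"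
        then obtain n m where nm: "z \<in> carrier G" "n \<in> N" "m \<in> N"
            "z \<otimes> n \<in> A" "z \<otimes> m \<in> B"
          by (auto simp: satur_def)
        have "inv (z \<otimes> n) \<otimes> (z \<otimes> m) = inv n \<otimes> m"
          using nm NG by (simp add: inv_mult_group m_assoc subset_iff)
            (simp add: m_assoc[symmetric] subset_iff)
        then show False
          using PQ[of "z \<otimes> n" "z \<otimes> m"] A(3) B(3) nm subgroup.m_closed[OF N]
            subgroup.m_inv_closed[OF N] by simp
      qed
      moreover have "openin Y (satur A \<inter> S)" "openin Y (satur B \<inter> S)"
        using sat_satur A(1) B(1) unfolding oY by blast+
      ultimately show "\<exists>U V. openin Y U \<and> openin Y V \<and> x \<in> U \<and> y \<in> V \<and> disjnt U V"
        using satur_sub[OF A(1)] satur_sub[OF B(1)] A(2) B(2) x y by blast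
    qed
    show "limitin Y (\<lambda>x. f x \<otimes>\<^bsub>G\<lparr>carrier := S\<rparr>\<^esub> g x) (a \<otimes>\<^bsub>G\<lparr>carrier := S\<rparr>\<^esub> b) F"
      if f: "limitin Y f a F" and g: "limitin Y g b F" for F :: "('a \<times> 'a) filter" and f g a b
      unfolding limitin_def tY
    proof (intro conjI allI impI, goal_cases)
      case 1
      then show ?case
        using limitin_topspace[OF f] limitin_topspace[OF g] tY subgroup.m_closed[OF S] by simp
    next
      case (2 U)
      have ab: "a \<in> S" "b \<in> S" "a \<in> carrier G" "b \<in> carrier G"
        using limitin_topspace[OF f] limitin_topspace[OF g] tY SG by auto
      obtain W where W: "sat W" "U = W \<inter> S" using 2 oY by blast
      have "limitin X (\<lambda>p. fst p \<otimes> snd p) (a \<otimes> b) (nhdsin X a \<times>\<^sub>F nhdsin X b)"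
      proof -
        have "limitin X fst a (nhdsin X a \<times>\<^sub>F nhdsin X b)"
          "limitin X snd b (nhdsin X a \<times>\<^sub>F nhdsin X b)"
          using ab tX by (simp_all add: limitin_fst limitin_snd)
        then show ?thesis using limitin_mult[OF G] by blast
      qed
      then have "eventually (\<lambda>p. fst p \<otimes> snd p \<in> W) (nhdsin X a \<times>\<^sub>F nhdsin X b)"
        using W 2 unfolding sat_def limitin_def by auto
      then obtain P Q where P: "eventually P (nhdsin X a)" and Q: "eventually Q (nhdsin X b)"
        and PQ: "\<And>x y. P x \<Longrightarrow> Q y \<Longrightarrow> x \<otimes> y \<in> W"
        unfolding eventually_prod_filter by auto
      obtain A B where A: "openin X A" "a \<in> A" "\<forall>a\<in>A. P a" and B: "openin X B" "b \<in> B" "\<forall>b\<in>B. Q b"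
        using P Q ab tX unfolding eventually_nhdsin by blast
      have "eventually (\<lambda>x. f x \<in> satur A \<inter> S) F" "eventually (\<lambda>x. g x \<in> satur B \<inter> S) F"
        using limitinD[OF f, of "satur A \<inter> S"] limitinD[OF g, of "satur B \<inter> S"] oY
          sat_satur[OF A(1)] sat_satur[OF B(1)] satur_sub[OF A(1)] satur_sub[OF B(1)] A B ab
        by blast+
      then show ?case
      proof eventually_elim
        case (elim t)
        then obtain n m where nm: "n \<in> N" "m \<in> N" "f t \<in> S" "g t \<in> S"
            "f t \<otimes> n \<in> A" "g t \<otimes> m \<in> B"
          by (auto simp: satur_def)
        have cl: "f t \<in> carrier G" "g t \<in> carrier G" "n \<in> carrier G" "m \<in> carrier G"
          using nm NG SG by auto
        have "f t \<otimes> n \<otimes> (g t \<otimes> m) = f t \<otimes> (n \<otimes> g t) \<otimes> m"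
          using cl by (simp add: m_assoc)
        also have "\<dots> = f t \<otimes> g t \<otimes> (n \<otimes> m)"
          unfolding central[OF nm(1) cl(2)] using cl by (simp add: m_assoc)
        finally have "f t \<otimes> g t \<otimes> (n \<otimes> m) \<in> W"
          using PQ A(3) B(3) nm by metis
        then have "f t \<otimes> g t \<otimes> (n \<otimes> m) \<otimes> inv (n \<otimes> m) \<in> W"
          using W(1) nm subgroup.m_closed[OF N] subgroup.m_inv_closed[OF N] unfolding sat_def by blast
        then show ?case
          using cl nm W(2) subgroup.m_closed[OF S] by (simp add: m_assoc r_inv del: inv_mult_group)
      qed
    qed
    show "limitin Y (\<lambda>x. inv\<^bsub>G\<lparr>carrier := S\<rparr>\<^esub> f x) (inv\<^bsub>G\<lparr>carrier := S\<rparr>\<^esub> a) F"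
      if f: "limitin Y f a F" for F :: "'a filter" and f a
      unfolding limitin_def tY
    proof (intro conjI allI impI, goal_cases)
      case 1
      then show ?case
        using limitin_topspace[OF f] tY group.inv_closed[OF gS, of a] by simp
    next
      case (2 U)
      have a: "a \<in> S" "a \<in> carrier G"
        using limitin_topspace[OF f] tY SG by auto
      have inv: "inv\<^bsub>G\<lparr>carrier := S\<rparr>\<^esub> x = inv x" if "x \<in> S" for x
        using group.m_inv_consistent[OF gr S that] .
      obtain W where W: "sat W" "U = W \<inter> S" using 2 oY by blast
      have "continuous_map X X (\<lambda>x. inv x)"
        using G by (simp add: topological_group_def)
      then have o: "openin X {x \<in> topspace X. inv x \<in> W}"
        using W(1) openin_continuous_map_preimage unfolding sat_def by blast
      have "x \<otimes> n \<in> {x \<in> topspace X. inv x \<in> W}"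
        if "x \<in> {x \<in> topspace X. inv x \<in> W}" "n \<in> N" for x n
      proof -
        have "inv x \<otimes> inv n \<in> W"
          using that W(1) subgroup.m_inv_closed[OF N] unfolding sat_def by blast
        moreover have "inv (x \<otimes> n) = inv x \<otimes> inv n"
          using that tX NG central[of "inv n" "inv x"] subgroup.m_inv_closed[OF N]
          by (simp add: inv_mult_group subset_iff)
        ultimately show ?thesis using that tX NG by auto
      qed
      then have "sat {x \<in> topspace X. inv x \<in> W}" using o unfolding sat_def by blast
      then have "openin Y ({x \<in> topspace X. inv x \<in> W} \<inter> S)" unfolding oY by blast
      then have "eventually (\<lambda>x. f x \<in> {x \<in> topspace X. inv x \<in> W} \<inter> S) F"
        by (rule limitinD[OF f]) (use a 2 W(2) inv tX in auto)
      then show ?case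
        by eventually_elim (use W(2) inv subgroup.m_inv_closed[OF S] in auto)
    qed
  qed (use gS tY in auto)
  have "openin (subtopology X S) U" if "openin Y U" for U
    using that unfolding oY sat_def openin_subtopology by blast
  then have YX: "Y = subtopology X S"
    using min topY unfolding minimal_group_def by blast
  have cG: "c \<in> topspace X" and oneG: "\<one> \<in> topspace X" using c(1) NG tX by auto
  then obtain E E' where E: "openin X E" "openin X E'" "\<one> \<in> E" "c \<in> E'" "disjnt E E'"
    using topological_groupD(3)[OF G] c(2) unfolding Hausdorff_space_def by metis
  have "openin Y (E \<inter> S)"
    using E(1) YX by (auto simp: openin_subtopology)
  then obtain W where W: "sat W" "E \<inter> S = W \<inter> S"
    unfolding oY by blast
  have "\<one> \<in> W"
    using W(2) E(3) subgroup.one_closed[OF S] by blast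
  then have "\<one> \<otimes> c \<in> W"
    using W(1) c(1) unfolding sat_def by blast
  then have "c \<in> W \<inter> E'" using E(4) c(1) NG by auto
  moreover have "openin X (W \<inter> E')" using W(1) E(2) unfolding sat_def by blast
  ultimately obtain y where "y \<in> S" "y \<in> W \<inter> E'"
    using c(3) unfolding in_closure_of by blast
  then show False using W(2) E(5) by (auto simp: disjnt_iff)
qed

text \<open>Conjugation by a single element of \<open>S\<close> is continuous for \<open>Y\<close>. Compactness of \<open>C\<close> reduces the claim to
  finitely many such elements, because two elements of \<open>S\<close> that are close in \<open>G\<close> differ by a factor that is
  small for the coarser topology \<open>Y\<close> as well.\<close>

lemma uniform_conjugation_neighbourhood:
  fixes G :: "('a, 'b) monoid_scheme" (structure)
  assumes G: "topological_group G X" and S: "subgroup S G"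
    and Y: "topological_group (G\<lparr>carrier := S\<rparr>) Y"
    and le: "\<And>U. openin Y U \<Longrightarrow> openin (subtopology X S) U"
    and C: "compactin X C" and V: "openin Y V" "\<one> \<in> V"
  obtains V' where "openin Y V'" "\<one> \<in> V'"
    "\<And>q v. q \<in> C \<Longrightarrow> q \<in> S \<Longrightarrow> v \<in> V' \<Longrightarrow> inv q \<otimes> v \<otimes> q \<in> V"
proof -
  have gr: "group G" and tX: "topspace X = carrier G"
    using topological_groupD[OF G] by auto
  interpret group G by (rule gr)
  let ?H = "G\<lparr>carrier := S\<rparr>"
  have tY: "topspace Y = S" using topological_groupD(2)[OF Y] by simp
  have SG: "S \<subseteq> carrier G" by (rule subgroup.subset[OF S])
  have CG: "C \<subseteq> carrier G" using compactin_subset_topspace[OF C] tX by simp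
  have inv: "inv\<^bsub>?H\<^esub> x = inv x" if "x \<in> S" for x
    using group.m_inv_consistent[OF gr S that] .
  have lim: "limitin Y (\<lambda>p. inv\<^bsub>?H\<^esub> (fst p) \<otimes>\<^bsub>?H\<^esub> snd p \<otimes>\<^bsub>?H\<^esub> fst p)
      (inv\<^bsub>?H\<^esub> \<one>\<^bsub>?H\<^esub> \<otimes>\<^bsub>?H\<^esub> \<one>\<^bsub>?H\<^esub> \<otimes>\<^bsub>?H\<^esub> \<one>\<^bsub>?H\<^esub>)
      (nhdsin Y \<one>\<^bsub>?H\<^esub> \<times>\<^sub>F nhdsin Y \<one>\<^bsub>?H\<^esub>)"
    by (intro limitin_mult[OF Y] limitin_inv[OF Y] limitin_prod_nhdsin[OF Y])
  have "inv\<^bsub>?H\<^esub> \<one>\<^bsub>?H\<^esub> \<otimes>\<^bsub>?H\<^esub> \<one>\<^bsub>?H\<^esub> \<otimes>\<^bsub>?H\<^esub> \<one>\<^bsub>?H\<^esub> \<in> V"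
    using inv[OF subgroup.one_closed[OF S]] V(2) by simp
  then obtain V0 where V0: "openin Y V0" "\<one>\<^bsub>?H\<^esub> \<in> V0"
    and h: "\<And>a v. a \<in> V0 \<Longrightarrow> v \<in> V0 \<Longrightarrow> inv\<^bsub>?H\<^esub> a \<otimes>\<^bsub>?H\<^esub> v \<otimes>\<^bsub>?H\<^esub> a \<in> V"
    using limit_at_one_neighbourhood[OF Y, where h = "\<lambda>a v. inv\<^bsub>?H\<^esub> a \<otimes>\<^bsub>?H\<^esub> v \<otimes>\<^bsub>?H\<^esub> a", OF lim V(1)]
    by blast
  have V0V: "inv a \<otimes> v \<otimes> a \<in> V" if "a \<in> V0" "v \<in> V0" for a v
    using h[OF that] inv openin_subset[OF V0(1)] tY that(1) by auto
  obtain W where W: "openin X W" "V0 = W \<inter> S"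
    using le[OF V0(1)] by (auto simp: openin_subtopology)
  have lim: "limitin X (\<lambda>p. inv (fst p) \<otimes> snd p) (inv \<one> \<otimes> \<one>)
      (nhdsin X \<one> \<times>\<^sub>F nhdsin X \<one>)"
    by (intro limitin_mult[OF G] limitin_inv[OF G] limitin_prod_nhdsin[OF G])
  have "inv \<one> \<otimes> \<one> \<in> W"
    using W(2) V0(2) by simp
  then obtain W' where W': "openin X W'" "\<one> \<in> W'"
      and W'W: "\<And>x y. x \<in> W' \<Longrightarrow> y \<in> W' \<Longrightarrow> inv x \<otimes> y \<in> W"
    using limit_at_one_neighbourhood[OF G, where h = "\<lambda>x y. inv x \<otimes> y", OF lim W(1)] by blast
  define T where "T x = {y \<in> carrier G. inv x \<otimes> y \<in> W'}" for x
  have "\<exists>\<F>. finite \<F> \<and> \<F> \<subseteq> T ` C \<and> C \<subseteq> \<Union>\<F>"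
  proof -
    have "\<And>U. U \<in> T ` C \<Longrightarrow> openin X U"
      using openin_left_translation[OF G W'(1)] CG unfolding T_def by auto
    moreover have "C \<subseteq> \<Union>(T ` C)"
    proof
      fix x assume x: "x \<in> C"
      then have "x \<in> T x" using CG W'(2) unfolding T_def by auto
      then show "x \<in> \<Union>(T ` C)" using x by blast
    qed
    ultimately show ?thesis using C unfolding compactin_def by blast
  qed
  then obtain D where D: "finite D" "D \<subseteq> C" "C \<subseteq> (\<Union>x\<in>D. T x)"
    by (metis finite_subset_image)
  define s where "s x = (SOME q. q \<in> C \<inter> S \<inter> T x)" for x
  define D' where "D' = {x \<in> D. C \<inter> S \<inter> T x \<noteq> {}}"
  have s: "s x \<in> C \<inter> S \<inter> T x" if "x \<in> D'" for x
  proof -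
    have "\<exists>q. q \<in> C \<inter> S \<inter> T x" using that unfolding D'_def by blast
    then show ?thesis unfolding s_def by (rule someI_ex)
  qed
  define V' where "V' = S \<inter> (\<Inter>x\<in>D'. {v \<in> S. inv (s x) \<otimes> v \<otimes> s x \<in> V0})"
  have conj_open: "openin Y {v \<in> S. inv q \<otimes> v \<otimes> q \<in> V0}" if q: "q \<in> S" for q
  proof -
    have 1: "openin Y {v \<in> carrier ?H. v \<otimes>\<^bsub>?H\<^esub> q \<in> V0}"
      using openin_right_translation[OF Y V0(1)] q by simp
    have "openin Y {v \<in> carrier ?H. inv q \<otimes>\<^bsub>?H\<^esub> v \<in> {v \<in> carrier ?H. v \<otimes>\<^bsub>?H\<^esub> q \<in> V0}}"
      using openin_left_translation[OF Y 1] q subgroup.m_inv_closed[OF S] by simp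
    also have "{v \<in> carrier ?H. inv q \<otimes>\<^bsub>?H\<^esub> v \<in> {v \<in> carrier ?H. v \<otimes>\<^bsub>?H\<^esub> q \<in> V0}}
        = {v \<in> S. inv q \<otimes> v \<otimes> q \<in> V0}"
      using q subgroup.m_inv_closed[OF S] subgroup.m_closed[OF S] by auto
    finally show ?thesis .
  qed
  have "openin Y V'"
  proof -
    have "finite D'" using D(1) unfolding D'_def by simp
    moreover have "openin Y S" using openin_topspace[of Y] tY by simp
    ultimately show ?thesis
      unfolding V'_def using conj_open s
      by (cases "D' = {}") (auto intro!: openin_Int openin_Inter)
  qed
  moreover have "\<one> \<in> V'"
    using s V0(2) CG subgroup.one_closed[OF S] unfolding V'_def by (fastforce simp: l_inv)
  moreover have "inv q \<otimes> v \<otimes> q \<in> V" if q: "q \<in> C" "q \<in> S" and v: "v \<in> V'" for q v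
  proof -
    obtain x where x: "x \<in> D" "q \<in> T x" using q(1) D(3) by blast
    then have xD': "x \<in> D'" using q unfolding D'_def by blast
    note sx = s[OF xD']
    have cl: "x \<in> carrier G" "q \<in> carrier G" "v \<in> carrier G" "s x \<in> carrier G" "v \<in> S"
      using x(1) D(2) CG q v SG sx unfolding V'_def by auto
    define a where "a = inv (s x) \<otimes> q"
    have "a = inv (inv x \<otimes> s x) \<otimes> (inv x \<otimes> q)"
      unfolding a_def using cl by (simp add: inv_mult_group m_assoc) (simp add: m_assoc[symmetric])
    then have "a \<in> W" using W'W sx x(2) unfolding T_def by simp
    moreover have "a \<in> S"
      unfolding a_def using sx q(2) subgroup.m_closed[OF S] subgroup.m_inv_closed[OF S] by blast
    ultimately have a: "a \<in> V0" using W(2) by blast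
    have w: "inv (s x) \<otimes> v \<otimes> s x \<in> V0"
      using v xD' unfolding V'_def by blast
    have "inv a \<otimes> (inv (s x) \<otimes> v \<otimes> s x) \<otimes> a = inv q \<otimes> v \<otimes> q"
    proof -
      have "s x \<otimes> a = q" "inv a \<otimes> inv (s x) = inv q" "a \<in> carrier G"
        unfolding a_def using cl by (simp_all add: inv_mult_group m_assoc[symmetric])
          (simp add: m_assoc)
      then show ?thesis using cl
        by (metis inv_closed m_assoc m_closed)
    qed
    then show ?thesis using V0V[OF a w] by simp
  qed
  ultimately show ?thesis using that by blast
qed

text \<open>This passes from triangular matrices to all matrices. An element \<open>g\<close> of \<open>S\<close> is conjugate to an element of
  \<open>T\<close> by some \<open>p\<close> from a compact set, but \<open>p\<close> need not belong to \<open>S\<close>. Approximating \<open>p\<close> by \<open>q\<close> in \<open>S\<close> and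
  the conjugate by \<open>b\<close> in \<open>S \<inter> T\<close>, one gets \<open>q\<^sup>-\<^sup>1 g q = b r\<close> with \<open>r\<close> as small as desired. If \<open>g\<close> is
  small for \<open>Y\<close>, so is \<open>q\<^sup>-\<^sup>1 g q\<close>, uniformly in \<open>q\<close>, and hence \<open>b\<close>. On \<open>S \<inter> T\<close> smallness for \<open>Y\<close> is the same
  as smallness in \<open>G\<close>, so that \<open>b r\<close> and finally \<open>g\<close> are small in \<open>G\<close>.\<close>

lemma coarser_topology_conjugation_transfer:
  fixes G :: "('a, 'b) monoid_scheme" (structure)
  assumes G: "topological_group G X" and S: "subgroup S G" and T: "subgroup T G"
    and Y: "topological_group (G\<lparr>carrier := S\<rparr>) Y"
    and le: "\<And>U. openin Y U \<Longrightarrow> openin (subtopology X S) U"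
    and agree: "\<And>U. openin X U \<Longrightarrow> \<one> \<in> U \<Longrightarrow> \<exists>V. openin Y V \<and> \<one> \<in> V \<and> V \<inter> T \<subseteq> U"
    and C: "compactin X C" and D: "openin X D" "D \<subseteq> C"
    and dense_S: "D \<subseteq> X closure_of S" and dense_T: "T \<subseteq> X closure_of (S \<inter> T)"
    and conj: "\<And>g. g \<in> S \<Longrightarrow> \<exists>p\<in>D. inv p \<otimes> g \<otimes> p \<in> T"
  shows "limitin (subtopology X S) (\<lambda>x. x) \<one> (nhdsin Y \<one>)"
proof -
  have gr: "group G" and tX: "topspace X = carrier G"
    using topological_groupD[OF G] by auto
  interpret group G by (rule gr)
  let ?H = "G\<lparr>carrier := S\<rparr>"
  have tY: "topspace Y = S" using topological_groupD(2)[OF Y] by simp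
  have SG: "S \<subseteq> carrier G" and TG: "T \<subseteq> carrier G"
    using subgroup.subset S T by blast+
  have inv: "inv\<^bsub>?H\<^esub> x = inv x" if "x \<in> S" for x
    using group.m_inv_consistent[OF gr S that] .
  have main: "\<exists>V. openin Y V \<and> \<one> \<in> V \<and> V \<subseteq> U" if U: "openin X U" "\<one> \<in> U" for U
  proof -
    have C': "compactin X ((\<lambda>x. inv x) ` C)"
      using G C image_compactin unfolding topological_group_def by blast
    obtain U1 where U1: "openin X U1" "\<one> \<in> U1"
      and U1U: "\<And>q v. q \<in> (\<lambda>x. inv x) ` C \<Longrightarrow> q \<in> carrier G \<Longrightarrow> v \<in> U1 \<Longrightarrow>
        inv q \<otimes> v \<otimes> q \<in> U"
    proof (rule uniform_conjugation_neighbourhood[OF G _ _ _ C' U])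
      show "subgroup (carrier G) G" by (rule subgroup_self)
      show "topological_group (G\<lparr>carrier := carrier G\<rparr>) X" using G by simp
      show "openin (subtopology X (carrier G)) U" if "openin X U" for U
        using that by (simp add: tX[symmetric])
    qed blast
    have lim: "limitin X (\<lambda>p. fst p \<otimes> snd p) (\<one> \<otimes> \<one>) (nhdsin X \<one> \<times>\<^sub>F nhdsin X \<one>)"
      by (intro limitin_mult[OF G] limitin_prod_nhdsin[OF G])
    have "\<one> \<otimes> \<one> \<in> U1" using U1(2) by simp
    then obtain U2 where U2: "openin X U2" "\<one> \<in> U2"
      and U2U: "\<And>x y. x \<in> U2 \<Longrightarrow> y \<in> U2 \<Longrightarrow> x \<otimes> y \<in> U1"
      using limit_at_one_neighbourhood[OF G, where h = "\<lambda>x y. x \<otimes> y", OF lim U1(1)] by blast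
    obtain V2 where V2: "openin Y V2" "\<one> \<in> V2" "V2 \<inter> T \<subseteq> U2"
      using agree[OF U2] by blast
    have lim: "limitin Y (\<lambda>p. fst p \<otimes>\<^bsub>?H\<^esub> inv\<^bsub>?H\<^esub> (snd p)) (\<one>\<^bsub>?H\<^esub> \<otimes>\<^bsub>?H\<^esub> inv\<^bsub>?H\<^esub> \<one>\<^bsub>?H\<^esub>)
        (nhdsin Y \<one>\<^bsub>?H\<^esub> \<times>\<^sub>F nhdsin Y \<one>\<^bsub>?H\<^esub>)"
      by (intro limitin_mult[OF Y] limitin_inv[OF Y] limitin_prod_nhdsin[OF Y])
    have "\<one>\<^bsub>?H\<^esub> \<otimes>\<^bsub>?H\<^esub> inv\<^bsub>?H\<^esub> \<one>\<^bsub>?H\<^esub> \<in> V2"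
      using inv[OF subgroup.one_closed[OF S]] V2(2) by simp
    then obtain V3 where V3: "openin Y V3" "\<one>\<^bsub>?H\<^esub> \<in> V3"
      and h: "\<And>a v. a \<in> V3 \<Longrightarrow> v \<in> V3 \<Longrightarrow> a \<otimes>\<^bsub>?H\<^esub> inv\<^bsub>?H\<^esub> v \<in> V2"
      using limit_at_one_neighbourhood[OF Y, where h = "\<lambda>a v. a \<otimes>\<^bsub>?H\<^esub> inv\<^bsub>?H\<^esub> v", OF lim V2(1)] by blast
    have V3_one: "\<one> \<in> V3" using V3(2) by simp
    have V32: "a \<otimes> inv v \<in> V2" if "a \<in> V3" "v \<in> V3" for a v
      using h[OF that] inv that openin_subset[OF V3(1)] tY by auto
    obtain W where W: "openin X W" "V3 = W \<inter> S"
      using le[OF V3(1)] by (auto simp: openin_subtopology)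
    obtain V where V: "openin Y V" "\<one> \<in> V"
      and conjV: "\<And>q v. q \<in> C \<Longrightarrow> q \<in> S \<Longrightarrow> v \<in> V \<Longrightarrow> inv q \<otimes> v \<otimes> q \<in> V3"
      using uniform_conjugation_neighbourhood[OF G S Y le C V3(1) V3_one] by blast
    have "g \<in> U" if g: "g \<in> V" for g
    proof -
      have gS: "g \<in> S" "g \<in> carrier G" using g openin_subset[OF V(1)] tY SG by auto
      obtain p where p: "p \<in> D" "inv p \<otimes> g \<otimes> p \<in> T" using conj[OF gS(1)] by blast
      define t where "t = inv p \<otimes> g \<otimes> p"
      have pG: "p \<in> carrier G" using p(1) openin_subset[OF D(1)] tX by blast
      have tG: "t \<in> carrier G" using p(2) TG t_def by auto
      \<comment> \<open>Approximate the conjugator and the triangular form simultaneously by elements of \<open>S\<close>.\<close>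
      have "limitin X (\<lambda>x. inv (snd x) \<otimes> (inv (fst x) \<otimes> g \<otimes> fst x))
          (inv t \<otimes> (inv p \<otimes> g \<otimes> p)) (nhdsin X p \<times>\<^sub>F nhdsin X t)"
      proof -
        have "limitin X fst p (nhdsin X p \<times>\<^sub>F nhdsin X t)"
          "limitin X snd t (nhdsin X p \<times>\<^sub>F nhdsin X t)"
          using pG tG tX by (simp_all add: limitin_fst limitin_snd)
        then show ?thesis
          by (intro limitin_mult[OF G] limitin_inv[OF G] limitin_group_const[OF G] gS(2))
      qed
      moreover have "inv t \<otimes> (inv p \<otimes> g \<otimes> p) = \<one>"
        using tG unfolding t_def[symmetric] by simp
      moreover have "openin X (W \<inter> U2)" "\<one> \<in> W \<inter> U2"
        using W V3_one U2 by auto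
      ultimately have "eventually (\<lambda>x. inv (snd x) \<otimes> (inv (fst x) \<otimes> g \<otimes> fst x) \<in> W \<inter> U2)
          (nhdsin X p \<times>\<^sub>F nhdsin X t)"
        unfolding limitin_def by auto
      then obtain P Q where P: "eventually P (nhdsin X p)" and Q: "eventually Q (nhdsin X t)"
        and PQ: "\<And>x y. P x \<Longrightarrow> Q y \<Longrightarrow> inv y \<otimes> (inv x \<otimes> g \<otimes> x) \<in> W \<inter> U2"
        unfolding eventually_prod_filter by auto
      obtain A B where A: "openin X A" "p \<in> A" "\<forall>a\<in>A. P a" and B: "openin X B" "t \<in> B" "\<forall>b\<in>B. Q b"
        using P Q pG tG tX unfolding eventually_nhdsin by blast
      obtain q where q: "q \<in> S" "q \<in> A \<inter> D"
        using dense_S p(1) A(1,2) D(1) unfolding in_closure_of subset_iff by (meson IntI openin_Int)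
      obtain b where b: "b \<in> S" "b \<in> T" "b \<in> B"
        using dense_T p(2) B(1,2) unfolding in_closure_of subset_iff t_def by (metis IntE)
      have cl: "q \<in> carrier G" "b \<in> carrier G" using q b SG by auto
      define h where "h = inv q \<otimes> g \<otimes> q"
      define r where "r = inv b \<otimes> h"
      have hS: "h \<in> S" and rS: "r \<in> S"
        unfolding h_def r_def using q(1) b(1) gS(1) S
        by (simp_all add: subgroup.m_closed subgroup.m_inv_closed)
      then have hG: "h \<in> carrier G" and rG: "r \<in> carrier G" using SG by auto
      have "r \<in> W \<inter> U2" unfolding r_def h_def using PQ A(3) B(3) q(2) b(3) by blast
      then have r: "r \<in> V3" "r \<in> U2" using W(2) rS by auto
      have "h \<in> V3" unfolding h_def using conjV q D(2) g by blast
      then have "h \<otimes> inv r \<in> V2" using V32 r(1) by blast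
      moreover have "h \<otimes> inv r = b"
        unfolding r_def using hG cl by (simp add: inv_mult_group m_assoc[symmetric])
      ultimately have "b \<in> U2" using V2(3) b(2) by blast
      then have "b \<otimes> r \<in> U1" using U2U r(2) by blast
      moreover have "b \<otimes> r = h"
        unfolding r_def using hG cl by (simp add: m_assoc[symmetric])
      ultimately have "h \<in> U1" by simp
      then have "inv (inv q) \<otimes> h \<otimes> inv q \<in> U"
        using U1U[of "inv q" h] q(2) D(2) cl by auto
      moreover have "inv (inv q) \<otimes> h \<otimes> inv q = g"
      proof -
        have "q \<otimes> h = g \<otimes> q"
          unfolding h_def using cl gS by (simp add: m_assoc[symmetric])
        then show ?thesis using cl gS by (simp add: m_assoc)
      qed
      ultimately show "g \<in> U" by simp
    qed
    then show ?thesis using V by blast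
  qed
  show ?thesis
    unfolding limitin_subtopology
  proof (intro conjI)
    show "\<one> \<in> S" by (rule subgroup.one_closed[OF S])
    show "eventually (\<lambda>a. a \<in> S) (nhdsin Y \<one>)"
      unfolding eventually_nhdsin using openin_topspace[of Y] tY by blast
    show "limitin X (\<lambda>x. x) \<one> (nhdsin Y \<one>)"
      unfolding limitin_def eventually_nhdsin using main tX by (metis one_closed subsetD)
  qed
qed

section \<open>Special linear groups over dense subfields of the complex numbers\<close>

locale complex_subfield =
  fixes K :: "complex set"
  assumes one_K: "1 \<in> K"
    and diff_K: "\<And>x y. x \<in> K \<Longrightarrow> y \<in> K \<Longrightarrow> x - y \<in> K"
    and mult_K: "\<And>x y. x \<in> K \<Longrightarrow> y \<in> K \<Longrightarrow> x * y \<in> K"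
    and inverse_K: "\<And>x. x \<in> K \<Longrightarrow> inverse x \<in> K"
begin

lemma zero_K: "0 \<in> K"
  using diff_K[OF one_K one_K] by simp

lemma uminus_K: "x \<in> K \<Longrightarrow> - x \<in> K"
  using diff_K[OF zero_K, of x] by simp

lemma add_K: "x \<in> K \<Longrightarrow> y \<in> K \<Longrightarrow> x + y \<in> K"
  using diff_K[OF _ uminus_K, of x y] by simp

lemma divide_K: "x \<in> K \<Longrightarrow> y \<in> K \<Longrightarrow> x / y \<in> K"
  using mult_K inverse_K by (simp add: divide_inverse)

lemma numeral_K: "numeral k \<in> K"
proof -
  have "of_nat m \<in> K" for m :: nat
    by (induction m) (auto intro: zero_K one_K add_K)
  then show ?thesis by (metis of_nat_numeral)
qed

lemma sum_K: "(\<And>i. i \<in> I \<Longrightarrow> f i \<in> K) \<Longrightarrow> sum f I \<in> K"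
  by (induction I rule: infinite_finite_induct) (auto intro: zero_K add_K)

lemma prod_K: "(\<And>i. i \<in> I \<Longrightarrow> f i \<in> K) \<Longrightarrow> prod f I \<in> K"
  by (induction I rule: infinite_finite_induct) (auto intro: one_K mult_K)

lemma power_K: "x \<in> K \<Longrightarrow> x ^ m \<in> K"
  by (induction m) (auto intro: one_K mult_K)

lemmas field_K = one_K zero_K diff_K mult_K inverse_K uminus_K add_K divide_K numeral_K sum_K prod_K power_K

lemma det_K:
  assumes A: "A \<in> carrier_mat n n" and K: "\<And>i j. i < n \<Longrightarrow> j < n \<Longrightarrow> A $$ (i, j) \<in> K"
  shows "det A \<in> K"
  unfolding det_def'[OF A]
proof (intro sum_K mult_K prod_K)
  fix p i assume "p \<in> {p. p permutes {0..<n}}" "i \<in> {0..<n}"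
  then show "A $$ (i, p i) \<in> K"
    using K permutes_in_image[of p "{0..<n}" i] by auto
qed (auto simp: sign_def intro: field_K)

end

lemma complex_subfield_UNIV: "complex_subfield UNIV"
  by unfold_locales auto

lemma carrier_special_linear:
  "A \<in> carrier (special_linear_group n K) \<longleftrightarrow>
     A \<in> carrier_mat n n \<and> (\<forall>i<n. \<forall>j<n. A $$ (i, j) \<in> K) \<and> det A = 1"
  unfolding special_linear_group_def elements_mat_def by fastforce

lemma carrier_special_triangular:
  "A \<in> carrier (special_triangular_group n K) \<longleftrightarrow>
     A \<in> carrier (special_linear_group n K) \<and> (\<forall>i<n. \<forall>j<i. A $$ (i, j) = 0)"
  unfolding special_triangular_group_def upper_triangular_def
  by (auto simp: carrier_special_linear)

lemma special_linear_group_simps [simp]: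
  "monoid.mult (special_linear_group n K) = (*)" "one (special_linear_group n K) = 1\<^sub>m n"
  "monoid.mult (special_triangular_group n K) = (*)" "one (special_triangular_group n K) = 1\<^sub>m n"
  by (simp_all add: special_linear_group_def special_triangular_group_def)

lemma special_triangular_group_restrict:
  "special_triangular_group n K = (special_linear_group n UNIV)\<lparr>carrier := carrier (special_triangular_group n K)\<rparr>"
  by (simp_all add: special_linear_group_def special_triangular_group_def)

lemma triangular_subset: "carrier (special_triangular_group n K) \<subseteq> carrier (special_linear_group n K)"
  by (auto simp: carrier_special_triangular)

lemma linear_mono: "carrier (special_linear_group n K) \<subseteq> carrier (special_linear_group n UNIV)"
  by (auto simp: carrier_special_linear)

lemma adj_mat_special_linear:
  fixes A :: "'a::field mat"
  assumes A: "A \<in> carrier_mat n n" "det A = 1"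
  shows "adj_mat A \<in> carrier_mat n n" "adj_mat A * A = 1\<^sub>m n" "A * adj_mat A = 1\<^sub>m n" "det (adj_mat A) = 1"
proof -
  note adj = adj_mat[OF A(1)]
  show "adj_mat A \<in> carrier_mat n n" by (rule adj(1))
  show "adj_mat A * A = 1\<^sub>m n" using adj(3) A(2) by auto
  show 1: "A * adj_mat A = 1\<^sub>m n" using adj(2) A(2) by auto
  show "det (adj_mat A) = 1"
    using det_mult[OF A(1) adj(1)] A(2) unfolding 1 by simp
qed

lemma group_special_linear: "group (special_linear_group n (UNIV :: 'a::field set))"
proof (rule groupI)
  show "\<exists>y\<in>carrier (special_linear_group n UNIV).
      y \<otimes>\<^bsub>special_linear_group n UNIV\<^esub> x = \<one>\<^bsub>special_linear_group n UNIV\<^esub>"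
    if "x \<in> carrier (special_linear_group n (UNIV :: 'a set))" for x
    using that adj_mat_special_linear[of x n] by (auto simp: carrier_special_linear intro!: bexI[of _ "adj_mat x"])
qed (auto simp: carrier_special_linear det_mult)

lemma inv_special_linear:
  assumes "A \<in> carrier (special_linear_group n (UNIV :: 'a::field set))"
  shows "inv\<^bsub>special_linear_group n UNIV\<^esub> A = adj_mat A"
  using assms adj_mat_special_linear[of A n]
  by (intro group.inv_equality[OF group_special_linear]) (auto simp: carrier_special_linear)

lemma inverse_upper_triangular:
  fixes A B :: "'a::field mat"
  assumes A: "A \<in> carrier_mat n n" and B: "B \<in> carrier_mat n n" and BA: "B * A = 1\<^sub>m n"
    and up: "\<And>i j. i < n \<Longrightarrow> j < i \<Longrightarrow> A $$ (i, j) = 0" and ij: "i < n" "j < i"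
  shows "B $$ (i, j) = 0"
  using ij(2)
proof (induction j rule: less_induct)
  case (less j)
  have "det A \<noteq> 0"
    using det_mult[OF B A] BA by auto
  moreover have "upper_triangular A"
    using up A by (auto simp: upper_triangular_def)
  ultimately have "prod_list (diag_mat A) \<noteq> 0"
    using det_upper_triangular A by metis
  then have d: "A $$ (j, j) \<noteq> 0"
    using less.prems ij A by (auto simp: prod_list_zero_iff diag_mat_def)
  have "(B * A) $$ (i, j) = (\<Sum>k\<in>{0..<n}. B $$ (i, k) * A $$ (k, j))"
    using A B ij less.prems by (auto simp: scalar_prod_def)
  also have "\<dots> = (\<Sum>k\<in>{0..<n}. if k = j then B $$ (i, j) * A $$ (j, j) else 0)"
  proof (intro sum.cong refl)
    fix k assume "k \<in> {0..<n}"
    then show "B $$ (i, k) * A $$ (k, j) = (if k = j then B $$ (i, j) * A $$ (j, j) else 0)"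
      using less.IH[of k] less.prems up[of k j] by (cases k j rule: linorder_cases) auto
  qed
  also have "\<dots> = B $$ (i, j) * A $$ (j, j)"
    using less.prems ij by simp
  finally show ?case
    using BA d ij less.prems by auto
qed

context complex_subfield
begin

lemma subgroup_special_linear:
  "subgroup (carrier (special_linear_group n K)) (special_linear_group n UNIV)"
proof (rule group.subgroupI[OF group_special_linear])
  show "carrier (special_linear_group n K) \<subseteq> carrier (special_linear_group n UNIV)"
    by (rule linear_mono)
  have "1\<^sub>m n \<in> carrier (special_linear_group n K)"
    by (auto simp: carrier_special_linear field_K)
  then show "carrier (special_linear_group n K) \<noteq> {}" by blast
next
  fix A assume A: "A \<in> carrier (special_linear_group n K)"
  have "adj_mat A $$ (i, j) \<in> K" if "i < n" "j < n" for i j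
  proof -
    have "det (mat_delete A j i) \<in> K"
      using A that by (intro det_K[of _ "n - 1"])
        (auto simp: carrier_special_linear mat_delete_def)
    then show ?thesis
      using A that by (auto simp: adj_mat_def carrier_special_linear cofactor_def intro!: field_K)
  qed
  then have "adj_mat A \<in> carrier (special_linear_group n K)"
    using A adj_mat_special_linear[of A n] by (auto simp: carrier_special_linear)
  then show "inv\<^bsub>special_linear_group n UNIV\<^esub> A \<in> carrier (special_linear_group n K)"
    using inv_special_linear[of A n] A linear_mono by fastforce
next
  fix A B assume "A \<in> carrier (special_linear_group n K)" "B \<in> carrier (special_linear_group n K)"
  then show "A \<otimes>\<^bsub>special_linear_group n UNIV\<^esub> B \<in> carrier (special_linear_group n K)"
    by (auto simp: carrier_special_linear det_mult scalar_prod_def intro!: sum_K mult_K)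
qed

lemma subgroup_special_triangular:
  "subgroup (carrier (special_triangular_group n K)) (special_linear_group n UNIV)"
proof (rule group.subgroupI[OF group_special_linear])
  show "carrier (special_triangular_group n K) \<subseteq> carrier (special_linear_group n UNIV)"
    using triangular_subset linear_mono by blast
  have "1\<^sub>m n \<in> carrier (special_triangular_group n K)"
    by (auto simp: carrier_special_linear carrier_special_triangular field_K)
  then show "carrier (special_triangular_group n K) \<noteq> {}" by blast
next
  fix A assume A: "A \<in> carrier (special_triangular_group n K)"
  then have A': "A \<in> carrier (special_linear_group n K)" "A \<in> carrier (special_linear_group n UNIV)"
    using triangular_subset linear_mono by blast+
  have "inv\<^bsub>special_linear_group n UNIV\<^esub> A \<in> carrier (special_linear_group n K)"
    using subgroup.m_inv_closed[OF subgroup_special_linear A'(1)] .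
  moreover have "adj_mat A $$ (i, j) = 0" if "i < n" "j < i" for i j
  proof -
    have "A \<in> carrier_mat n n" "det A = 1"
      using A'(1) by (auto simp: carrier_special_linear)
    note adj = adj_mat_special_linear[OF this]
    have "A $$ (i, j) = 0" if "i < n" "j < i" for i j
      using A that by (auto simp: carrier_special_triangular)
    then show ?thesis
      using inverse_upper_triangular[OF \<open>A \<in> carrier_mat n n\<close> adj(1,2)] that by blast
  qed
  ultimately show "inv\<^bsub>special_linear_group n UNIV\<^esub> A \<in> carrier (special_triangular_group n K)"
    using inv_special_linear[OF A'(2)] by (simp add: carrier_special_triangular)
next
  fix A B assume AB: "A \<in> carrier (special_triangular_group n K)" "B \<in> carrier (special_triangular_group n K)"
  have "(A * B) $$ (i, j) = 0" if "i < n" "j < i" for i j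
  proof -
    have "(A * B) $$ (i, j) = (\<Sum>k\<in>{0..<n}. A $$ (i, k) * B $$ (k, j))"
      using AB that by (auto simp: scalar_prod_def carrier_special_triangular carrier_special_linear)
    also have "\<dots> = 0"
    proof (intro sum.neutral ballI)
      fix k assume "k \<in> {0..<n}"
      then show "A $$ (i, k) * B $$ (k, j) = 0"
        using AB that by (cases "k < i") (auto simp: carrier_special_triangular)
    qed
    finally show ?thesis .
  qed
  moreover have "A * B \<in> carrier (special_linear_group n K)"
    using subgroup.m_closed[OF subgroup_special_linear, of A n B] AB triangular_subset by fastforce
  ultimately show "A \<otimes>\<^bsub>special_linear_group n UNIV\<^esub> B \<in> carrier (special_triangular_group n K)"
    by (simp add: carrier_special_triangular)
qed

end

subsection \<open>The topology of entrywise convergence\<close>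

lemma tendsto_det:
  fixes A :: "'x \<Rightarrow> complex mat"
  assumes lim: "\<And>i j. i < n \<Longrightarrow> j < n \<Longrightarrow> ((\<lambda>x. A x $$ (i, j)) \<longlongrightarrow> L $$ (i, j)) F"
    and A: "eventually (\<lambda>x. A x \<in> carrier_mat n n) F" and L: "L \<in> carrier_mat n n"
  shows "((\<lambda>x. det (A x)) \<longlongrightarrow> det L) F"
proof -
  have "((\<lambda>x. \<Sum>p\<in>{p. p permutes {0..<n}}. signof p * (\<Prod>i = 0..<n. A x $$ (i, p i))) \<longlongrightarrow>
      (\<Sum>p\<in>{p. p permutes {0..<n}}. signof p * (\<Prod>i = 0..<n. L $$ (i, p i)))) F"
  proof (intro tendsto_sum tendsto_mult tendsto_const tendsto_prod)
    fix p i assume "p \<in> {p. p permutes {0..<n}}" "i \<in> {0..<n}"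
    then show "((\<lambda>x. A x $$ (i, p i)) \<longlongrightarrow> L $$ (i, p i)) F"
      using lim permutes_in_image[of p "{0..<n}" i] by auto
  qed
  moreover have "eventually (\<lambda>x. (\<Sum>p\<in>{p. p permutes {0..<n}}. signof p * (\<Prod>i = 0..<n. A x $$ (i, p i)))
      = det (A x)) F"
    using A by eventually_elim (simp add: det_def')
  ultimately show ?thesis
    unfolding det_def'[OF L] by (rule Lim_transform_eventually)
qed

lemma tendsto_mat_mult:
  fixes A B :: "'x \<Rightarrow> complex mat"
  assumes A: "\<And>j. j < n \<Longrightarrow> ((\<lambda>x. A x $$ (i, j)) \<longlongrightarrow> L $$ (i, j)) F"
    and B: "\<And>i. i < n \<Longrightarrow> ((\<lambda>x. B x $$ (i, j)) \<longlongrightarrow> M $$ (i, j)) F"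
    and evA: "eventually (\<lambda>x. A x \<in> carrier_mat n n) F" and evB: "eventually (\<lambda>x. B x \<in> carrier_mat n n) F"
    and L: "L \<in> carrier_mat n n" and M: "M \<in> carrier_mat n n" and ij: "i < n" "j < n"
  shows "((\<lambda>x. (A x * B x) $$ (i, j)) \<longlongrightarrow> (L * M) $$ (i, j)) F"
proof -
  have lim: "((\<lambda>x. \<Sum>k = 0..<n. A x $$ (i, k) * B x $$ (k, j)) \<longlongrightarrow> (\<Sum>k = 0..<n. L $$ (i, k) * M $$ (k, j))) F"
    by (intro tendsto_sum tendsto_mult A B) auto
  have ev: "eventually (\<lambda>x. (\<Sum>k = 0..<n. A x $$ (i, k) * B x $$ (k, j)) = (A x * B x) $$ (i, j)) F"
    using evA evB by eventually_elim (use ij in \<open>auto simp: scalar_prod_def\<close>)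
  have "(\<Sum>k = 0..<n. L $$ (i, k) * M $$ (k, j)) = (L * M) $$ (i, j)"
    using L M ij by (auto simp: scalar_prod_def)
  then show ?thesis
    using Lim_transform_eventually[OF lim ev] by (simp only:)
qed

lemma special_linear_topology_restrict:
  "special_linear_topology n K =
     subtopology (special_linear_topology n (UNIV :: 'a::{field, topological_space} set))
       (carrier (special_linear_group n K))"
proof -
  let ?I = "{..<n} \<times> {..<n}"
  let ?e = "\<lambda>A::'a mat. \<lambda>p \<in> ?I. A $$ p"
  have "openin (special_linear_topology n K) U \<longleftrightarrow>
      openin (subtopology (special_linear_topology n UNIV) (carrier (special_linear_group n K))) U" for U
  proof -
    have "product_topology (\<lambda>_. top_of_set K) ?I =
        subtopology (product_topology (\<lambda>_. euclidean) ?I) (PiE ?I (\<lambda>_. K))"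
      by (simp add: subtopology_product_topology)
    then have "openin (special_linear_topology n K) U \<longleftrightarrow>
        (\<exists>V. openin (product_topology (\<lambda>_. euclidean) ?I) V \<and>
          U = ?e -` (V \<inter> PiE ?I (\<lambda>_. K)) \<inter> carrier (special_linear_group n K))"
      unfolding special_linear_topology_def openin_pullback_topology
      by (auto simp: openin_subtopology)
    also have "\<dots> \<longleftrightarrow> (\<exists>V. openin (product_topology (\<lambda>_. euclidean) ?I) V \<and>
          U = ?e -` V \<inter> carrier (special_linear_group n UNIV) \<inter> carrier (special_linear_group n K))"
    proof -
      have "?e -` (V \<inter> PiE ?I (\<lambda>_. K)) \<inter> carrier (special_linear_group n K) =
          ?e -` V \<inter> carrier (special_linear_group n UNIV) \<inter> carrier (special_linear_group n K)" for V
        by (auto simp: carrier_special_linear)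
      then show ?thesis by simp
    qed
    also have "\<dots> \<longleftrightarrow>
      openin (subtopology (special_linear_topology n UNIV) (carrier (special_linear_group n K))) U"
      unfolding special_linear_topology_def openin_pullback_topology openin_subtopology by auto
    finally show ?thesis .
  qed
  then show ?thesis by (simp add: topology_eq)
qed

lemma special_triangular_topology_restrict:
  "special_triangular_topology n K =
     subtopology (special_linear_topology n (UNIV :: 'a::{field, topological_space} set))
       (carrier (special_triangular_group n K))"
  unfolding special_triangular_topology_def
  by (subst special_linear_topology_restrict)
    (simp add: subtopology_subtopology Int_absorb1 triangular_subset)

lemma limitin_special_linear_UNIV:
  fixes f :: "'x \<Rightarrow> 'a::{field, topological_space} mat"
  shows "limitin (special_linear_topology n UNIV) f L F \<longleftrightarrow>
     L \<in> carrier (special_linear_group n UNIV) \<and>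
     eventually (\<lambda>x. f x \<in> carrier (special_linear_group n UNIV)) F \<and>
     (\<forall>i<n. \<forall>j<n. ((\<lambda>x. f x $$ (i, j)) \<longlongrightarrow> L $$ (i, j)) F)"
  unfolding special_linear_topology_def limitin_pullback_topology limitin_componentwise
  by auto

lemma limitin_special_linear:
  fixes f :: "'x \<Rightarrow> 'a::{field, topological_space} mat"
  shows "limitin (special_linear_topology n K) f L F \<longleftrightarrow>
     L \<in> carrier (special_linear_group n K) \<and>
     eventually (\<lambda>x. f x \<in> carrier (special_linear_group n K)) F \<and>
     (\<forall>i<n. \<forall>j<n. ((\<lambda>x. f x $$ (i, j)) \<longlongrightarrow> L $$ (i, j)) F)"
  unfolding special_linear_topology_restrict[of n K] limitin_subtopology limitin_special_linear_UNIV
  using linear_mono[of n K] by (auto elim: eventually_mono)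

lemma limitin_special_triangular:
  fixes f :: "'x \<Rightarrow> 'a::{field, topological_space} mat"
  shows "limitin (special_triangular_topology n K) f L F \<longleftrightarrow>
     L \<in> carrier (special_triangular_group n K) \<and>
     eventually (\<lambda>x. f x \<in> carrier (special_triangular_group n K)) F \<and>
     (\<forall>i<n. \<forall>j<n. ((\<lambda>x. f x $$ (i, j)) \<longlongrightarrow> L $$ (i, j)) F)"
  unfolding special_triangular_topology_restrict[of n K] limitin_subtopology limitin_special_linear_UNIV
  using linear_mono[of n K] triangular_subset[of n K]
    eventually_mono[of "\<lambda>x. f x \<in> carrier (special_triangular_group n K)" F
      "\<lambda>x. f x \<in> carrier (special_linear_group n UNIV)"] by blast

lemma tendsto_adj_mat:
  fixes A :: "'x \<Rightarrow> complex mat"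
  assumes lim: "\<And>i j. i < n \<Longrightarrow> j < n \<Longrightarrow> ((\<lambda>x. A x $$ (i, j)) \<longlongrightarrow> L $$ (i, j)) F"
    and A: "eventually (\<lambda>x. A x \<in> carrier_mat n n) F" and L: "L \<in> carrier_mat n n"
    and ij: "i < n" "j < n"
  shows "((\<lambda>x. adj_mat (A x) $$ (i, j)) \<longlongrightarrow> adj_mat L $$ (i, j)) F"
proof -
  have md: "mat_delete B j i \<in> carrier_mat (n - 1) (n - 1)" if "B \<in> carrier_mat n n" for B :: "complex mat"
    using that by (auto simp: mat_delete_def)
  have lim': "((\<lambda>x. (-1) ^ (j + i) * det (mat_delete (A x) j i)) \<longlongrightarrow> (-1) ^ (j + i) * det (mat_delete L j i)) F"
  proof (intro tendsto_mult tendsto_const tendsto_det[of "n - 1"])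
    show "eventually (\<lambda>x. mat_delete (A x) j i \<in> carrier_mat (n - 1) (n - 1)) F"
      using A by eventually_elim (rule md)
    fix a b assume ab: "a < n - 1" "b < n - 1"
    define a' b' where "a' = (if a < j then a else Suc a)" and "b' = (if b < i then b else Suc b)"
    have lt: "a' < n" "b' < n" using ab by (auto simp: a'_def b'_def)
    have e: "mat_delete B j i $$ (a, b) = B $$ (a', b')" if "B \<in> carrier_mat n n" for B :: "complex mat"
      using that ab by (auto simp: mat_delete_def a'_def b'_def)
    have "eventually (\<lambda>x. A x $$ (a', b') = mat_delete (A x) j i $$ (a, b)) F"
      using A by eventually_elim (simp add: e)
    then show "((\<lambda>x. mat_delete (A x) j i $$ (a, b)) \<longlongrightarrow> mat_delete L j i $$ (a, b)) F"
      unfolding e[OF L] by (rule Lim_transform_eventually[OF lim[OF lt]])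
  qed (rule md[OF L])
  have adj: "adj_mat B $$ (i, j) = (-1) ^ (j + i) * det (mat_delete B j i)"
    if "B \<in> carrier_mat n n" for B :: "complex mat"
    using that ij by (auto simp: adj_mat_def cofactor_def)
  have ev: "eventually (\<lambda>x. (-1) ^ (j + i) * det (mat_delete (A x) j i) = adj_mat (A x) $$ (i, j)) F"
    using A by eventually_elim (simp add: adj)
  show ?thesis
    unfolding adj[OF L] by (rule Lim_transform_eventually[OF lim' ev])
qed

lemma topspace_special_linear: "topspace (special_linear_topology n (UNIV :: complex set)) =
    carrier (special_linear_group n UNIV)"
  by (auto simp: special_linear_topology_def topspace_pullback_topology)

lemma topological_group_special_linear_UNIV:
  "topological_group (special_linear_group n UNIV) (special_linear_topology n (UNIV :: complex set))"
proof (rule topological_groupI)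
  let ?e = "\<lambda>A::complex mat. \<lambda>p \<in> {..<n} \<times> {..<n}. A $$ p"
  let ?Z = "product_topology (\<lambda>_. euclidean :: complex topology) ({..<n} \<times> {..<n})"
  have "continuous_map (special_linear_topology n UNIV) ?Z (id \<circ> ?e)"
    unfolding special_linear_topology_def by (intro continuous_map_pullback) simp
  moreover have "inj_on ?e (carrier (special_linear_group n UNIV))"
  proof (rule inj_onI)
    fix A B assume AB: "A \<in> carrier (special_linear_group n (UNIV :: complex set))"
      "B \<in> carrier (special_linear_group n (UNIV :: complex set))" and e: "?e A = ?e B"
    have "A $$ (i, j) = B $$ (i, j)" if "i < n" "j < n" for i j
      using fun_cong[OF e, of "(i, j)"] that by simp
    then show "A = B"
      using AB by (intro eq_matI) (auto simp: carrier_special_linear)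
  qed
  moreover have "Hausdorff_space ?Z"
    by (simp add: Hausdorff_space_product_topology Hausdorff_space_euclidean)
  ultimately show "Hausdorff_space (special_linear_topology n (UNIV :: complex set))"
    using Hausdorff_space_injective_preimage topspace_special_linear by (metis id_comp)
  show "limitin (special_linear_topology n UNIV) (\<lambda>x. f x \<otimes>\<^bsub>special_linear_group n UNIV\<^esub> g x)
      (a \<otimes>\<^bsub>special_linear_group n UNIV\<^esub> b) F"
    if "limitin (special_linear_topology n UNIV) f a F" "limitin (special_linear_topology n UNIV) g b F"
    for F :: "(complex mat \<times> complex mat) filter" and f g and a b :: "complex mat"
  proof -
    have f: "eventually (\<lambda>x. f x \<in> carrier_mat n n) F" "eventually (\<lambda>x. g x \<in> carrier_mat n n) F"
      using that by (auto simp: limitin_special_linear carrier_special_linear elim: eventually_mono)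
    have "eventually (\<lambda>x. f x \<in> carrier (special_linear_group n UNIV)) F"
      "eventually (\<lambda>x. g x \<in> carrier (special_linear_group n UNIV)) F"
      using that unfolding limitin_special_linear by blast+
    then have "eventually (\<lambda>x. f x * g x \<in> carrier (special_linear_group n UNIV)) F"
      by eventually_elim
        (use monoid.m_closed[OF group.is_monoid[OF group_special_linear[where ?'a = complex]], of _ n] in simp)
    moreover have "a * b \<in> carrier (special_linear_group n UNIV)"
      using that monoid.m_closed[OF group.is_monoid[OF group_special_linear[where ?'a = complex]], of _ n]
      unfolding limitin_special_linear by auto
    ultimately show ?thesis
      using that f unfolding limitin_special_linear special_linear_group_simps
      by (intro conjI allI impI tendsto_mat_mult[of n]) (auto simp: carrier_special_linear)
  qed
  show "limitin (special_linear_topology n UNIV) (\<lambda>x. inv\<^bsub>special_linear_group n UNIV\<^esub> f x)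
      (inv\<^bsub>special_linear_group n UNIV\<^esub> a) F"
    if "limitin (special_linear_topology n UNIV) f a F"
    for F :: "complex mat filter" and f and a :: "complex mat"
  proof -
    note ic = group.inv_closed[OF group_special_linear[where ?'a = complex], of _ n]
    have a: "a \<in> carrier (special_linear_group n UNIV)"
      and f: "eventually (\<lambda>x. f x \<in> carrier (special_linear_group n UNIV)) F"
      using that by (auto simp: limitin_special_linear)
    have "eventually (\<lambda>x. adj_mat (f x) = inv\<^bsub>special_linear_group n UNIV\<^esub> f x) F"
      using f by eventually_elim (simp add: inv_special_linear)
    moreover have "limitin (special_linear_topology n UNIV) (\<lambda>x. adj_mat (f x)) (adj_mat a) F"
      unfolding limitin_special_linear
    proof (intro conjI allI impI)
      show "adj_mat a \<in> carrier (special_linear_group n UNIV)"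
        using ic[OF a] inv_special_linear[OF a] by simp
      show "eventually (\<lambda>x. adj_mat (f x) \<in> carrier (special_linear_group n UNIV)) F"
        using f by eventually_elim (use ic inv_special_linear in metis)
      fix i j assume "i < n" "j < n"
      moreover have "eventually (\<lambda>x. f x \<in> carrier_mat n n) F"
        using f by eventually_elim (simp add: carrier_special_linear)
      ultimately show "((\<lambda>x. adj_mat (f x) $$ (i, j)) \<longlongrightarrow> adj_mat a $$ (i, j)) F"
        using that a by (intro tendsto_adj_mat[of n]) (auto simp: limitin_special_linear carrier_special_linear)
    qed
    ultimately show ?thesis
      unfolding inv_special_linear[OF a] by (rule limitin_transform_eventually)
  qed
qed (auto simp: group_special_linear topspace_special_linear)

context complex_subfield
begin

lemma topological_group_special_triangular:
  "topological_group (special_triangular_group n K) (special_triangular_topology n K)"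
  using topological_group_subgroup[OF topological_group_special_linear_UNIV[of n] subgroup_special_triangular]
  unfolding special_triangular_group_restrict[of n K, symmetric]
    special_triangular_topology_restrict[of n K, symmetric] .

end

section \<open>Density, compactness and triangularization\<close>

lemma limitin_imp_closure_of:
  assumes l: "limitin X f l F" and F: "F \<noteq> bot" and S: "eventually (\<lambda>x. f x \<in> S) F"
  shows "l \<in> X closure_of S"
  unfolding in_closure_of
proof (intro conjI allI impI)
  show "l \<in> topspace X" by (rule limitin_topspace[OF l])
  fix T assume "l \<in> T \<and> openin X T"
  then have "eventually (\<lambda>x. f x \<in> T) F" using limitinD[OF l] by blast
  with S have "eventually (\<lambda>x. f x \<in> S \<and> f x \<in> T) F" by (rule eventually_conj)
  then show "\<exists>y. y \<in> S \<and> y \<in> T" using eventually_happens'[OF F] by blast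
qed

locale dense_complex_subfield = complex_subfield +
  assumes dense: "closure K = UNIV"
begin

text \<open>Approximate the entries of a matrix of determinant one in \<open>K\<close>, keeping zeros, and then divide
  the first row by the determinant of the approximation, which is close to one.\<close>

lemma approximate_special_linear:
  assumes n: "0 < n" and A: "A \<in> carrier (special_linear_group n UNIV)"
  obtains B :: "nat \<Rightarrow> complex mat" where
    "limitin (special_linear_topology n UNIV) B A sequentially"
    "eventually (\<lambda>m. B m \<in> carrier (special_linear_group n K)) sequentially"
    "\<forall>m. \<forall>i<n. \<forall>j<n. A $$ (i, j) = 0 \<longrightarrow> B m $$ (i, j) = 0"
proof -
  have Ac: "A \<in> carrier_mat n n" and dA: "det A = 1"
    using A by (auto simp: carrier_special_linear)
  have "\<exists>q. (\<forall>m. q m \<in> K) \<and> q \<longlonglongrightarrow> z \<and> (z = 0 \<longrightarrow> (\<forall>m. q m = 0))" for z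
  proof (cases "z = 0")
    case True
    then show ?thesis by (intro exI[of _ "\<lambda>_. 0"]) (auto simp: zero_K)
  next
    case False
    have "z \<in> closure K" using dense by simp
    then show ?thesis using False unfolding closure_sequential by blast
  qed
  then obtain q where q: "\<And>z m. q z m \<in> K" "\<And>z. q z \<longlonglongrightarrow> z" "\<And>m. q 0 m = 0"
    by metis
  define C where "C m = mat n n (\<lambda>p. q (A $$ p) m)" for m
  have C: "C m \<in> carrier_mat n n" for m by (simp add: C_def)
  have limC: "(\<lambda>m. C m $$ (i, j)) \<longlonglongrightarrow> A $$ (i, j)" if "i < n" "j < n" for i j
    using that q(2) by (simp add: C_def)
  have lim_det: "(\<lambda>m. det (C m)) \<longlonglongrightarrow> 1"
    using tendsto_det[of n C A sequentially] limC C Ac dA by simp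
  define B where "B m = multrow 0 (1 / det (C m)) (C m)" for m
  have Bc: "B m \<in> carrier_mat n n" for m using C[of m] by (simp add: B_def)
  have B_entry: "B m $$ (i, j) = (if i = 0 then 1 / det (C m) * C m $$ (i, j) else C m $$ (i, j))"
    if "i < n" "j < n" for m i j
    using that C[of m] by (auto simp: B_def)
  have detK: "det (C m) \<in> K" for m
    by (rule det_K[OF C]) (auto simp: C_def q(1))
  have "eventually (\<lambda>m. det (C m) \<noteq> 0) sequentially"
    using lim_det by (rule tendsto_imp_eventually_ne) simp
  then have BK: "eventually (\<lambda>m. B m \<in> carrier (special_linear_group n K)) sequentially"
  proof eventually_elim
    case (elim m)
    have "det (B m) = 1"
      unfolding B_def using det_multrow[OF n C] elim by simp
    then show ?case
      unfolding carrier_special_linear using Bc B_entry q(1) detK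
      by (auto simp: C_def intro!: mult_K divide_K one_K)
  qed
  have lim: "limitin (special_linear_topology n UNIV) B A sequentially"
    unfolding limitin_special_linear
  proof (intro conjI allI impI)
    show "A \<in> carrier (special_linear_group n UNIV)" by (rule A)
    show "eventually (\<lambda>m. B m \<in> carrier (special_linear_group n UNIV)) sequentially"
      using BK by eventually_elim (use linear_mono in blast)
    fix i j assume ij: "i < n" "j < n"
    have "(\<lambda>m. 1 / det (C m) * C m $$ (i, j)) \<longlonglongrightarrow> 1 / 1 * A $$ (i, j)"
      by (intro tendsto_intros lim_det limC ij) simp
    then show "(\<lambda>m. B m $$ (i, j)) \<longlonglongrightarrow> A $$ (i, j)"
      using limC[OF ij] B_entry[OF ij] by (cases "i = 0") simp_all
  qed
  show thesis
    by (rule that[OF lim BK]) (auto simp: B_entry C_def q(3))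
qed

lemma dense_special_linear:
  assumes "0 < n"
  shows "carrier (special_linear_group n UNIV) \<subseteq>
    special_linear_topology n UNIV closure_of carrier (special_linear_group n K)"
proof
  fix A :: "complex mat" assume "A \<in> carrier (special_linear_group n UNIV)"
  then obtain B where
    "limitin (special_linear_topology n UNIV) B A sequentially"
    "eventually (\<lambda>m. B m \<in> carrier (special_linear_group n K)) sequentially"
    by (rule approximate_special_linear[OF assms])
  then show "A \<in> special_linear_topology n UNIV closure_of carrier (special_linear_group n K)"
    by (intro limitin_imp_closure_of[of _ B _ sequentially]) auto
qed

lemma dense_special_triangular:
  assumes n: "0 < n"
  shows "carrier (special_triangular_group n UNIV) \<subseteq>
    special_linear_topology n UNIV closure_of carrier (special_triangular_group n K)"
proof
  fix A :: "complex mat" assume A: "A \<in> carrier (special_triangular_group n UNIV)"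
  then have "A \<in> carrier (special_linear_group n UNIV)" by (simp add: carrier_special_triangular)
  then obtain B where
    B: "limitin (special_linear_topology n UNIV) B A sequentially"
    "eventually (\<lambda>m. B m \<in> carrier (special_linear_group n K)) sequentially"
    "\<forall>m. \<forall>i<n. \<forall>j<n. A $$ (i, j) = 0 \<longrightarrow> B m $$ (i, j) = 0"
    by (rule approximate_special_linear[OF n])
  have "eventually (\<lambda>m. B m \<in> carrier (special_triangular_group n K)) sequentially"
    using B(2) by eventually_elim (use A B(3) in \<open>auto simp: carrier_special_triangular\<close>)
  then show "A \<in> special_linear_topology n UNIV closure_of carrier (special_triangular_group n K)"
    using B(1) by (intro limitin_imp_closure_of[of _ B _ sequentially]) auto
qed

end

lemma compactin_pullback_topology:
  assumes C: "C \<subseteq> A" and f: "compactin T (f ` C)"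
  shows "compactin (pullback_topology A f T) C"
  unfolding compactin_def
proof (intro conjI allI impI, goal_cases)
  case 1
  show ?case
    using C compactin_subset_topspace[OF f] by (auto simp: topspace_pullback_topology)
next
  case (2 \<U>)
  then have "\<forall>U\<in>\<U>. \<exists>V. openin T V \<and> U = f -` V \<inter> A"
    by (auto simp: openin_pullback_topology)
  then obtain v where v: "\<And>U. U \<in> \<U> \<Longrightarrow> openin T (v U) \<and> U = f -` v U \<inter> A"
    by metis
  have "f ` C \<subseteq> \<Union>(v ` \<U>)"
  proof
    fix y assume "y \<in> f ` C"
    then obtain x U where "x \<in> C" "y = f x" "x \<in> U" "U \<in> \<U>" using 2 by blast
    then show "y \<in> \<Union>(v ` \<U>)" using v[of U] by blast
  qed
  moreover have "\<And>V. V \<in> v ` \<U> \<Longrightarrow> openin T V" using v by blast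
  ultimately have "\<exists>\<F>. finite \<F> \<and> \<F> \<subseteq> v ` \<U> \<and> f ` C \<subseteq> \<Union>\<F>"
    by (intro compactinD[OF f])
  then obtain \<F> where "finite \<F>" "\<F> \<subseteq> v ` \<U>" "f ` C \<subseteq> \<Union>\<F>" by blast
  then obtain \<G> where G: "finite \<G>" "\<G> \<subseteq> \<U>" "f ` C \<subseteq> \<Union>(v ` \<G>)"
    by (metis finite_subset_image)
  have "C \<subseteq> \<Union>\<G>"
  proof
    fix x assume x: "x \<in> C"
    then obtain U where "U \<in> \<G>" "f x \<in> v U" using G(3) by blast
    then show "x \<in> \<Union>\<G>" using v[of U] G(2) C x by blast
  qed
  with G show ?case by blast
qed

lemma compactin_bounded_special_linear:
  "compactin (special_linear_topology n UNIV)
    {A \<in> carrier (special_linear_group n UNIV). \<forall>i<n. \<forall>j<n. norm (A $$ (i, j) :: complex) \<le> b}"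
  unfolding special_linear_topology_def
proof (rule compactin_pullback_topology)
  let ?I = "{..<n} \<times> {..<n}"
  let ?e = "\<lambda>A::complex mat. \<lambda>p \<in> ?I. A $$ p"
  let ?Z = "product_topology (\<lambda>_. euclidean :: complex topology) ?I"
  let ?C = "{A \<in> carrier (special_linear_group n (UNIV :: complex set)). \<forall>i<n. \<forall>j<n. norm (A $$ (i, j)) \<le> b}"
  have "continuous_map ?Z euclidean (\<lambda>h. det (mat n n h))"
    unfolding continuous_map_atin limitin_canonical_iff
  proof (intro ballI tendsto_det[of n])
    fix h i j assume h: "h \<in> topspace ?Z" and ij: "i < n" "j < n"
    have "limitin ?Z (\<lambda>x. x) h (atin ?Z h)" by (rule limitin_atin_ident[OF h])
    then have "((\<lambda>x. x (i, j)) \<longlongrightarrow> h (i, j)) (atin ?Z h)"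
      using ij unfolding limitin_componentwise by simp
    then show "((\<lambda>x. mat n n x $$ (i, j)) \<longlongrightarrow> mat n n h $$ (i, j)) (atin ?Z h)"
      using ij by simp
  qed auto
  then have "closedin ?Z {h \<in> topspace ?Z. det (mat n n h) = 1}"
    by (intro closedin_continuous_maps_eq[OF Hausdorff_space_euclidean]) auto
  moreover have "compactin ?Z (PiE ?I (\<lambda>_. cball 0 b))"
    by (simp add: compactin_PiE)
  ultimately have "compactin ?Z ({h \<in> topspace ?Z. det (mat n n h) = 1} \<inter> PiE ?I (\<lambda>_. cball 0 b))"
    by (rule closed_Int_compactin)
  also have "{h \<in> topspace ?Z. det (mat n n h) = 1} \<inter> PiE ?I (\<lambda>_. cball 0 b) = ?e ` ?C"
  proof (intro equalityI subsetI)
    fix h assume h: "h \<in> {h \<in> topspace ?Z. det (mat n n h) = 1} \<inter> PiE ?I (\<lambda>_. cball 0 b)"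
    have e: "?e (mat n n h) = h"
    proof
      fix p show "?e (mat n n h) p = h p"
        using h by (cases p; cases "p \<in> ?I") (auto simp: PiE_iff extensional_def)
    qed
    have "mat n n h \<in> ?C"
      using h by (auto simp: carrier_special_linear PiE_iff)
    then show "h \<in> ?e ` ?C" by (rule image_eqI[rotated]) (rule e[symmetric])
  next
    fix h assume "h \<in> ?e ` ?C"
    then obtain A where A: "A \<in> ?C" and h: "h = ?e A" by blast
    have Ac: "A \<in> carrier_mat n n" using A by (auto simp: carrier_special_linear)
    have "mat n n h = A"
      using Ac unfolding h by (intro eq_matI) auto
    then show "h \<in> {h \<in> topspace ?Z. det (mat n n h) = 1} \<inter> PiE ?I (\<lambda>_. cball 0 b)"
      using A unfolding h by (auto simp: carrier_special_linear)
  qed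
  finally show "compactin (product_topology (\<lambda>_. top_of_set UNIV) ?I) (?e ` ?C)"
    by simp
qed auto

lemma openin_bounded_special_linear:
  "openin (special_linear_topology n UNIV)
    {A \<in> carrier (special_linear_group n UNIV). \<forall>i<n. \<forall>j<n. norm (A $$ (i, j) :: complex) < b}"
proof -
  let ?I = "{..<n} \<times> {..<n}"
  let ?e = "\<lambda>A::complex mat. \<lambda>p \<in> ?I. A $$ p"
  have "openin (product_topology (\<lambda>_. top_of_set (UNIV :: complex set)) ?I) (PiE ?I (\<lambda>_. ball 0 b))"
    by (simp add: openin_PiE_gen)
  moreover have "{A \<in> carrier (special_linear_group n UNIV). \<forall>i<n. \<forall>j<n. norm (A $$ (i, j)) < b} =
      ?e -` PiE ?I (\<lambda>_. ball 0 b) \<inter> carrier (special_linear_group n UNIV)"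
  proof -
    have "?e A \<in> PiE ?I (\<lambda>_. ball 0 b) \<longleftrightarrow> (\<forall>i<n. \<forall>j<n. norm (A $$ (i, j)) < b)" for A
      unfolding restrict_PiE_iff by auto
    then show ?thesis by blast
  qed
  ultimately show ?thesis
    unfolding special_linear_topology_def openin_pullback_topology by (intro exI conjI)
qed

text \<open>Normalize the eigenvector so that its largest entry is one, at position \<open>r\<close>, and take unit vectors for the
  other columns. If \<open>r > 0\<close>, column \<open>r\<close> is minus the first unit vector, so that exchanging the rows \<open>0\<close> and \<open>r\<close>
  leaves a lower triangular matrix of determinant minus one.\<close>

lemma eigenvector_basis:
  fixes v :: "complex vec"
  assumes v: "v \<in> carrier_vec n" "v \<noteq> 0\<^sub>v n"
  obtains c W where "c \<noteq> 0" "W \<in> carrier_mat n n" "det W = 1" "col W 0 = c \<cdot>\<^sub>v v"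
    "\<And>i j. i < n \<Longrightarrow> j < n \<Longrightarrow> norm (W $$ (i, j)) \<le> 1"
proof -
  have n: "0 < n" using v by (intro Nat.gr0I) auto
  define M where "M = Max ((\<lambda>i. norm (v $ i)) ` {..<n})"
  have "M \<in> (\<lambda>i. norm (v $ i)) ` {..<n}"
    unfolding M_def using n by (intro Max_in) auto
  then obtain r where r: "r < n" "norm (v $ r) = M" by auto
  have le: "norm (v $ i) \<le> norm (v $ r)" if "i < n" for i
    using that r(2) unfolding M_def by auto
  have vr: "v $ r \<noteq> 0"
  proof
    assume "v $ r = 0"
    then have "\<And>i. i < n \<Longrightarrow> v $ i = 0" using le by fastforce
    then show False using v by (auto intro: eq_vecI)
  qed
  define w where "w = (1 / v $ r) \<cdot>\<^sub>v v"
  have w: "w \<in> carrier_vec n" "w $ r = 1" and w_le: "\<And>i. i < n \<Longrightarrow> norm (w $ i) \<le> 1"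
    using v r vr le by (auto simp: w_def norm_divide norm_mult divide_simps)
  define L where "L = mat n n (\<lambda>(i, j). if j = 0 then (if i = 0 then 1 else if i = r then w $ 0 else w $ i)
      else if i = j then (if i = r then -1 else 1) else 0 :: complex)"
  define L0 where "L0 = mat n n (\<lambda>(i, j). if j = 0 then w $ i else if i = j then 1 else 0 :: complex)"
  define W where "W = (if r = 0 then L0 else swaprows 0 r L)"
  have Lc: "L \<in> carrier_mat n n" "L0 \<in> carrier_mat n n" by (auto simp: L_def L0_def)
  have "det W = 1"
  proof (cases "r = 0")
    case True
    have "det L0 = prod_list (diag_mat L0)"
      using Lc by (intro det_lower_triangular[of n]) (auto simp: L0_def)
    also have "\<dots> = (\<Prod>i = 0..<n. L0 $$ (i, i))"
      using Lc by (simp add: prod_list_diag_prod)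
    also have "\<dots> = 1"
      using True w by (intro prod.neutral) (auto simp: L0_def)
    finally show ?thesis by (simp add: W_def True)
  next
    case False
    have "det L = prod_list (diag_mat L)"
      using Lc by (intro det_lower_triangular[of n]) (auto simp: L_def)
    also have "\<dots> = (\<Prod>i = 0..<n. L $$ (i, i))"
      using Lc by (simp add: prod_list_diag_prod)
    also have "\<dots> = (\<Prod>i = 0..<n. if i = r then -1 else 1)"
      using False by (intro prod.cong) (auto simp: L_def)
    also have "\<dots> = -1" using r by simp
    finally have "det L = -1" .
    then show ?thesis
      using False det_swaprows[OF n r(1) _ Lc(1)] by (simp add: W_def)
  qed
  moreover have Wc: "W \<in> carrier_mat n n"
    using Lc by (simp add: W_def)
  moreover have "col W 0 = (1 / v $ r) \<cdot>\<^sub>v v"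
  proof -
    have "W $$ (i, 0) = w $ i" if "i < n" for i
      using that r n w by (auto simp: W_def L_def L0_def)
    then show ?thesis
      using Wc w n unfolding w_def[symmetric] by (intro eq_vecI) auto
  qed
  moreover have "norm (W $$ (i, j)) \<le> 1" if "i < n" "j < n" for i j
    using that r n w_le by (auto simp: W_def L_def L0_def)
  ultimately show thesis using that[of "1 / v $ r" W] vr by simp
qed

text \<open>Like the Schur decomposition, but the change of basis is bounded in terms of the dimension instead of
  unitary, and it has determinant one: split off an eigenvector by the previous lemma and continue with the
  remaining block.\<close>

lemma bounded_triangularization:
  "\<exists>b. \<forall>A \<in> carrier_mat n n. \<exists>Q B. Q \<in> carrier_mat n n \<and> B \<in> carrier_mat n n \<and> det Q = 1 \<and>
     (\<forall>i<n. \<forall>j<n. norm (Q $$ (i, j)) \<le> b) \<and> upper_triangular B \<and> A * Q = Q * (B :: complex mat)"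
proof (induction n)
  case 0
  show ?case
    by (intro exI[of _ 0] ballI exI[of _ "1\<^sub>m 0"]) auto
next
  case (Suc n)
  then obtain b where b: "\<And>A. A \<in> carrier_mat n n \<Longrightarrow> \<exists>Q B. Q \<in> carrier_mat n n \<and> B \<in> carrier_mat n n \<and>
      det Q = 1 \<and> (\<forall>i<n. \<forall>j<n. norm (Q $$ (i, j)) \<le> b) \<and> upper_triangular B \<and> A * Q = Q * (B :: complex mat)"
    by blast
  let ?b = "real (Suc n) * max 1 b"
  show ?case
  proof (intro exI[of _ ?b] ballI)
    fix A :: "complex mat" assume A: "A \<in> carrier_mat (Suc n) (Suc n)"
    obtain e where "e \<in> spectrum A" using spectrum_non_empty[OF A] by auto
    then obtain v where v: "v \<in> carrier_vec (Suc n)" "v \<noteq> 0\<^sub>v (Suc n)" "A *\<^sub>v v = e \<cdot>\<^sub>v v"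
      using A unfolding spectrum_def eigenvalue_def eigenvector_def by auto
    obtain c W where c: "c \<noteq> 0" and W: "W \<in> carrier_mat (Suc n) (Suc n)" "det W = 1"
      and col: "col W 0 = c \<cdot>\<^sub>v v" and W_le: "\<And>i j. i < Suc n \<Longrightarrow> j < Suc n \<Longrightarrow> norm (W $$ (i, j)) \<le> 1"
      using eigenvector_basis[OF v(1,2)] by blast
    define W' where "W' = adj_mat W"
    have W': "W' \<in> carrier_mat (Suc n) (Suc n)" "W' * W = 1\<^sub>m (Suc n)" "W * W' = 1\<^sub>m (Suc n)"
      using adj_mat_special_linear[OF W] by (auto simp: W'_def)
    define M where "M = W' * A * W"
    have M: "M \<in> carrier_mat (Suc n) (Suc n)" using W W' A by (simp add: M_def)
    have AW: "A * W = W * M"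
    proof -
      have "W * M = W * (W' * (A * W))"
        unfolding M_def using W W' A by (simp add: assoc_mult_mat[of _ "Suc n" "Suc n" _ "Suc n" _ "Suc n"])
      also have "\<dots> = (W * W') * (A * W)"
        using W W' A by (intro assoc_mult_mat[symmetric, of _ "Suc n" "Suc n" _ "Suc n" _ "Suc n"]) auto
      finally show ?thesis using W W' A by simp
    qed
    have col0: "M $$ (i, 0) = (if i = 0 then e else 0)" if i: "i < Suc n" for i
    proof -
      have "col M 0 = W' *\<^sub>v (A *\<^sub>v col W 0)"
        unfolding M_def using W W' A
        by (simp add: assoc_mult_mat[of _ "Suc n" "Suc n" _ "Suc n" _ "Suc n"] col_mult2[of _ "Suc n" "Suc n" _ "Suc n"])
      also have "A *\<^sub>v col W 0 = e \<cdot>\<^sub>v col W 0"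
        unfolding col using A v by (simp add: mult_mat_vec smult_smult_assoc mult.commute)
      also have "W' *\<^sub>v (e \<cdot>\<^sub>v col W 0) = e \<cdot>\<^sub>v (W' *\<^sub>v col W 0)"
        using W W' by (intro mult_mat_vec[of _ "Suc n" "Suc n"] carrier_vecI) auto
      also have "W' *\<^sub>v col W 0 = col (W' * W) 0"
        using col_mult2[OF W'(1) W(1)] by simp
      finally have "col M 0 = e \<cdot>\<^sub>v col (1\<^sub>m (Suc n)) 0" unfolding W'(2) .
      moreover have "M $$ (i, 0) = col M 0 $ i" using M i by simp
      ultimately show ?thesis using i by simp
    qed
    define A3 where "A3 = mat n n (\<lambda>(i, j). M $$ (Suc i, Suc j))"
    obtain Q B where Q: "Q \<in> carrier_mat n n" "det Q = 1" "\<And>i j. i < n \<Longrightarrow> j < n \<Longrightarrow> norm (Q $$ (i, j)) \<le> b"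
      and B: "B \<in> carrier_mat n n" "upper_triangular B" and AQ: "A3 * Q = Q * B"
      using b[of A3] by (auto simp: A3_def)
    define R where "R = mat 1 n (\<lambda>(i, j). M $$ (0, Suc j))"
    define Q1 where "Q1 = four_block_mat (1\<^sub>m 1) (0\<^sub>m 1 n) (0\<^sub>m n 1) Q"
    define B1 where "B1 = four_block_mat (mat 1 1 (\<lambda>_. e)) (R * Q) (0\<^sub>m n 1) B"
    have R: "R \<in> carrier_mat 1 n" and A3: "A3 \<in> carrier_mat n n" by (auto simp: R_def A3_def)
    have M_block: "M = four_block_mat (mat 1 1 (\<lambda>_. e)) R (0\<^sub>m n 1) A3"
      using M col0 by (intro eq_matI) (auto simp: R_def A3_def)
    have Q1: "Q1 \<in> carrier_mat (Suc n) (Suc n)" and B1: "B1 \<in> carrier_mat (Suc n) (Suc n)"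
      using Q(1) B(1) by (auto simp: Q1_def B1_def)
    have MQ: "M * Q1 = Q1 * B1"
    proof -
      have "M * Q1 = four_block_mat (mat 1 1 (\<lambda>_. e)) (R * Q) (0\<^sub>m n 1) (A3 * Q)"
        unfolding M_block Q1_def using R A3 Q(1)
        by (subst mult_four_block_mat[of _ 1 1 _ n _ n _ _ 1 _ n]) auto
      moreover have "Q1 * B1 = four_block_mat (mat 1 1 (\<lambda>_. e)) (R * Q) (0\<^sub>m n 1) (Q * B)"
        unfolding B1_def Q1_def using R B(1) Q(1)
        by (subst mult_four_block_mat[of _ 1 1 _ n _ n _ _ 1 _ n]) auto
      ultimately show ?thesis using AQ by simp
    qed
    have "det Q1 = 1"
      unfolding Q1_def using Q(1,2)
      by (subst det_four_block_mat_lower_left_zero[of _ 1 _ n]) auto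
    then have det: "det (W * Q1) = 1"
      using det_mult[OF W(1) Q1] W(2) by simp
    have up: "upper_triangular B1"
      using B Q(1) R unfolding B1_def upper_triangular_def by auto
    have Q1_le: "norm (Q1 $$ (i, j)) \<le> max 1 b" if "i < Suc n" "j < Suc n" for i j
    proof (cases "0 < i \<and> 0 < j")
      case True
      then have "norm (Q $$ (i - 1, j - 1)) \<le> b" using that by (intro Q(3)) auto
      then show ?thesis using True that Q(1) by (simp add: Q1_def max.coboundedI2)
    qed (use that Q(1) in \<open>auto simp: Q1_def\<close>)
    have le: "norm ((W * Q1) $$ (i, j)) \<le> ?b" if ij: "i < Suc n" "j < Suc n" for i j
    proof -
      have "(W * Q1) $$ (i, j) = (\<Sum>k = 0..<Suc n. W $$ (i, k) * Q1 $$ (k, j))"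
        using W Q1 ij by (auto simp: scalar_prod_def simp del: sum.op_ivl_Suc)
      also have "norm \<dots> \<le> (\<Sum>k = 0..<Suc n. 1 * max 1 b)"
      proof (intro order_trans[OF norm_sum] sum_mono)
        fix k assume "k \<in> {0..<Suc n}"
        then show "norm (W $$ (i, k) * Q1 $$ (k, j)) \<le> 1 * max 1 b"
          unfolding norm_mult using W_le Q1_le ij by (intro mult_mono) auto
      qed
      also have "\<dots> = ?b" by simp
      finally show ?thesis .
    qed
    have "A * (W * Q1) = (A * W) * Q1"
      using A W Q1 by (simp add: assoc_mult_mat[of _ "Suc n" "Suc n" _ "Suc n" _ "Suc n"])
    also have "\<dots> = W * (M * Q1)"
      unfolding AW using W M Q1 by (simp add: assoc_mult_mat[of _ "Suc n" "Suc n" _ "Suc n" _ "Suc n"])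
    also have "\<dots> = (W * Q1) * B1"
      unfolding MQ using W B1 Q1 by (simp add: assoc_mult_mat[of _ "Suc n" "Suc n" _ "Suc n" _ "Suc n"])
    finally have eq: "A * (W * Q1) = (W * Q1) * B1" .
    show "\<exists>Q B. Q \<in> carrier_mat (Suc n) (Suc n) \<and> B \<in> carrier_mat (Suc n) (Suc n) \<and> det Q = 1 \<and>
        (\<forall>i<Suc n. \<forall>j<Suc n. norm (Q $$ (i, j)) \<le> ?b) \<and> upper_triangular B \<and> A * Q = Q * B"
      using W(1) Q1 B1 det le up eq by (intro exI[of _ "W * Q1"] exI[of _ B1]) auto
  qed
qed

section \<open>Coarser group topologies on a triangular group\<close>

text \<open>The Heisenberg group consists of the unipotent upper triangular matrices that differ from the identity only
  in the first row, given by \<open>y\<close>, in the last column, given by \<open>x\<close>, and in the corner \<open>t\<close> that both have in common.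
  At the indices \<open>0\<close> and \<open>n - 1\<close> the diagonal and the corner take precedence over \<open>x\<close> and \<open>y\<close>.\<close>

definition heisenberg :: "nat \<Rightarrow> (nat \<Rightarrow> 'a) \<Rightarrow> (nat \<Rightarrow> 'a) \<Rightarrow> 'a \<Rightarrow> 'a::comm_ring_1 mat" where
  "heisenberg n x y t = mat n n (\<lambda>(i, j).
     if i = j then 1
     else if i = 0 then (if j = n - 1 then t else y j)
     else if j = n - 1 then x i else 0)"

lemma heisenberg_carrier [simp]: "heisenberg n x y t \<in> carrier_mat n n"
  "dim_row (heisenberg n x y t) = n" "dim_col (heisenberg n x y t) = n"
  by (simp_all add: heisenberg_def)

lemma heisenberg_entry:
  "i < n \<Longrightarrow> j < n \<Longrightarrow> heisenberg n x y t $$ (i, j) =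
    (if i = j then 1 else if i = 0 then (if j = n - 1 then t else y j)
     else if j = n - 1 then x i else 0)"
  by (simp add: heisenberg_def)

lemma heisenberg_cong:
  assumes "\<And>i. 0 < i \<Longrightarrow> i < n - 1 \<Longrightarrow> x i = x' i" "\<And>i. 0 < i \<Longrightarrow> i < n - 1 \<Longrightarrow> y i = y' i" "t = t'"
  shows "heisenberg n x y t = heisenberg n x' y' t'"
  using assms by (intro eq_matI) (auto simp: heisenberg_entry)

lemma heisenberg_one: "heisenberg n (\<lambda>_. 0) (\<lambda>_. 0) 0 = 1\<^sub>m n"
  by (intro eq_matI) (auto simp: heisenberg_entry)

lemma heisenberg_mult:
  assumes n: "2 \<le> n"
  shows "heisenberg n x y t * heisenberg n x' y' t' =
    heisenberg n (\<lambda>i. x i + x' i) (\<lambda>j. y j + y' j) (t + t' + (\<Sum>k\<in>{1..<n - 1}. y k * x' k))"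
    (is "?A * ?B = ?C")
proof (rule eq_matI)
  fix i j assume "i < dim_row ?C" "j < dim_col ?C"
  then have ij: "i < n" "j < n" by auto
  have split: "sum f {0..<n} = f 0 + sum f {1..<n - 1} + f (n - 1)" for f :: "nat \<Rightarrow> 'a"
  proof -
    have "{0..<n} = insert 0 (insert (n - 1) {1..<n - 1})" using n by auto
    then show ?thesis using n by (simp add: add.commute add.left_commute)
  qed
  have prod: "(?A * ?B) $$ (i, j) = ?A $$ (i, 0) * ?B $$ (0, j) + (\<Sum>k\<in>{1..<n - 1}. ?A $$ (i, k) * ?B $$ (k, j))
      + ?A $$ (i, n - 1) * ?B $$ (n - 1, j)"
    using ij by (simp add: scalar_prod_def split)
  consider "i = 0" "j = 0" | "i = 0" "j = n - 1" | "i = 0" "0 < j" "j < n - 1"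
    | "0 < i" "i < n - 1" | "i = n - 1"
    using ij by linarith
  then show "(?A * ?B) $$ (i, j) = ?C $$ (i, j)"
  proof cases
    case 1
    have "(\<Sum>k\<in>{1..<n - 1}. ?A $$ (i, k) * ?B $$ (k, j)) = 0"
      using 1 n by (intro sum.neutral) (auto simp: heisenberg_entry)
    then show ?thesis unfolding prod using 1 n by (auto simp: heisenberg_entry)
  next
    case 2
    have "(\<Sum>k\<in>{1..<n - 1}. ?A $$ (i, k) * ?B $$ (k, j)) = (\<Sum>k\<in>{1..<n - 1}. y k * x' k)"
      using 2 n by (intro sum.cong) (auto simp: heisenberg_entry)
    then show ?thesis unfolding prod using 2 n by (auto simp: heisenberg_entry)
  next
    case 3
    have "(\<Sum>k\<in>{1..<n - 1}. ?A $$ (i, k) * ?B $$ (k, j)) = (\<Sum>k\<in>{1..<n - 1}. if k = j then y j else 0)"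
      using 3 n by (intro sum.cong) (auto simp: heisenberg_entry)
    also have "\<dots> = y j" using 3 by simp
    finally show ?thesis unfolding prod using 3 n by (auto simp: heisenberg_entry)
  next
    case 4
    have "(\<Sum>k\<in>{1..<n - 1}. ?A $$ (i, k) * ?B $$ (k, j)) = (\<Sum>k\<in>{1..<n - 1}. if k = i then ?B $$ (i, j) else 0)"
      using 4 n by (intro sum.cong) (auto simp: heisenberg_entry)
    also have "\<dots> = ?B $$ (i, j)" using 4 by simp
    finally show ?thesis unfolding prod using 4 n ij by (auto simp: heisenberg_entry)
  next
    case 5
    have "(\<Sum>k\<in>{1..<n - 1}. ?A $$ (i, k) * ?B $$ (k, j)) = 0"
      using 5 n by (intro sum.neutral) (auto simp: heisenberg_entry)
    then show ?thesis unfolding prod using 5 n ij by (auto simp: heisenberg_entry)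
  qed
qed auto

text \<open>Conjugation by \<open>diag(s, 1, \<dots>, 1, 1/s)\<close> multiplies the upper right corner of a matrix by \<open>s\<^sup>2\<close>.\<close>

definition corner_torus :: "nat \<Rightarrow> 'a \<Rightarrow> 'a::field mat" where
  "corner_torus n s = mat n n (\<lambda>(i, j). if i \<noteq> j then 0 else if i = 0 then s
     else if i = n - 1 then inverse s else 1)"

lemma corner_torus_carrier [simp]: "corner_torus n s \<in> carrier_mat n n"
  "dim_row (corner_torus n s) = n" "dim_col (corner_torus n s) = n"
  by (simp_all add: corner_torus_def)

abbreviation torus_entry :: "nat \<Rightarrow> 'a \<Rightarrow> nat \<Rightarrow> 'a::field" where
  "torus_entry n s i \<equiv> (if i = 0 then s else if i = n - 1 then inverse s else 1)"

lemma corner_torus_mult_left: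
  assumes "A \<in> carrier_mat n n" "i < n" "j < n"
  shows "(corner_torus n s * A) $$ (i, j) = torus_entry n s i * A $$ (i, j)"
proof -
  have "(corner_torus n s * A) $$ (i, j) = (\<Sum>k = 0..<n. corner_torus n s $$ (i, k) * A $$ (k, j))"
    using assms by (auto simp: scalar_prod_def)
  also have "\<dots> = (\<Sum>k = 0..<n. if k = i then torus_entry n s i * A $$ (i, j) else 0)"
    using assms by (intro sum.cong) (auto simp: corner_torus_def)
  also have "\<dots> = torus_entry n s i * A $$ (i, j)" using assms by simp
  finally show ?thesis .
qed

lemma corner_torus_mult_right:
  assumes "A \<in> carrier_mat n n" "i < n" "j < n"
  shows "(A * corner_torus n s) $$ (i, j) = A $$ (i, j) * torus_entry n s j"
proof -
  have "(A * corner_torus n s) $$ (i, j) = (\<Sum>k = 0..<n. A $$ (i, k) * corner_torus n s $$ (k, j))"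
    using assms by (auto simp: scalar_prod_def)
  also have "\<dots> = (\<Sum>k = 0..<n. if k = j then A $$ (i, j) * torus_entry n s j else 0)"
    using assms by (intro sum.cong) (auto simp: corner_torus_def)
  also have "\<dots> = A $$ (i, j) * torus_entry n s j" using assms by simp
  finally show ?thesis .
qed

lemma det_corner_torus:
  assumes "2 \<le> n" "s \<noteq> 0"
  shows "det (corner_torus n s) = 1"
proof -
  have "upper_triangular (corner_torus n s)"
    by (auto simp: upper_triangular_def corner_torus_def)
  then have "det (corner_torus n s) = (\<Prod>i = 0..<n. corner_torus n s $$ (i, i))"
    by (simp add: det_upper_triangular[of _ n] prod_list_diag_prod)
  also have "\<dots> = (\<Prod>i\<in>{0..<n}. torus_entry n s i)"
    by (intro prod.cong) (auto simp: corner_torus_def)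
  also have "\<dots> = 1"
  proof -
    have "{0..<n} = insert 0 (insert (n - 1) {1..<n - 1})" using assms by auto
    moreover have "(\<Prod>i\<in>{1..<n - 1}. torus_entry n s i) = 1" by (intro prod.neutral) auto
    ultimately show ?thesis using assms by simp
  qed
  finally show ?thesis .
qed

locale coarse_triangular_topology = complex_subfield +
  fixes n :: nat and \<sigma> :: "complex mat topology"
  assumes n: "2 \<le> n"
    and top: "topological_group (special_triangular_group n K) \<sigma>"
    and coarser: "\<And>U. openin \<sigma> U \<Longrightarrow> openin (special_triangular_topology n K) U"
begin

abbreviation "M \<equiv> special_triangular_group n K"

sublocale M: group M
  by (rule topological_groupD(1)[OF top])

lemma topspace_eq: "topspace \<sigma> = carrier M"
  by (rule topological_groupD(2)[OF top])

lemma M_carrier: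
  "A \<in> carrier M \<Longrightarrow> A \<in> carrier_mat n n" "A \<in> carrier M \<Longrightarrow> i < n \<Longrightarrow> j < n \<Longrightarrow> A $$ (i, j) \<in> K"
  "A \<in> carrier M \<Longrightarrow> det A = 1" "A \<in> carrier M \<Longrightarrow> i < n \<Longrightarrow> j < i \<Longrightarrow> A $$ (i, j) = 0"
  by (auto simp: carrier_special_triangular carrier_special_linear)

lemma limit_of_entries:
  assumes "L \<in> carrier M" "eventually (\<lambda>x. f x \<in> carrier M) F"
    "\<And>i j. i < n \<Longrightarrow> j < n \<Longrightarrow> ((\<lambda>x. f x $$ (i, j)) \<longlongrightarrow> L $$ (i, j)) F"
  shows "limitin \<sigma> f L F"
proof (rule limitin_coarser[OF coarser])
  show "L \<in> topspace \<sigma>" using assms(1) topspace_eq by simp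
  show "limitin (special_triangular_topology n K) f L F"
    using assms by (simp add: limitin_special_triangular)
qed

lemma M_inv: "A \<in> carrier M \<Longrightarrow> inv\<^bsub>M\<^esub> A * A = 1\<^sub>m n" "A \<in> carrier M \<Longrightarrow> A * inv\<^bsub>M\<^esub> A = 1\<^sub>m n"
  using M.l_inv M.r_inv by simp_all

lemma mult_limit: "limitin \<sigma> f a F \<Longrightarrow> limitin \<sigma> g b F \<Longrightarrow> limitin \<sigma> (\<lambda>x. f x * g x) (a * b) F"
  using limitin_mult[OF top, of f a F g b] by simp

lemma heisenberg_in_M:
  assumes "\<And>i. 0 < i \<Longrightarrow> i < n - 1 \<Longrightarrow> x i \<in> K" "\<And>i. 0 < i \<Longrightarrow> i < n - 1 \<Longrightarrow> y i \<in> K" "t \<in> K"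
  shows "heisenberg n x y t \<in> carrier M"
proof -
  have up: "upper_triangular (heisenberg n x y t)"
    by (auto simp: upper_triangular_def heisenberg_entry)
  then have "det (heisenberg n x y t) = (\<Prod>i = 0..<n. heisenberg n x y t $$ (i, i))"
    by (simp add: det_upper_triangular[of _ n] prod_list_diag_prod)
  also have "\<dots> = 1" by (intro prod.neutral) (auto simp: heisenberg_entry)
  finally show ?thesis
    using up assms by (auto simp: carrier_special_triangular carrier_special_linear heisenberg_entry field_K)
qed

lemma torus_in_M:
  assumes "s \<in> K" "s \<noteq> 0"
  shows "corner_torus n s \<in> carrier M"
  using det_corner_torus[OF n assms(2)] assms
  by (auto simp: carrier_special_triangular carrier_special_linear corner_torus_def field_K)

abbreviation "corner t \<equiv> heisenberg n (\<lambda>_. 0) (\<lambda>_. 0) t"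

lemma corner_in_M: "t \<in> K \<Longrightarrow> corner t \<in> carrier M"
  by (rule heisenberg_in_M) (auto simp: zero_K)

lemma corner_mult: "corner s * corner t = corner (s + t)"
  using heisenberg_mult[OF n, of "\<lambda>_. 0" "\<lambda>_. 0" s "\<lambda>_. 0" "\<lambda>_. 0" t] by simp

lemma corner_inv: "t \<in> K \<Longrightarrow> inv\<^bsub>M\<^esub> (corner t) = corner (- t)"
  by (rule M.inv_equality) (auto simp: corner_mult heisenberg_one corner_in_M uminus_K)

lemma torus_conj_corner:
  assumes "s \<in> K" "s \<noteq> 0" "t \<in> K"
  shows "corner_torus n s * corner t * inv\<^bsub>M\<^esub> (corner_torus n s) = corner (s\<^sup>2 * t)"
proof -
  have "corner_torus n s * corner t = corner (s\<^sup>2 * t) * corner_torus n s"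
    using n assms(2)
    by (intro eq_matI)
      (auto simp: corner_torus_mult_left[of _ n] corner_torus_mult_right[of _ n] heisenberg_entry
        power2_eq_square simp del: index_mult_mat(1))
  then have "corner_torus n s \<otimes>\<^bsub>M\<^esub> corner t = corner (s\<^sup>2 * t) \<otimes>\<^bsub>M\<^esub> corner_torus n s" by simp
  then have "corner_torus n s \<otimes>\<^bsub>M\<^esub> corner t \<otimes>\<^bsub>M\<^esub> inv\<^bsub>M\<^esub> (corner_torus n s) = corner (s\<^sup>2 * t)"
    using torus_in_M[OF assms(1,2)] corner_in_M[OF assms(3)] corner_in_M[of "s\<^sup>2 * t"] assms
    by (simp add: M.m_assoc mult_K power_K del: special_linear_group_simps)
  then show ?thesis by simp
qed

lemma one_in_M: "1\<^sub>m n \<in> carrier M"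
  using M.one_closed by simp

text \<open>If corners \<open>t\<close> in a net tend to the identity while \<open>t\<close> tends to infinity, put
  \<open>b = 1/(4t)\<close>. The torus elements for \<open>1 + b\<close> and \<open>1 - b\<close> tend to the identity, and conjugation by
  them produces the corners \<open>(1 + b)\<^sup>2t\<close> and \<open>(1 - b)\<^sup>2t\<close>, whose difference is constantly one.\<close>

lemma corner_limit_not_at_infinity:
  assumes lim: "limitin \<sigma> (\<lambda>x. corner (t x)) (1\<^sub>m n) F" and K: "eventually (\<lambda>x. t x \<in> K) F"
    and inf: "filterlim t at_infinity F"
  shows "F = bot"
proof (rule ccontr)
  assume F: "F \<noteq> bot"
  define b where "b x = inverse (4 * t x)" for x
  have "filterlim (\<lambda>x. 4 * t x) at_infinity F"
    by (rule tendsto_mult_filterlim_at_infinity[OF tendsto_const _ inf]) simp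
  then have b0: "(b \<longlongrightarrow> 0) F"
    unfolding b_def by (rule filterlim_compose[OF tendsto_inverse_0])
  have t0: "eventually (\<lambda>x. t x \<noteq> 0) F"
    using inf by (rule filterlim_at_infinity_imp_eventually_ne)
  have bK: "eventually (\<lambda>x. b x \<in> K) F"
    using K unfolding b_def by eventually_elim (intro inverse_K mult_K numeral_K)
  have torus: "limitin \<sigma> (\<lambda>x. corner_torus n (1 + c * b x)) (1\<^sub>m n) F"
    and torus_ev: "eventually (\<lambda>x. 1 + c * b x \<noteq> 0 \<and> 1 + c * b x \<in> K) F" if c: "c \<in> K" for c
  proof -
    have l: "((\<lambda>x. 1 + c * b x) \<longlongrightarrow> 1) F"
      using tendsto_add[OF tendsto_const[of 1] tendsto_mult[OF tendsto_const[of c] b0]] by simp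
    then have "eventually (\<lambda>x. 1 + c * b x \<noteq> 0) F"
      by (rule tendsto_imp_eventually_ne) simp
    then show ev: "eventually (\<lambda>x. 1 + c * b x \<noteq> 0 \<and> 1 + c * b x \<in> K) F"
      using bK by eventually_elim (simp add: c field_K)
    have l': "((\<lambda>x. inverse (1 + c * b x)) \<longlongrightarrow> 1) F"
      using tendsto_inverse[OF l] by simp
    show "limitin \<sigma> (\<lambda>x. corner_torus n (1 + c * b x)) (1\<^sub>m n) F"
    proof (rule limit_of_entries[OF one_in_M])
      show "eventually (\<lambda>x. corner_torus n (1 + c * b x) \<in> carrier M) F"
        using ev by eventually_elim (simp add: torus_in_M)
      fix i j assume "i < n" "j < n"
      then show "((\<lambda>x. corner_torus n (1 + c * b x) $$ (i, j)) \<longlongrightarrow> 1\<^sub>m n $$ (i, j)) F"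
        using l l' by (cases "i = j"; cases "i = 0"; cases "i = n - 1") (simp_all add: corner_torus_def)
    qed
  qed
  define w where "w c x = corner_torus n (1 + c * b x) * corner (t x) * inv\<^bsub>M\<^esub> (corner_torus n (1 + c * b x))"
    for c x
  have w: "limitin \<sigma> (w c) (1\<^sub>m n) F" if c: "c \<in> K" for c
  proof -
    have "limitin \<sigma> (w c) (1\<^sub>m n * 1\<^sub>m n * inv\<^bsub>M\<^esub> (1\<^sub>m n)) F"
      unfolding w_def by (intro mult_limit limitin_inv[OF top] torus[OF c] lim)
    moreover have "inv\<^bsub>M\<^esub> (1\<^sub>m n) = 1\<^sub>m n" using M.inv_one by simp
    ultimately show ?thesis by simp
  qed
  have "limitin \<sigma> (\<lambda>x. w 1 x * inv\<^bsub>M\<^esub> (w (-1) x)) (1\<^sub>m n * inv\<^bsub>M\<^esub> (1\<^sub>m n)) F"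
    by (intro mult_limit limitin_inv[OF top] w uminus_K one_K)
  then have "limitin \<sigma> (\<lambda>x. w 1 x * inv\<^bsub>M\<^esub> (w (-1) x)) (1\<^sub>m n) F"
    using M.inv_one by simp
  moreover have "eventually (\<lambda>x. w 1 x * inv\<^bsub>M\<^esub> (w (-1) x) = corner 1) F"
    using torus_ev[OF one_K] torus_ev[OF uminus_K[OF one_K]] K t0
  proof eventually_elim
    case (elim x)
    have "w 1 x = corner ((1 + b x)\<^sup>2 * t x)" "w (-1) x = corner ((1 - b x)\<^sup>2 * t x)"
      unfolding w_def using elim by (simp_all add: torus_conj_corner)
    moreover have "(1 - b x)\<^sup>2 * t x \<in> K"
      using elim by (simp add: field_K)
    moreover have "(1 + b x)\<^sup>2 * t x + - ((1 - b x)\<^sup>2 * t x) = 1"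
      using elim by (simp add: b_def power2_eq_square field_simps)
    ultimately show ?case by (simp only: corner_inv corner_mult)
  qed
  ultimately have "limitin \<sigma> (\<lambda>x. corner 1) (1\<^sub>m n) F"
    by (rule limitin_transform_eventually[rotated])
  moreover have "limitin \<sigma> (\<lambda>x. corner 1) (corner 1) F"
    by (rule limitin_group_const[OF top corner_in_M[OF one_K]])
  ultimately have "1\<^sub>m n = (corner 1 :: complex mat)"
    using F topological_groupD(3)[OF top] by (rule limitin_Hausdorff_unique)
  then have "1\<^sub>m n $$ (0, n - 1) = (corner 1 :: complex mat) $$ (0, n - 1)" by simp
  then show False using n by (simp add: heisenberg_entry)
qed

text \<open>If the corners near the identity were unbounded, those that are near the identity and far from zero would
  generate a proper filter, along which corners tend to the identity and to infinity at once.\<close>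

lemma corner_bounded_near_one:
  "\<exists>R. eventually (\<lambda>t. norm t \<le> R) (inf (filtercomap corner (nhdsin \<sigma> (1\<^sub>m n))) (principal K))"
proof (rule ccontr)
  let ?G = "inf (filtercomap corner (nhdsin \<sigma> (1\<^sub>m n))) (principal K)"
  assume unbounded: "\<nexists>R. eventually (\<lambda>t. norm t \<le> R) ?G"
  let ?F = "inf ?G at_infinity"
  have "?F = bot"
  proof (rule corner_limit_not_at_infinity)
    have "limitin \<sigma> corner (1\<^sub>m n) (filtercomap corner (nhdsin \<sigma> (1\<^sub>m n)))"
      by (rule limitin_filtercomap) (use one_in_M topspace_eq in simp)
    then show "limitin \<sigma> (\<lambda>x. corner x) (1\<^sub>m n) ?F"
      by (rule limitin_filter_mono) (simp add: inf.coboundedI1)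
    show "eventually (\<lambda>x. x \<in> K) ?F"
      by (rule filter_leD[of _ "principal K"]) (auto simp: eventually_principal inf.coboundedI1)
    show "filterlim (\<lambda>x. x) at_infinity ?F"
      by (simp add: filterlim_def)
  qed
  then have "eventually (\<lambda>_. False) ?F" by simp
  then obtain P Q where PQ: "eventually P ?G" "eventually Q at_infinity" "\<And>x. P x \<and> Q x \<Longrightarrow> False"
    unfolding eventually_inf[of _ ?G] by blast
  then obtain R where "\<And>x. R \<le> norm x \<Longrightarrow> Q x"
    unfolding eventually_at_infinity by blast
  then have "eventually (\<lambda>t. norm t \<le> R) ?G"
    using PQ(3) by (intro eventually_mono[OF PQ(1)]) (meson linear)
  then show False using unbounded by blast
qed

text \<open>Hence the corner subgroup carries its usual topology: rescaling by \<open>s\<^sup>2\<close> maps corners that tend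
  to the identity to such corners, and the rescaled ones stay within the same bound.\<close>

lemma corner_limit:
  assumes lim: "limitin \<sigma> (\<lambda>x. corner (t x)) (1\<^sub>m n) F" and K: "eventually (\<lambda>x. t x \<in> K) F"
  shows "(t \<longlongrightarrow> 0) F"
proof -
  obtain R where R: "eventually (\<lambda>t. norm t \<le> R) (inf (filtercomap corner (nhdsin \<sigma> (1\<^sub>m n))) (principal K))"
    using corner_bounded_near_one by blast
  have scaled: "eventually (\<lambda>x. norm (s\<^sup>2 * t x) \<le> R) F" if s: "s \<in> K" "s \<noteq> 0" for s
  proof -
    have "limitin \<sigma> (\<lambda>x. corner_torus n s * corner (t x) * inv\<^bsub>M\<^esub> (corner_torus n s))
        (corner_torus n s * 1\<^sub>m n * inv\<^bsub>M\<^esub> (corner_torus n s)) F"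
      by (intro mult_limit lim limitin_group_const[OF top] torus_in_M s M.inv_closed)
    moreover have "corner_torus n s * 1\<^sub>m n * inv\<^bsub>M\<^esub> (corner_torus n s) = 1\<^sub>m n"
      using M_inv(2)[OF torus_in_M[OF s]] by simp
    moreover have "eventually (\<lambda>x. corner_torus n s * corner (t x) * inv\<^bsub>M\<^esub> (corner_torus n s)
        = corner (s\<^sup>2 * t x)) F"
      using K by eventually_elim (simp add: torus_conj_corner s)
    ultimately have l: "limitin \<sigma> (\<lambda>x. corner (s\<^sup>2 * t x)) (1\<^sub>m n) F"
      by (simp add: limitin_transform_eventually)
    obtain P where P: "eventually P (nhdsin \<sigma> (1\<^sub>m n))" "\<And>u. u \<in> K \<Longrightarrow> P (corner u) \<Longrightarrow> norm u \<le> R"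
      using R unfolding eventually_inf_principal eventually_filtercomap by blast
    obtain U where U: "openin \<sigma> U" "1\<^sub>m n \<in> U" "\<And>A. A \<in> U \<Longrightarrow> P A"
      using P(1) one_in_M topspace_eq unfolding eventually_nhdsin by blast
    have "eventually (\<lambda>x. corner (s\<^sup>2 * t x) \<in> U) F"
      by (rule limitinD[OF l U(1,2)])
    then show ?thesis
      using K
    proof eventually_elim
      case (elim x)
      show ?case
        by (rule P(2)) (use elim U(3) s in \<open>auto intro: mult_K power_K\<close>)
    qed
  qed
  show ?thesis
    unfolding tendsto_iff
  proof (intro allI impI)
    fix e :: real assume e: "0 < e"
    obtain m :: nat where m: "\<bar>R\<bar> / e < of_nat m" using reals_Archimedean2 by blast
    then have m0: "0 < m" using e by (cases m) (auto simp: field_simps)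
    have "of_nat m \<in> K" by (induction m) (auto intro: zero_K one_K add_K)
    then have "eventually (\<lambda>x. norm ((of_nat m)\<^sup>2 * t x) \<le> R) F"
      using scaled m0 by simp
    then show "eventually (\<lambda>x. dist (t x) 0 < e) F"
    proof eventually_elim
      case (elim x)
      have "real m * norm (t x) \<le> (real m)\<^sup>2 * norm (t x)"
        using m0 by (intro mult_right_mono) (auto simp: power2_eq_square)
      also have "\<dots> \<le> R" using elim by (simp add: norm_mult norm_power)
      also have "\<dots> \<le> \<bar>R\<bar>" by simp
      also have "\<dots> < real m * e" using m e by (simp add: field_simps)
      finally show ?case using m0 by simp
    qed
  qed
qed

text \<open>Commutators with fixed elements of the Heisenberg group move every entry of its first row and
  last column into the corner.\<close>

lemma heisenberg_limit_one:
  assumes lim: "limitin \<sigma> (\<lambda>a. heisenberg n (x a) (y a) (t a)) (1\<^sub>m n) F"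
    and K: "eventually (\<lambda>a. (\<forall>i. 0 < i \<and> i < n - 1 \<longrightarrow> x a i \<in> K \<and> y a i \<in> K) \<and> t a \<in> K) F"
  shows "\<And>i. 0 < i \<Longrightarrow> i < n - 1 \<Longrightarrow> ((\<lambda>a. x a i) \<longlongrightarrow> 0) F"
    "\<And>i. 0 < i \<Longrightarrow> i < n - 1 \<Longrightarrow> ((\<lambda>a. y a i) \<longlongrightarrow> 0) F" "(t \<longlongrightarrow> 0) F"
proof -
  let ?H = "\<lambda>a. heisenberg n (x a) (y a) (t a)"
  have H: "eventually (\<lambda>a. ?H a \<in> carrier M) F"
    using K by eventually_elim (rule heisenberg_in_M, blast+)
  have comm: "limitin \<sigma> (\<lambda>a. ?H a * A * inv\<^bsub>M\<^esub> (A * ?H a)) (1\<^sub>m n) F" if A: "A \<in> carrier M" for A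
  proof -
    have "limitin \<sigma> (\<lambda>a. ?H a * A * inv\<^bsub>M\<^esub> (A * ?H a)) (1\<^sub>m n * A * inv\<^bsub>M\<^esub> (A * 1\<^sub>m n)) F"
      by (intro mult_limit lim limitin_inv[OF top] limitin_group_const[OF top] A)
    then show ?thesis using M_carrier(1)[OF A] M_inv(2)[OF A] by simp
  qed
  have cancel: "B * A * inv\<^bsub>M\<^esub> (A * B) = corner u"
    if "A \<in> carrier M" "B \<in> carrier M" "u \<in> K" "B * A = corner u * (A * B)" for A B u
  proof -
    have "B \<otimes>\<^bsub>M\<^esub> A \<otimes>\<^bsub>M\<^esub> inv\<^bsub>M\<^esub> (A \<otimes>\<^bsub>M\<^esub> B) = corner u \<otimes>\<^bsub>M\<^esub> (A \<otimes>\<^bsub>M\<^esub> B) \<otimes>\<^bsub>M\<^esub> inv\<^bsub>M\<^esub> (A \<otimes>\<^bsub>M\<^esub> B)"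
      using that(4) by simp
    also have "\<dots> = corner u"
      using that(1,2) corner_in_M[OF that(3)] M.m_closed[OF that(1,2)] by (simp only: M.m_assoc M.r_inv M.m_closed M.inv_closed M.r_one)
    finally show ?thesis by simp
  qed
  show xlim: "((\<lambda>a. x a i) \<longlongrightarrow> 0) F" if i: "0 < i" "i < n - 1" for i
  proof -
    let ?A = "heisenberg n (\<lambda>_. 0) (\<lambda>k. if k = i then -1 else 0) 0"
    have A: "?A \<in> carrier M" by (rule heisenberg_in_M) (auto simp: field_K)
    have s: "(\<Sum>k = Suc 0..<n - Suc 0. (if k = i then -1 else 0) * x a k) = - x a i" for a
    proof -
      have "(\<Sum>k = Suc 0..<n - Suc 0. (if k = i then -1 else 0) * x a k)
        = (\<Sum>k = Suc 0..<n - Suc 0. if k = i then - x a i else 0)" by (intro sum.cong) auto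
      then show ?thesis using i by simp
    qed
    have "eventually (\<lambda>a. ?H a * ?A * inv\<^bsub>M\<^esub> (?A * ?H a) = corner (x a i)) F"
      using H K
    proof eventually_elim
      case (elim a)
      have "?H a * ?A = corner (x a i) * (?A * ?H a)"
        by (simp add: heisenberg_mult[OF n] s add.commute)
      then show ?case by (rule cancel[OF A elim(1), rotated]) (use elim(2) i in blast)
    qed
    then have "limitin \<sigma> (\<lambda>a. corner (x a i)) (1\<^sub>m n) F"
      using comm[OF A] by (rule limitin_transform_eventually)
    then show ?thesis
      by (rule corner_limit) (rule eventually_mono[OF K], use i in blast)
  qed
  show ylim: "((\<lambda>a. y a i) \<longlongrightarrow> 0) F" if i: "0 < i" "i < n - 1" for i
  proof -
    let ?A = "heisenberg n (\<lambda>k. if k = i then 1 else 0) (\<lambda>_. 0) 0"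
    have A: "?A \<in> carrier M" by (rule heisenberg_in_M) (auto simp: field_K)
    have s: "(\<Sum>k = Suc 0..<n - Suc 0. y a k * (if k = i then 1 else 0)) = y a i" for a
    proof -
      have "(\<Sum>k = Suc 0..<n - Suc 0. y a k * (if k = i then 1 else 0))
        = (\<Sum>k = Suc 0..<n - Suc 0. if k = i then y a i else 0)" by (intro sum.cong) auto
      then show ?thesis using i by simp
    qed
    have "eventually (\<lambda>a. ?H a * ?A * inv\<^bsub>M\<^esub> (?A * ?H a) = corner (y a i)) F"
      using H K
    proof eventually_elim
      case (elim a)
      have "?H a * ?A = corner (y a i) * (?A * ?H a)"
        by (simp add: heisenberg_mult[OF n] s add.commute)
      then show ?case by (rule cancel[OF A elim(1), rotated]) (use elim(2) i in blast)
    qed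
    then have "limitin \<sigma> (\<lambda>a. corner (y a i)) (1\<^sub>m n) F"
      using comm[OF A] by (rule limitin_transform_eventually)
    then show ?thesis
      by (rule corner_limit) (rule eventually_mono[OF K], use i in blast)
  qed
  show "(t \<longlongrightarrow> 0) F"
  proof (rule corner_limit)
    let ?B = "\<lambda>a. heisenberg n (x a) (y a) 0"
    have B: "eventually (\<lambda>a. ?B a \<in> carrier M) F"
      using K by eventually_elim (rule heisenberg_in_M, (blast intro: zero_K)+)
    have "limitin \<sigma> ?B (1\<^sub>m n) F"
    proof (rule limit_of_entries[OF one_in_M B])
      fix i j assume ij: "i < n" "j < n"
      consider "i = j" | "i \<noteq> j" "i = 0" "j = n - 1" | "i \<noteq> j" "i = 0" "0 < j" "j < n - 1"
        | "i \<noteq> j" "0 < i" "j = n - 1" "i < n - 1" | "i \<noteq> j" "0 < i" "j \<noteq> n - 1"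
        using ij by linarith
      then show "((\<lambda>a. ?B a $$ (i, j)) \<longlongrightarrow> 1\<^sub>m n $$ (i, j)) F"
        by cases (use ij xlim[of i] ylim[of j] in \<open>simp_all add: heisenberg_entry\<close>)
    qed
    then have "limitin \<sigma> (\<lambda>a. ?H a * inv\<^bsub>M\<^esub> (?B a)) (1\<^sub>m n * inv\<^bsub>M\<^esub> (1\<^sub>m n)) F"
      by (intro mult_limit lim limitin_inv[OF top])
    moreover have "1\<^sub>m n * inv\<^bsub>M\<^esub> (1\<^sub>m n) = 1\<^sub>m n" using M_inv(2)[OF one_in_M] .
    moreover have "eventually (\<lambda>a. ?H a * inv\<^bsub>M\<^esub> (?B a) = corner (t a)) F"
      using B K
    proof eventually_elim
      case (elim a)
      have "?H a = corner (t a) * ?B a"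
        by (simp add: heisenberg_mult[OF n])
      then have "?H a \<otimes>\<^bsub>M\<^esub> inv\<^bsub>M\<^esub> (?B a) = corner (t a) \<otimes>\<^bsub>M\<^esub> ?B a \<otimes>\<^bsub>M\<^esub> inv\<^bsub>M\<^esub> (?B a)" by simp
      also have "\<dots> = corner (t a)"
        using elim corner_in_M[of "t a"] by (simp only: M.m_assoc M.r_inv M.inv_closed M.r_one)
      finally show ?case by simp
    qed
    ultimately show "limitin \<sigma> (\<lambda>a. corner (t a)) (1\<^sub>m n) F"
      by (simp add: limitin_transform_eventually)
    show "eventually (\<lambda>a. t a \<in> K) F" by (rule eventually_mono[OF K]) blast
  qed
qed

end

lemma mat_mult_entry:
  fixes A B :: "'a::semiring_0 mat"
  assumes "A \<in> carrier_mat n n" "B \<in> carrier_mat n n" "i < n" "j < n"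
  shows "(A * B) $$ (i, j) = (\<Sum>k = 0..<n. A $$ (i, k) * B $$ (k, j))"
  using assms by (auto simp: scalar_prod_def)

context coarse_triangular_topology
begin

text \<open>Translating by the limit reduces this to nets that tend to the identity.\<close>

lemma heisenberg_limit:
  assumes lim: "limitin \<sigma> (\<lambda>a. heisenberg n (x a) (y a) (t a)) (heisenberg n x0 y0 t0) F"
    and K: "eventually (\<lambda>a. (\<forall>i. 0 < i \<and> i < n - 1 \<longrightarrow> x a i \<in> K \<and> y a i \<in> K) \<and> t a \<in> K) F"
    and K0: "\<And>i. 0 < i \<Longrightarrow> i < n - 1 \<Longrightarrow> x0 i \<in> K \<and> y0 i \<in> K" "t0 \<in> K"
  shows "\<And>i. 0 < i \<Longrightarrow> i < n - 1 \<Longrightarrow> ((\<lambda>a. x a i) \<longlongrightarrow> x0 i) F"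
    "\<And>i. 0 < i \<Longrightarrow> i < n - 1 \<Longrightarrow> ((\<lambda>a. y a i) \<longlongrightarrow> y0 i) F" "(t \<longlongrightarrow> t0) F"
proof -
  define s0 where "s0 = - t0 + (\<Sum>k\<in>{1..<n - 1}. y0 k * x0 k)"
  let ?L = "heisenberg n x0 y0 t0" and ?L' = "heisenberg n (\<lambda>i. - x0 i) (\<lambda>i. - y0 i) s0"
  have L: "?L \<in> carrier M" using K0 by (intro heisenberg_in_M) auto
  have L': "?L' \<in> carrier M"
    unfolding s0_def using K0 by (intro heisenberg_in_M add_K sum_K mult_K uminus_K) auto
  have "?L * ?L' = 1\<^sub>m n"
    unfolding heisenberg_mult[OF n] heisenberg_one[symmetric]
    by (rule heisenberg_cong) (auto simp: s0_def sum_negf)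
  define u where "u a = t a + s0 - (\<Sum>k\<in>{1..<n - 1}. y a k * x0 k)" for a
  have "limitin \<sigma> (\<lambda>a. heisenberg n (x a) (y a) (t a) * ?L') (?L * ?L') F"
    by (intro mult_limit lim limitin_group_const[OF top] L')
  then have lim1: "limitin \<sigma> (\<lambda>a. heisenberg n (\<lambda>i. x a i - x0 i) (\<lambda>i. y a i - y0 i) (u a)) (1\<^sub>m n) F"
    unfolding \<open>?L * ?L' = 1\<^sub>m n\<close> by (simp add: heisenberg_mult[OF n] u_def sum_negf)
  have K1: "eventually (\<lambda>a. (\<forall>i. 0 < i \<and> i < n - 1 \<longrightarrow> x a i - x0 i \<in> K \<and> y a i - y0 i \<in> K) \<and> u a \<in> K) F"
    using K
  proof eventually_elim
    case (elim a)
    have "s0 \<in> K"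
      unfolding s0_def using K0 by (intro add_K sum_K mult_K uminus_K) auto
    then have "u a \<in> K"
      unfolding u_def using K0 elim by (intro diff_K add_K sum_K mult_K) auto
    then show ?case using K0 elim by (auto intro: diff_K)
  qed
  note x = heisenberg_limit_one(1)[OF lim1 K1] and y = heisenberg_limit_one(2)[OF lim1 K1]
    and u = heisenberg_limit_one(3)[OF lim1 K1]
  show "\<And>i. 0 < i \<Longrightarrow> i < n - 1 \<Longrightarrow> ((\<lambda>a. x a i) \<longlongrightarrow> x0 i) F"
    using x by (simp add: LIM_zero_iff)
  show yl: "\<And>i. 0 < i \<Longrightarrow> i < n - 1 \<Longrightarrow> ((\<lambda>a. y a i) \<longlongrightarrow> y0 i) F"
    using y by (simp add: LIM_zero_iff)
  have "((\<lambda>a. u a - s0 + (\<Sum>k\<in>{1..<n - 1}. y a k * x0 k)) \<longlongrightarrow> 0 - s0 + (\<Sum>k\<in>{1..<n - 1}. y0 k * x0 k)) F"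
    by (intro tendsto_intros u yl) auto
  then show "(t \<longlongrightarrow> t0) F"
    by (simp add: u_def s0_def)
qed

text \<open>The Heisenberg group is normal in the triangular group. The conjugate of an elementary matrix with entry
  \<open>(a, b)\<close> has the products of column \<open>a\<close> of \<open>g\<close> and row \<open>b\<close> of its inverse as its entries off the diagonal.\<close>

lemma conj_elementary:
  fixes g h :: "complex mat"
  assumes g: "g \<in> carrier_mat n n" "\<And>i j. i < n \<Longrightarrow> j < i \<Longrightarrow> g $$ (i, j) = 0"
    and h: "h \<in> carrier_mat n n" "\<And>i j. i < n \<Longrightarrow> j < i \<Longrightarrow> h $$ (i, j) = 0"
    and gh: "g * h = 1\<^sub>m n"
    and ab: "a < b" "b < n" "a = 0 \<or> b = n - 1"
  shows "g * heisenberg n (\<lambda>i. if i = a \<and> b = n - 1 then 1 else 0) (\<lambda>j. if a = 0 \<and> j = b then 1 else 0)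
      (if a = 0 \<and> b = n - 1 then 1 else 0) * h =
    heisenberg n (\<lambda>i. g $$ (i, a) * h $$ (b, n - 1)) (\<lambda>j. g $$ (0, a) * h $$ (b, j))
      (g $$ (0, a) * h $$ (b, n - 1))"
    (is "g * ?T * h = ?H")
proof (rule eq_matI)
  fix i j assume "i < dim_row ?H" "j < dim_col ?H"
  then have ij: "i < n" "j < n" by auto
  define E where "E = ?T"
  have T: "E $$ (k, l) = (if k = l then 1 else 0) + (if k = a \<and> l = b then 1 else 0)" if "k < n" "l < n" for k l
    unfolding E_def using that ab by (auto simp: heisenberg_entry)
  have Ec: "E \<in> carrier_mat n n" by (simp add: E_def)
  have gT: "(g * E) $$ (i, k) = g $$ (i, k) + (if k = b then g $$ (i, a) else 0)" if k: "k < n" for k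
  proof -
    have "(g * E) $$ (i, k) = (\<Sum>l = 0..<n. g $$ (i, l) * E $$ (l, k))"
      using g Ec ij k by (auto simp: scalar_prod_def)
    also have "\<dots> = (\<Sum>l = 0..<n. (if l = k then g $$ (i, k) else 0) + (if l = a then (if k = b then g $$ (i, a) else 0) else 0))"
      using k by (intro sum.cong) (auto simp: T)
    also have "\<dots> = g $$ (i, k) + (if k = b then g $$ (i, a) else 0)"
      using k ab by (simp add: sum.distrib)
    finally show ?thesis .
  qed
  have gTc: "g * E \<in> carrier_mat n n" using g Ec by simp
  have "(g * E * h) $$ (i, j) = (\<Sum>k = 0..<n. (g * E) $$ (i, k) * h $$ (k, j))"
    by (rule mat_mult_entry[OF gTc h(1) ij])
  also have "\<dots> = (\<Sum>k = 0..<n. g $$ (i, k) * h $$ (k, j) + (if k = b then g $$ (i, a) * h $$ (b, j) else 0))"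
    using gT by (intro sum.cong) (auto simp: distrib_right)
  also have "\<dots> = (g * h) $$ (i, j) + g $$ (i, a) * h $$ (b, j)"
    using g h ij ab by (simp add: sum.distrib scalar_prod_def)
  finally have e: "(g * E * h) $$ (i, j) = (if i = j then 1 else 0) + g $$ (i, a) * h $$ (b, j)"
    using ij by (simp add: gh del: index_mult_mat(1))
  have z: "g $$ (i, a) * h $$ (b, j) = 0" if "i = j \<or> (0 < i \<and> j \<noteq> n - 1)"
  proof (cases "a < i")
    case True
    then show ?thesis using g(2) ij by simp
  next
    case False
    then have "j < b" using that ab ij by auto
    then show ?thesis using h(2) ab by simp
  qed
  show "(g * ?T * h) $$ (i, j) = ?H $$ (i, j)"
    unfolding E_def[symmetric] e using ij z by (auto simp: heisenberg_entry)
qed (use g h in auto)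

text \<open>The entries of \<open>g x\<close>, divided by the last one, are read off from conjugates of elementary matrices. These
  do not see the upper right corner, because corners are central in the unipotent group; it comes from the
  conjugate of a torus element. The determinant then controls the scalar up to a root of unity.\<close>

lemma conjugation_limit:
  assumes g: "eventually (\<lambda>x. g x \<in> carrier M) F"
    and conj: "\<And>A. A \<in> carrier M \<Longrightarrow> limitin \<sigma> (\<lambda>x. g x * A * inv\<^bsub>M\<^esub> (g x)) A F"
  shows "\<And>i j. i < n \<Longrightarrow> j < n \<Longrightarrow>
      ((\<lambda>x. g x $$ (i, j) / g x $$ (n - 1, n - 1)) \<longlongrightarrow> (if i = j then 1 else 0)) F"
    "((\<lambda>x. g x $$ (n - 1, n - 1) ^ n) \<longlongrightarrow> 1) F"
proof -
  define h where "h x = inv\<^bsub>M\<^esub> (g x)" for x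
  define z where "z x = g x $$ (n - 1, n - 1)" for x
  define G where "G i j x = g x $$ (i, j) / z x" for i j x
  define H where "H i j x = z x * h x $$ (i, j)" for i j x
  have h: "eventually (\<lambda>x. h x \<in> carrier M) F"
    using g by eventually_elim (simp add: h_def)
  have gh: "eventually (\<lambda>x. g x * h x = 1\<^sub>m n) F"
    using g by eventually_elim (simp add: h_def M_inv)
  have upper: "g x $$ (i, j) = 0" "h x $$ (i, j) = 0" if "g x \<in> carrier M" "h x \<in> carrier M" "i < n" "j < i" for x i j
    using that M_carrier(4) by auto
  have gh_entry: "(\<Sum>k = 0..<n. g x $$ (i, k) * h x $$ (k, j)) = (if i = j then 1 else 0)"
    if "g x \<in> carrier M" "h x \<in> carrier M" "g x * h x = 1\<^sub>m n" "i < n" "j < n" for x i j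
  proof -
    have "(\<Sum>k = 0..<n. g x $$ (i, k) * h x $$ (k, j)) = (g x * h x) $$ (i, j)"
      using M_carrier(1)[OF that(1)] M_carrier(1)[OF that(2)] that(4,5) by (auto simp: scalar_prod_def)
    then show ?thesis using that by simp
  qed
  have z1: "eventually (\<lambda>x. z x * h x $$ (n - 1, n - 1) = 1) F"
    using g h gh
  proof eventually_elim
    case (elim x)
    have "(\<Sum>k = 0..<n. g x $$ (n - 1, k) * h x $$ (k, n - 1)) =
        (\<Sum>k = 0..<n. if k = n - 1 then z x * h x $$ (n - 1, n - 1) else 0)"
      using elim upper n by (intro sum.cong) (auto simp: z_def)
    also have "\<dots> = z x * h x $$ (n - 1, n - 1)" using n by simp
    finally show ?case using gh_entry[of x "n - 1" "n - 1"] elim n by simp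
  qed
  then have z0: "eventually (\<lambda>x. z x \<noteq> 0) F" by eventually_elim auto
  have elementary: "\<And>i. 0 < i \<Longrightarrow> i < n - 1 \<Longrightarrow>
        ((\<lambda>x. g x $$ (i, a) * h x $$ (b, n - 1)) \<longlongrightarrow> (if i = a \<and> b = n - 1 then 1 else 0)) F"
      "\<And>j. 0 < j \<Longrightarrow> j < n - 1 \<Longrightarrow>
        ((\<lambda>x. g x $$ (0, a) * h x $$ (b, j)) \<longlongrightarrow> (if a = 0 \<and> j = b then 1 else 0)) F"
      "((\<lambda>x. g x $$ (0, a) * h x $$ (b, n - 1)) \<longlongrightarrow> (if a = 0 \<and> b = n - 1 then 1 else 0)) F"
    if ab: "a < b" "b < n" "a = 0 \<or> b = n - 1" for a b
  proof -
    let ?T = "heisenberg n (\<lambda>i. if i = a \<and> b = n - 1 then 1 else 0) (\<lambda>j. if a = 0 \<and> j = b then 1 else 0)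
      (if a = 0 \<and> b = n - 1 then 1 else 0 :: complex)"
    have T: "?T \<in> carrier M" by (rule heisenberg_in_M) (auto simp: field_K)
    have "eventually (\<lambda>x. g x * ?T * inv\<^bsub>M\<^esub> (g x) =
        heisenberg n (\<lambda>i. g x $$ (i, a) * h x $$ (b, n - 1)) (\<lambda>j. g x $$ (0, a) * h x $$ (b, j))
          (g x $$ (0, a) * h x $$ (b, n - 1))) F"
      using g h gh
    proof eventually_elim
      case (elim x)
      show ?case
        unfolding h_def[symmetric] using elim upper
        by (intro conj_elementary ab M_carrier(1)) auto
    qed
    then have lim: "limitin \<sigma> (\<lambda>x. heisenberg n (\<lambda>i. g x $$ (i, a) * h x $$ (b, n - 1))
        (\<lambda>j. g x $$ (0, a) * h x $$ (b, j)) (g x $$ (0, a) * h x $$ (b, n - 1))) ?T F"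
      using conj[OF T] by (rule limitin_transform_eventually)
    have K: "eventually (\<lambda>x. (\<forall>i. 0 < i \<and> i < n - 1 \<longrightarrow> g x $$ (i, a) * h x $$ (b, n - 1) \<in> K \<and>
        g x $$ (0, a) * h x $$ (b, i) \<in> K) \<and> g x $$ (0, a) * h x $$ (b, n - 1) \<in> K) F"
      using g h by eventually_elim (use ab n in \<open>auto intro!: mult_K M_carrier(2)\<close>)
    note l = heisenberg_limit[OF lim K]
    show "\<And>i. 0 < i \<Longrightarrow> i < n - 1 \<Longrightarrow>
        ((\<lambda>x. g x $$ (i, a) * h x $$ (b, n - 1)) \<longlongrightarrow> (if i = a \<and> b = n - 1 then 1 else 0)) F"
      by (rule l(1)) (auto simp: field_K)
    show "\<And>j. 0 < j \<Longrightarrow> j < n - 1 \<Longrightarrow>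
        ((\<lambda>x. g x $$ (0, a) * h x $$ (b, j)) \<longlongrightarrow> (if a = 0 \<and> j = b then 1 else 0)) F"
      by (rule l(2)) (auto simp: field_K)
    show "((\<lambda>x. g x $$ (0, a) * h x $$ (b, n - 1)) \<longlongrightarrow> (if a = 0 \<and> b = n - 1 then 1 else 0)) F"
      by (rule l(3)) (auto simp: field_K)
  qed
  have zero_lim: "((\<lambda>x. f x) \<longlongrightarrow> 0) F" if "eventually (\<lambda>x. f x = 0) F" for f :: "_ \<Rightarrow> complex"
    using that by (rule tendsto_eventually)
  have G_left: "(G i a \<longlongrightarrow> (if i = a then 1 else 0)) F" if ia: "i < n" "a < n - 1" for i a
  proof (cases "i = n - 1")
    case True
    have "eventually (\<lambda>x. G i a x = 0) F"
      using g h by eventually_elim (use ia True in \<open>simp add: G_def upper(1)\<close>)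
    then show ?thesis using ia True by (simp add: tendsto_eventually)
  next
    case False
    have "((\<lambda>x. g x $$ (i, a) * h x $$ (n - 1, n - 1)) \<longlongrightarrow> (if i = a then 1 else 0)) F"
      using elementary(1)[of a "n - 1" i] elementary(3)[of a "n - 1"] ia False by (cases "i = 0") auto
    moreover have "eventually (\<lambda>x. g x $$ (i, a) * h x $$ (n - 1, n - 1) = G i a x) F"
      using z1
    proof eventually_elim
      case (elim x)
      then have "z x \<noteq> 0" by auto
      with elim have "h x $$ (n - 1, n - 1) = 1 / z x" by (simp add: eq_divide_eq mult.commute)
      then show ?case by (simp add: G_def)
    qed
    ultimately show ?thesis by (rule Lim_transform_eventually)
  qed
  have H_lower: "(H b j \<longlongrightarrow> (if b = j then 1 else 0)) F" if bj: "0 < b" "b < n" "j < n" for b j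
  proof -
    have l: "((\<lambda>x. g x $$ (0, 0) * h x $$ (b, j)) \<longlongrightarrow> (if b = j then 1 else 0)) F"
    proof (cases "j = 0")
      case True
      have "eventually (\<lambda>x. g x $$ (0, 0) * h x $$ (b, j) = 0) F"
        using g h by eventually_elim (simp add: upper(2) bj True)
      then show ?thesis using bj True by (simp add: tendsto_eventually)
    next
      case False
      have "(b = j) = (j = b)" by blast
      then show ?thesis
        using elementary(2)[of 0 b j] elementary(3)[of 0 b] bj False
        by (cases "j = n - 1") (simp_all del: eq_commute)
    qed
    have G00: "(G 0 0 \<longlongrightarrow> 1) F" using G_left[of 0 0] n by simp
    have "((\<lambda>x. g x $$ (0, 0) * h x $$ (b, j) / G 0 0 x) \<longlongrightarrow> (if b = j then 1 else 0) / 1) F"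
      by (rule tendsto_divide[OF l G00]) simp
    moreover have "eventually (\<lambda>x. G 0 0 x \<noteq> 0) F"
      using G00 by (rule tendsto_imp_eventually_ne) simp
    then have "eventually (\<lambda>x. g x $$ (0, 0) * h x $$ (b, j) / G 0 0 x = H b j x) F"
      using z0 by eventually_elim (auto simp: G_def H_def)
    ultimately show ?thesis by (simp add: Lim_transform_eventually)
  qed
  have GH: "eventually (\<lambda>x. (\<Sum>k = 0..<n. G i k x * H k j x) = (if i = j then 1 else 0)) F"
    if "i < n" "j < n" for i j
    using g h gh z0
  proof eventually_elim
    case (elim x)
    have "(\<Sum>k = 0..<n. G i k x * H k j x) = (\<Sum>k = 0..<n. g x $$ (i, k) * h x $$ (k, j))"
      using elim(4) by (intro sum.cong) (auto simp: G_def H_def)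
    then show ?case using gh_entry[of x i j] elim that by simp
  qed
  have Hnn: "eventually (\<lambda>x. H (n - 1) (n - 1) x = 1) F"
    using z1 by (simp add: H_def)
  have G_i0: "eventually (\<lambda>x. G i 0 x = 0) F" if "0 < i" "i < n" for i
    using g h by eventually_elim (use that in \<open>simp add: G_def upper(1)\<close>)
  have split: "sum f {0..<n} = f 0 + sum f {1..<n - 1} + f (n - 1)" for f :: "nat \<Rightarrow> complex"
  proof -
    have "{0..<n} = insert 0 (insert (n - 1) {1..<n - 1})" using n by auto
    then show ?thesis using n by (simp add: add.commute add.left_commute)
  qed
  have mid: "((\<lambda>x. \<Sum>s\<in>{1..<n - 1}. c s * (G i s x * H s (n - 1) x)) \<longlongrightarrow> 0) F" if i: "i < n" for c i
  proof -
    have "((\<lambda>x. \<Sum>s\<in>{1..<n - 1}. c s * (G i s x * H s (n - 1) x)) \<longlongrightarrow>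
        (\<Sum>s\<in>{1..<n - 1}. c s * ((if i = s then 1 else 0) * (if s = n - 1 then 1 else 0)))) F"
      using i by (intro tendsto_intros G_left H_lower) auto
    moreover have "(\<Sum>s\<in>{1..<n - 1}. c s * ((if i = s then 1 else 0) * (if s = n - 1 then 1 else 0))) = 0"
      by (intro sum.neutral) auto
    ultimately show ?thesis by simp
  qed
  have G_last: "(G i (n - 1) \<longlongrightarrow> (if i = n - 1 then 1 else 0)) F" if i: "0 < i" "i < n" for i
  proof (cases "i = n - 1")
    case True
    have "eventually (\<lambda>x. G i (n - 1) x = 1) F"
      using z0 by eventually_elim (simp add: True G_def z_def)
    then show ?thesis using True by (simp add: tendsto_eventually)
  next
    case False
    have "((\<lambda>x. - (\<Sum>s\<in>{1..<n - 1}. 1 * (G i s x * H s (n - 1) x))) \<longlongrightarrow> - 0) F"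
      by (intro tendsto_minus mid i)
    moreover have "eventually (\<lambda>x. - (\<Sum>s\<in>{1..<n - 1}. 1 * (G i s x * H s (n - 1) x)) = G i (n - 1) x) F"
    proof -
      have "eventually (\<lambda>x. (\<Sum>k = 0..<n. G i k x * H k (n - 1) x) = 0) F"
        using GH[of i "n - 1"] n i False by simp
      then show ?thesis
        using G_i0[OF i] Hnn
        by eventually_elim (simp add: split add_eq_0_iff)
    qed
    ultimately show ?thesis using False by (simp add: Lim_transform_eventually)
  qed
  \<comment> \<open>The commutator with a torus element; its terms involving the first row of \<open>h\<close> cancel.\<close>
  define d where "d = corner_torus n (2 :: complex)"
  define d' where "d' = corner_torus n (inverse 2 :: complex)"
  have d: "d \<in> carrier M" and d': "d' \<in> carrier M"
    unfolding d_def d'_def by (intro torus_in_M inverse_K numeral_K; simp)+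
  define te where "te i = torus_entry n (2 :: complex) i" for i
  define te' where "te' i = torus_entry n (inverse 2 :: complex) i" for i
  have te: "te i * te' i = 1" for i by (simp add: te_def te'_def)
  have dd': "d * d' = 1\<^sub>m n"
  proof (rule eq_matI)
    fix i j assume "i < dim_row (1\<^sub>m n :: complex mat)" "j < dim_col (1\<^sub>m n :: complex mat)"
    then have ij: "i < n" "j < n" by auto
    then have "(d * d') $$ (i, j) = te i * d' $$ (i, j)"
      unfolding d_def te_def by (intro corner_torus_mult_left) (auto simp: d'_def)
    moreover have "d' $$ (i, j) = (if i = j then te' i else 0)"
      using ij by (simp add: d'_def te'_def corner_torus_def)
    ultimately show "(d * d') $$ (i, j) = 1\<^sub>m n $$ (i, j)"
      using ij te[of i] by (cases "i = j") (simp_all del: index_mult_mat(1))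
  qed (auto simp: d_def d'_def)
  define C where "C x = d * (g x * d' * h x)" for x
  have "limitin \<sigma> C (d * d') F"
    unfolding C_def h_def by (intro mult_limit limitin_group_const[OF top] d conj d')
  then have C_lim: "limitin \<sigma> C (1\<^sub>m n) F" by (simp add: dd')
  have C_M: "eventually (\<lambda>x. C x \<in> carrier M) F"
    using g h
  proof eventually_elim
    case (elim x)
    have "d \<otimes>\<^bsub>M\<^esub> (g x \<otimes>\<^bsub>M\<^esub> d' \<otimes>\<^bsub>M\<^esub> h x) \<in> carrier M"
      using elim d d' by (intro M.m_closed)
    then show ?case by (simp add: C_def)
  qed
  define \<kappa> where "\<kappa> i s = te i * te' s - 1" for i s
  have C_entry: "eventually (\<lambda>x. C x $$ (i, j) = (if i = j then 1 else 0) +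
      (\<Sum>s\<in>{1..<n - 1}. \<kappa> i s * (G i s x * H s j x)) + \<kappa> i (n - 1) * (G i (n - 1) x * H (n - 1) j x)) F"
    if ij: "i < n" "j < n" for i j
  proof -
    have "eventually (\<lambda>x. \<kappa> i 0 * (G i 0 x * H 0 j x) = 0) F"
    proof (cases "i = 0")
      case True
      then show ?thesis using te[of 0] by (simp add: \<kappa>_def)
    next
      case False
      then have "eventually (\<lambda>x. G i 0 x = 0) F" using G_i0[of i] ij by simp
      then show ?thesis by eventually_elim simp
    qed
    then show ?thesis
      using g h z0 GH[OF ij]
    proof eventually_elim
      case (elim x)
      note gc = M_carrier(1)[OF elim(2)] and hc = M_carrier(1)[OF elim(3)]
      have dc: "d \<in> carrier_mat n n" "d' \<in> carrier_mat n n" by (auto simp: d_def d'_def)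
      have "C x $$ (i, j) = te i * (g x * d' * h x) $$ (i, j)"
        unfolding C_def d_def te_def using gc hc dc ij by (intro corner_torus_mult_left) auto
      also have "(g x * d' * h x) $$ (i, j) = (\<Sum>s = 0..<n. (g x * d') $$ (i, s) * h x $$ (s, j))"
        using gc hc dc ij by (intro mat_mult_entry) auto
      also have "\<dots> = (\<Sum>s = 0..<n. te' s * (G i s x * H s j x))"
      proof (intro sum.cong refl)
        fix s assume "s \<in> {0..<n}"
        then have "(g x * d') $$ (i, s) = g x $$ (i, s) * te' s"
          unfolding d'_def te'_def using gc ij by (intro corner_torus_mult_right) auto
        then show "(g x * d') $$ (i, s) * h x $$ (s, j) = te' s * (G i s x * H s j x)"
          using elim(4) by (simp add: G_def H_def)
      qed
      also have "te i * \<dots> = (\<Sum>s = 0..<n. \<kappa> i s * (G i s x * H s j x)) + (\<Sum>s = 0..<n. G i s x * H s j x)"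
        by (simp add: sum_distrib_left sum.distrib[symmetric] \<kappa>_def algebra_simps)
      also have "(\<Sum>s = 0..<n. \<kappa> i s * (G i s x * H s j x)) =
          (\<Sum>s\<in>{1..<n - 1}. \<kappa> i s * (G i s x * H s j x)) + \<kappa> i (n - 1) * (G i (n - 1) x * H (n - 1) j x)"
        using elim(1) by (simp add: split)
      finally show ?case using elim(5) by simp
    qed
  qed
  have C_noncorner: "((\<lambda>x. C x $$ (i, j)) \<longlongrightarrow> (if i = j then 1 else 0)) F"
    if ij: "i < n" "j < n" "\<not> (i = 0 \<and> j = n - 1)" for i j
  proof -
    have "((\<lambda>x. \<Sum>s\<in>{1..<n - 1}. \<kappa> i s * (G i s x * H s j x)) \<longlongrightarrow>
        (\<Sum>s\<in>{1..<n - 1}. \<kappa> i s * ((if i = s then 1 else 0) * (if s = j then 1 else 0)))) F"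
      using ij by (intro tendsto_intros G_left H_lower) auto
    moreover have "(\<Sum>s\<in>{1..<n - 1}. \<kappa> i s * ((if i = s then 1 else 0) * (if s = j then 1 else 0))) = 0"
      using te by (intro sum.neutral) (auto simp: \<kappa>_def)
    ultimately have 1: "((\<lambda>x. \<Sum>s\<in>{1..<n - 1}. \<kappa> i s * (G i s x * H s j x)) \<longlongrightarrow> 0) F" by simp
    have 2: "((\<lambda>x. \<kappa> i (n - 1) * (G i (n - 1) x * H (n - 1) j x)) \<longlongrightarrow> 0) F"
    proof (cases "i = 0")
      case True
      have "eventually (\<lambda>x. \<kappa> i (n - 1) * (G i (n - 1) x * H (n - 1) j x) = 0) F"
        using g h by eventually_elim (use True ij n in \<open>simp add: H_def upper(2)\<close>)
      then show ?thesis by (rule tendsto_eventually)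
    next
      case False
      have "((\<lambda>x. \<kappa> i (n - 1) * (G i (n - 1) x * H (n - 1) j x)) \<longlongrightarrow>
          \<kappa> i (n - 1) * ((if i = n - 1 then 1 else 0) * (if n - 1 = j then 1 else 0))) F"
        using ij n False by (intro tendsto_intros G_last H_lower) auto
      moreover have "\<kappa> i (n - 1) * ((if i = n - 1 then 1 else 0) * (if n - 1 = j then 1 else 0)) = 0"
        using te[of "n - 1"] by (auto simp: \<kappa>_def)
      ultimately show ?thesis by (simp only:)
    qed
    have "((\<lambda>x. (if i = j then 1 else 0) + (\<Sum>s\<in>{1..<n - 1}. \<kappa> i s * (G i s x * H s j x)) +
        \<kappa> i (n - 1) * (G i (n - 1) x * H (n - 1) j x)) \<longlongrightarrow> (if i = j then 1 else 0) + 0 + 0) F"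
      by (intro tendsto_add tendsto_const 1 2)
    moreover have "eventually (\<lambda>x. (if i = j then 1 else 0) + (\<Sum>s\<in>{1..<n - 1}. \<kappa> i s * (G i s x * H s j x)) +
        \<kappa> i (n - 1) * (G i (n - 1) x * H (n - 1) j x) = C x $$ (i, j)) F"
      using C_entry[OF ij(1,2)] by eventually_elim simp
    ultimately show ?thesis by (simp add: Lim_transform_eventually)
  qed
  define c where "c x = C x $$ (0, n - 1)" for x
  define D where "D x = corner (- c x) * C x" for x
  have c_K: "eventually (\<lambda>x. c x \<in> K) F"
    using C_M by eventually_elim (use n in \<open>auto simp: c_def intro!: M_carrier(2)\<close>)
  have D_M: "eventually (\<lambda>x. D x \<in> carrier M) F"
    using C_M c_K
  proof eventually_elim
    case (elim x)
    have "corner (- c x) \<otimes>\<^bsub>M\<^esub> C x \<in> carrier M"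
      using elim by (intro M.m_closed corner_in_M uminus_K)
    then show ?case by (simp add: D_def)
  qed
  have Cnn: "eventually (\<lambda>x. C x $$ (n - 1, n - 1) = 1) F"
  proof -
    have \<kappa>0: "\<kappa> (n - 1) (n - 1) = 0" using te[of "n - 1"] by (simp add: \<kappa>_def)
    have "eventually (\<lambda>x. (\<Sum>s\<in>{1..<n - 1}. \<kappa> (n - 1) s * (G (n - 1) s x * H s (n - 1) x)) = 0) F"
      using g h
    proof eventually_elim
      case (elim x)
      show ?case by (intro sum.neutral) (use elim n in \<open>simp add: G_def upper(1)\<close>)
    qed
    moreover have "eventually (\<lambda>x. C x $$ (n - 1, n - 1) = (if n - 1 = n - 1 then 1 else 0) +
        (\<Sum>s\<in>{1..<n - 1}. \<kappa> (n - 1) s * (G (n - 1) s x * H s (n - 1) x)) +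
        \<kappa> (n - 1) (n - 1) * (G (n - 1) (n - 1) x * H (n - 1) (n - 1) x)) F"
      using n by (intro C_entry) auto
    ultimately show ?thesis
      by eventually_elim (simp only: \<kappa>0 mult_zero_left add_0_right if_True refl)
  qed
  have D_entry: "eventually (\<lambda>x. D x $$ (i, j) = (if i = 0 \<and> j = n - 1 then 0 else C x $$ (i, j))) F"
    if ij: "i < n" "j < n" for i j
    using C_M Cnn
  proof eventually_elim
    case (elim x)
    note Cc = M_carrier(1)[OF elim(1)]
    have "D x $$ (i, j) = (\<Sum>k = 0..<n. corner (- c x) $$ (i, k) * C x $$ (k, j))"
      unfolding D_def using Cc ij by (auto simp: scalar_prod_def)
    also have "\<dots> = (\<Sum>k = 0..<n. (if k = i then C x $$ (i, j) else 0) +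
        (if k = n - 1 then (if i = 0 then - c x * C x $$ (n - 1, j) else 0) else 0))"
      using ij n by (intro sum.cong) (auto simp: heisenberg_entry)
    also have "\<dots> = C x $$ (i, j) + (if i = 0 then - c x * C x $$ (n - 1, j) else 0)"
      using ij n by (simp add: sum.distrib)
    finally show ?case
      using elim M_carrier(4)[OF elim(1), of "n - 1" j] ij n by (auto simp: c_def)
  qed
  have "limitin \<sigma> D (1\<^sub>m n) F"
  proof (rule limit_of_entries[OF one_in_M D_M])
    fix i j assume ij: "i < n" "j < n"
    have "((\<lambda>x. if i = 0 \<and> j = n - 1 then 0 else C x $$ (i, j)) \<longlongrightarrow> 1\<^sub>m n $$ (i, j)) F"
      using C_noncorner[OF ij] ij n by (cases "i = 0 \<and> j = n - 1") auto
    moreover have "eventually (\<lambda>x. (if i = 0 \<and> j = n - 1 then 0 else C x $$ (i, j)) = D x $$ (i, j)) F"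
      using D_entry[OF ij] by eventually_elim simp
    ultimately show "((\<lambda>x. D x $$ (i, j)) \<longlongrightarrow> 1\<^sub>m n $$ (i, j)) F"
      by (rule Lim_transform_eventually)
  qed
  then have "limitin \<sigma> (\<lambda>x. C x * inv\<^bsub>M\<^esub> (D x)) (1\<^sub>m n * inv\<^bsub>M\<^esub> (1\<^sub>m n)) F"
    by (intro mult_limit limitin_inv[OF top] C_lim)
  then have "limitin \<sigma> (\<lambda>x. C x * inv\<^bsub>M\<^esub> (D x)) (1\<^sub>m n) F"
    using M_inv(2)[OF one_in_M] by simp
  moreover have "eventually (\<lambda>x. C x * inv\<^bsub>M\<^esub> (D x) = corner (c x)) F"
    using C_M c_K D_M
  proof eventually_elim
    case (elim x)
    have "corner (c x) * corner (- c x) = 1\<^sub>m n" by (simp add: corner_mult heisenberg_one)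
    then have "corner (c x) \<otimes>\<^bsub>M\<^esub> corner (- c x) = \<one>\<^bsub>M\<^esub>" by simp
    moreover have "D x = corner (- c x) \<otimes>\<^bsub>M\<^esub> C x" by (simp add: D_def)
    ultimately have "corner (c x) \<otimes>\<^bsub>M\<^esub> D x = C x"
      using elim corner_in_M uminus_K by (simp only: M.m_assoc[symmetric] M.l_one)
    then have "C x \<otimes>\<^bsub>M\<^esub> inv\<^bsub>M\<^esub> (D x) = corner (c x) \<otimes>\<^bsub>M\<^esub> D x \<otimes>\<^bsub>M\<^esub> inv\<^bsub>M\<^esub> (D x)" by simp
    also have "\<dots> = corner (c x)"
      using elim corner_in_M by (simp only: M.m_assoc M.r_inv M.inv_closed M.r_one)
    finally show ?case by simp
  qed
  ultimately have "limitin \<sigma> (\<lambda>x. corner (c x)) (1\<^sub>m n) F"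
    by (simp add: limitin_transform_eventually)
  then have c0: "(c \<longlongrightarrow> 0) F" using c_K by (rule corner_limit)
  have \<kappa>3: "\<kappa> 0 (n - 1) = 3" using n by (simp add: \<kappa>_def te_def te'_def)
  have G_corner: "(G 0 (n - 1) \<longlongrightarrow> 0) F"
  proof -
    have "((\<lambda>x. (c x - (\<Sum>s\<in>{1..<n - 1}. \<kappa> 0 s * (G 0 s x * H s (n - 1) x))) / 3) \<longlongrightarrow> (0 - 0) / 3) F"
      using n by (intro tendsto_intros c0 mid) auto
    moreover have "eventually (\<lambda>x. (c x - (\<Sum>s\<in>{1..<n - 1}. \<kappa> 0 s * (G 0 s x * H s (n - 1) x))) / 3 = G 0 (n - 1) x) F"
    proof -
      have "eventually (\<lambda>x. c x = (\<Sum>s\<in>{1..<n - 1}. \<kappa> 0 s * (G 0 s x * H s (n - 1) x)) +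
          3 * (G 0 (n - 1) x * H (n - 1) (n - 1) x)) F"
        using C_entry[of 0 "n - 1"] n by (simp add: c_def \<kappa>3[simplified])
      then show ?thesis using Hnn by eventually_elim simp
    qed
    ultimately show ?thesis by (simp add: Lim_transform_eventually)
  qed
  have G_lim: "(G i j \<longlongrightarrow> (if i = j then 1 else 0)) F" if "i < n" "j < n" for i j
    using G_left[of i j] G_last[of i] G_corner that n by (cases "j = n - 1"; cases "i = 0") auto
  then show "\<And>i j. i < n \<Longrightarrow> j < n \<Longrightarrow>
      ((\<lambda>x. g x $$ (i, j) / g x $$ (n - 1, n - 1)) \<longlongrightarrow> (if i = j then 1 else 0)) F"
    by (simp add: G_def[abs_def] z_def)
  have "((\<lambda>x. det (mat n n (\<lambda>(i, j). G i j x))) \<longlongrightarrow> det (1\<^sub>m n)) F"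
    by (rule tendsto_det[of n]) (use G_lim in auto)
  then have "((\<lambda>x. 1 / det (mat n n (\<lambda>(i, j). G i j x))) \<longlongrightarrow> 1 / 1) F"
    by (intro tendsto_divide tendsto_const) auto
  moreover have "eventually (\<lambda>x. 1 / det (mat n n (\<lambda>(i, j). G i j x)) = z x ^ n) F"
    using g z0
  proof eventually_elim
    case (elim x)
    have "g x = z x \<cdot>\<^sub>m mat n n (\<lambda>(i, j). G i j x)"
      using M_carrier(1)[OF elim(1)] elim(2) by (intro eq_matI) (auto simp: G_def)
    then have "1 = z x ^ n * det (mat n n (\<lambda>(i, j). G i j x))"
      using M_carrier(3)[OF elim(1)] det_smult[of "z x" "mat n n (\<lambda>(i, j). G i j x)"] by simp
    then show ?case by (metis divide_eq_eq mult_zero_right one_neq_zero)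
  qed
  ultimately show "((\<lambda>x. g x $$ (n - 1, n - 1) ^ n) \<longlongrightarrow> 1) F"
    unfolding z_def by (simp add: Lim_transform_eventually)
qed

end

section \<open>Finite products of triangular groups\<close>

lemma topological_group_pullback_hom:
  assumes G: "group G" and H: "topological_group H Y" and f: "f \<in> hom G H" "inj_on f (carrier G)"
  shows "topological_group G (pullback_topology (carrier G) f Y)"
proof -
  have grH: "group H" by (rule topological_groupD(1)[OF H])
  interpret f: group_hom G H f
    using G grH f by (simp add: group_hom_def group_hom_axioms_def)
  let ?S = "f ` carrier G"
  have "subgroup ?S H" by (rule f.img_is_subgroup)
  then have "topological_group (H\<lparr>carrier := ?S\<rparr>) (subtopology Y ?S)"
    by (rule topological_group_subgroup[OF H])
  moreover have "f \<in> iso G (H\<lparr>carrier := ?S\<rparr>)"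
    using f by (auto simp: iso_def hom_def bij_betw_def)
  ultimately have "topological_group G (pullback_topology (carrier G) f (subtopology Y ?S))"
    using G topological_group_pullback by blast
  moreover have "pullback_topology (carrier G) f (subtopology Y ?S) = pullback_topology (carrier G) f Y"
  proof -
    have "f -` (V \<inter> ?S) \<inter> carrier G = f -` V \<inter> carrier G" for V by blast
    then show ?thesis
      unfolding topology_eq openin_pullback_topology openin_subtopology by (metis (no_types, lifting))
  qed
  ultimately show ?thesis by simp
qed

locale coarse_product_topology = complex_subfield +
  fixes I :: "'i set" and n k :: "'i \<Rightarrow> nat" and \<tau> :: "('i \<Rightarrow> complex mat) topology"
  assumes finite_I: "finite I"
    and n: "\<And>i. i \<in> I \<Longrightarrow> n i = 2 ^ k i" and k: "\<And>i. i \<in> I \<Longrightarrow> 1 \<le> k i"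
    and top: "topological_group (product_group I (\<lambda>i. special_triangular_group (n i) K)) \<tau>"
    and coarser: "\<And>U. openin \<tau> U \<Longrightarrow> openin (product_topology (\<lambda>i. special_triangular_topology (n i) K) I) U"
begin

abbreviation "M i \<equiv> special_triangular_group (n i) K"
abbreviation "P \<equiv> product_group I M"
abbreviation "T \<equiv> product_topology (\<lambda>i. special_triangular_topology (n i) K) I"

lemma group_M: "group (M i)"
  by (rule topological_groupD(1)[OF topological_group_special_triangular])

lemma group_P: "group P"
  by (rule topological_groupD(1)[OF top])

lemma topological_group_T: "topological_group P T"
  by (rule topological_group_product) (rule topological_group_special_triangular)

lemma n_ge: "i \<in> I \<Longrightarrow> 2 \<le> n i"
  using n[of i] power_increasing[of 1 "k i" "2 :: nat"] k[of i] by simp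

lemma limit_of_components:
  assumes "l \<in> carrier P" "eventually (\<lambda>x. f x \<in> carrier P) F"
    and "\<And>i a b. i \<in> I \<Longrightarrow> a < n i \<Longrightarrow> b < n i \<Longrightarrow> ((\<lambda>x. f x i $$ (a, b)) \<longlongrightarrow> l i $$ (a, b)) F"
  shows "limitin T f l F"
  unfolding limitin_componentwise
proof (intro conjI ballI)
  show "l \<in> extensional I" using assms(1) by (auto simp: PiE_iff)
  show "eventually (\<lambda>x. f x \<in> topspace T) F"
    using assms(2) topological_groupD(2)[OF topological_group_T] by simp
  fix i assume i: "i \<in> I"
  have "eventually (\<lambda>x. f x i \<in> carrier (M i)) F"
    using assms(2) by eventually_elim (use i in auto)
  then show "limitin (special_triangular_topology (n i) K) (\<lambda>x. f x i) (l i) F"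
    using assms(1,3) i unfolding limitin_special_triangular by auto
qed

lemma limit_coarser:
  assumes "limitin T f l F"
  shows "limitin \<tau> f l F"
proof (rule limitin_coarser[OF coarser _ assms])
  show "l \<in> topspace \<tau>"
    using limitin_topspace[OF assms] topological_groupD(2)[OF topological_group_T] topological_groupD(2)[OF top]
    by simp
qed

definition embed :: "'i \<Rightarrow> complex mat \<Rightarrow> 'i \<Rightarrow> complex mat" where
  "embed i A = (\<lambda>j\<in>I. if j = i then A else 1\<^sub>m (n j))"

lemma one_M: "1\<^sub>m (n i) \<in> carrier (M i)"
  using monoid.one_closed[OF group.is_monoid[OF group_M[of i]]] by simp

lemma embed_in_P: "A \<in> carrier (M i) \<Longrightarrow> embed i A \<in> carrier P"
  by (auto simp: embed_def one_M)

lemma conj_embed: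
  assumes i: "i \<in> I" and g: "g \<in> carrier P" and A: "A \<in> carrier (M i)"
  shows "g \<otimes>\<^bsub>P\<^esub> embed i A \<otimes>\<^bsub>P\<^esub> inv\<^bsub>P\<^esub> g = embed i (g i * A * inv\<^bsub>M i\<^esub> (g i))"
proof
  fix j
  have "inv\<^bsub>P\<^esub> g = (\<lambda>j\<in>I. inv\<^bsub>M j\<^esub> (g j))"
    using g group_M by (intro inv_product_group) auto
  moreover have "g j * 1\<^sub>m (n j) * inv\<^bsub>M j\<^esub> (g j) = 1\<^sub>m (n j)" if "j \<in> I" for j
  proof -
    have gj: "g j \<in> carrier (M j)" using g that by auto
    have "g j \<otimes>\<^bsub>M j\<^esub> \<one>\<^bsub>M j\<^esub> \<otimes>\<^bsub>M j\<^esub> inv\<^bsub>M j\<^esub> (g j) = \<one>\<^bsub>M j\<^esub>"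
      using monoid.r_one[OF group.is_monoid[OF group_M] gj] group.r_inv[OF group_M gj] by simp
    then show ?thesis by simp
  qed
  ultimately show "(g \<otimes>\<^bsub>P\<^esub> embed i A \<otimes>\<^bsub>P\<^esub> inv\<^bsub>P\<^esub> g) j = embed i (g i * A * inv\<^bsub>M i\<^esub> (g i)) j"
    by (auto simp: embed_def)
qed

lemma factor_topology:
  assumes i: "i \<in> I"
  shows "coarse_triangular_topology K (n i) (pullback_topology (carrier (M i)) (embed i) \<tau>)"
proof unfold_locales
  show "2 \<le> n i" by (rule n_ge[OF i])
  have "embed i \<in> hom (M i) P"
  proof (rule homI)
    fix A B assume "A \<in> carrier (M i)" "B \<in> carrier (M i)"
    then show "embed i (A \<otimes>\<^bsub>M i\<^esub> B) = embed i A \<otimes>\<^bsub>P\<^esub> embed i B"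
      by (auto simp: embed_def fun_eq_iff)
  qed (rule embed_in_P)
  moreover have "inj_on (embed i) (carrier (M i))"
    using i by (auto simp: inj_on_def embed_def fun_eq_iff split: if_splits)
  ultimately show "topological_group (M i) (pullback_topology (carrier (M i)) (embed i) \<tau>)"
    by (rule topological_group_pullback_hom[OF group_M top])
  fix U assume "openin (pullback_topology (carrier (M i)) (embed i) \<tau>) U"
  then obtain V where V: "openin \<tau> V" "U = embed i -` V \<inter> carrier (M i)"
    by (auto simp: openin_pullback_topology)
  note tM = topological_groupD(2)[OF topological_group_special_triangular]
  have "continuous_map (special_triangular_topology (n i) K) T (embed i)"
    unfolding continuous_map_atin
  proof
    fix A assume A: "A \<in> topspace (special_triangular_topology (n i) K)"
    have l: "limitin (special_triangular_topology (n i) K) (\<lambda>x. x) A (atin (special_triangular_topology (n i) K) A)"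
      by (rule limitin_atin_ident[OF A])
    show "limitin T (embed i) (embed i A) (atin (special_triangular_topology (n i) K) A)"
    proof (rule limit_of_components)
      show "embed i A \<in> carrier P" using A tM embed_in_P by simp
      show "eventually (\<lambda>x. embed i x \<in> carrier P) (atin (special_triangular_topology (n i) K) A)"
        using limitin_eventually_carrier(1)[OF topological_group_special_triangular l]
        by eventually_elim (rule embed_in_P)
      fix j a b assume "j \<in> I" "a < n j" "b < n j"
      then show "((\<lambda>x. embed i x j $$ (a, b)) \<longlongrightarrow> embed i A j $$ (a, b)) (atin (special_triangular_topology (n i) K) A)"
        using l unfolding limitin_special_triangular by (auto simp: embed_def)
    qed
  qed
  from openin_continuous_map_preimage[OF this coarser[OF V(1)]]
  have "openin (special_triangular_topology (n i) K) {A \<in> carrier (M i). embed i A \<in> V}"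
    unfolding tM .
  moreover have "{A \<in> carrier (M i). embed i A \<in> V} = U" using V(2) by auto
  ultimately show "openin (special_triangular_topology (n i) K) U" by simp
qed

abbreviation "last_entry g i \<equiv> g i $$ (n i - 1, n i - 1)"

text \<open>The projections of the product need not be continuous for \<open>\<tau>\<close>. But an element of the product acts on an
  embedded factor by conjugation with its component there, so the components of a net that tends to the identity
  satisfy the hypothesis on inner automorphisms for the topology that the factor inherits from \<open>\<tau>\<close>.\<close>

lemma limit_up_to_scalars:
  assumes lim: "limitin \<tau> g \<one>\<^bsub>P\<^esub> F" and i: "i \<in> I"
  shows "\<And>a b. a < n i \<Longrightarrow> b < n i \<Longrightarrow> ((\<lambda>x. g x i $$ (a, b) / last_entry (g x) i) \<longlongrightarrow> (if a = b then 1 else 0)) F"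
    "((\<lambda>x. last_entry (g x) i ^ n i) \<longlongrightarrow> 1) F"
proof -
  interpret c: coarse_triangular_topology K "n i" "pullback_topology (carrier (M i)) (embed i) \<tau>"
    by (rule factor_topology[OF i])
  interpret P: group P by (rule group_P)
  have gP: "eventually (\<lambda>x. g x \<in> carrier P) F"
    by (rule limitin_eventually_carrier(1)[OF top lim])
  then have g: "eventually (\<lambda>x. g x i \<in> carrier (M i)) F"
    by eventually_elim (use i in auto)
  have conj: "limitin (pullback_topology (carrier (M i)) (embed i) \<tau>) (\<lambda>x. g x i * A * inv\<^bsub>M i\<^esub> (g x i)) A F"
    if A: "A \<in> carrier (M i)" for A
    unfolding limitin_pullback_topology
  proof (intro conjI A)
    show "eventually (\<lambda>x. g x i * A * inv\<^bsub>M i\<^esub> (g x i) \<in> carrier (M i)) F"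
      using g
    proof eventually_elim
      case (elim x)
      have "g x i \<otimes>\<^bsub>M i\<^esub> A \<otimes>\<^bsub>M i\<^esub> inv\<^bsub>M i\<^esub> (g x i) \<in> carrier (M i)"
        using elim A by (intro c.M.m_closed c.M.inv_closed)
      then show ?case by simp
    qed
    have "limitin \<tau> (\<lambda>x. g x \<otimes>\<^bsub>P\<^esub> embed i A \<otimes>\<^bsub>P\<^esub> inv\<^bsub>P\<^esub> (g x))
        (\<one>\<^bsub>P\<^esub> \<otimes>\<^bsub>P\<^esub> embed i A \<otimes>\<^bsub>P\<^esub> inv\<^bsub>P\<^esub> \<one>\<^bsub>P\<^esub>) F"
      by (intro limitin_mult[OF top] limitin_inv[OF top] lim limitin_group_const[OF top] embed_in_P A)
    moreover have "\<one>\<^bsub>P\<^esub> \<otimes>\<^bsub>P\<^esub> embed i A \<otimes>\<^bsub>P\<^esub> inv\<^bsub>P\<^esub> \<one>\<^bsub>P\<^esub> = embed i A"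
      using embed_in_P[OF A] by (simp only: P.inv_one P.l_one P.r_one)
    moreover have "eventually (\<lambda>x. g x \<otimes>\<^bsub>P\<^esub> embed i A \<otimes>\<^bsub>P\<^esub> inv\<^bsub>P\<^esub> (g x) = embed i (g x i * A * inv\<^bsub>M i\<^esub> (g x i))) F"
      using gP by eventually_elim (rule conj_embed[OF i _ A])
    ultimately show "limitin \<tau> (\<lambda>x. embed i (g x i * A * inv\<^bsub>M i\<^esub> (g x i))) (embed i A) F"
      by (simp only: limitin_transform_eventually)
  qed
  show "\<And>a b. a < n i \<Longrightarrow> b < n i \<Longrightarrow> ((\<lambda>x. g x i $$ (a, b) / last_entry (g x) i) \<longlongrightarrow> (if a = b then 1 else 0)) F"
    "((\<lambda>x. last_entry (g x) i ^ n i) \<longlongrightarrow> 1) F"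
    using c.conjugation_limit[OF g conj] by blast+
qed

text \<open>A number with non-negative real part is at least as close to \<open>1\<close> as its square.\<close>

lemma sign_correction:
  fixes z :: "'x \<Rightarrow> complex"
  assumes "((\<lambda>x. z x ^ 2) \<longlongrightarrow> 1) F"
  shows "((\<lambda>x. z x * (if 0 \<le> Re (z x) then 1 else -1)) \<longlongrightarrow> 1) F"
proof -
  define w where "w x = z x * (if 0 \<le> Re (z x) then 1 else -1)" for x
  have w2: "w x ^ 2 = z x ^ 2" and wRe: "0 \<le> Re (w x)" for x by (auto simp: w_def)
  have "((\<lambda>x. z x ^ 2 - 1) \<longlongrightarrow> 0) F" using assms by (simp add: LIM_zero_iff)
  then have lim: "((\<lambda>x. norm (z x ^ 2 - 1)) \<longlongrightarrow> 0) F" by (rule tendsto_norm_zero)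
  have le: "norm (w x - 1) \<le> norm (z x ^ 2 - 1)" for x
  proof -
    have "1 \<le> Re (w x + 1)" using wRe[of x] by simp
    also have "\<dots> \<le> norm (w x + 1)" by (rule complex_Re_le_cmod)
    finally have "norm (w x - 1) * 1 \<le> norm (w x - 1) * norm (w x + 1)" by (intro mult_left_mono) auto
    also have "\<dots> = norm (z x ^ 2 - 1)"
      unfolding w2[symmetric] norm_mult[symmetric] by (simp add: power2_eq_square algebra_simps)
    finally show ?thesis by simp
  qed
  have "((\<lambda>x. w x - 1) \<longlongrightarrow> 0) F"
    by (rule Lim_null_comparison[OF _ lim]) (simp add: le)
  then show ?thesis by (simp add: LIM_zero_iff w_def)
qed

text \<open>The scalars tend to \<open>2\<^sup>m\<close>-th roots of unity. Passing to squares, one may assume that they are close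
  to \<open>\<plusminus>1\<close>. The sign matrices are central elements of the product itself and there are only finitely many
  of them, so signs other than the identity are excluded by the Hausdorff property of the coarser topology.\<close>

lemma scalars_tend_to_one:
  assumes "limitin \<tau> g \<one>\<^bsub>P\<^esub> F" "\<And>i. i \<in> I \<Longrightarrow> ((\<lambda>x. last_entry (g x) i ^ (2 ^ m)) \<longlongrightarrow> 1) F" "i \<in> I"
  shows "((\<lambda>x. last_entry (g x) i) \<longlongrightarrow> 1) F"
  using assms
proof (induction m arbitrary: g i)
  case 0
  then show ?case by simp
next
  case (Suc m)
  interpret P: group P by (rule group_P)
  note lim = Suc.prems(1)
  have gP: "eventually (\<lambda>x. g x \<in> carrier P) F"
    by (rule limitin_eventually_carrier(1)[OF top lim])
  define q where "q x = g x \<otimes>\<^bsub>P\<^esub> g x" for x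
  have "limitin \<tau> q (\<one>\<^bsub>P\<^esub> \<otimes>\<^bsub>P\<^esub> \<one>\<^bsub>P\<^esub>) F"
    unfolding q_def by (intro limitin_mult[OF top] lim)
  then have q: "limitin \<tau> q \<one>\<^bsub>P\<^esub> F" using P.l_one[OF P.one_closed] by simp
  have last_entry_q: "eventually (\<lambda>x. last_entry (q x) j = last_entry (g x) j ^ 2) F" if j: "j \<in> I" for j
    using gP
  proof eventually_elim
    case (elim x)
    then have A: "g x j \<in> carrier (M j)" using j by auto
    then have Ac: "g x j \<in> carrier_mat (n j) (n j)" and up: "\<And>l. l < n j - 1 \<Longrightarrow> g x j $$ (n j - 1, l) = 0"
      using n_ge[OF j] by (auto simp: carrier_special_triangular carrier_special_linear)
    have "last_entry (q x) j = (\<Sum>l = 0..<n j. g x j $$ (n j - 1, l) * g x j $$ (l, n j - 1))"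
      using Ac j n_ge[OF j] by (simp add: q_def scalar_prod_def)
    also have "\<dots> = (\<Sum>l = 0..<n j. if l = n j - 1 then last_entry (g x) j ^ 2 else 0)"
      using up by (intro sum.cong) (auto simp: power2_eq_square)
    also have "\<dots> = last_entry (g x) j ^ 2" using n_ge[OF j] by simp
    finally show ?case .
  qed
  have sq: "((\<lambda>x. last_entry (g x) j ^ 2) \<longlongrightarrow> 1) F" if j: "j \<in> I" for j
  proof -
    have "((\<lambda>x. last_entry (q x) j' ^ (2 ^ m)) \<longlongrightarrow> 1) F" if j': "j' \<in> I" for j'
    proof -
      have "eventually (\<lambda>x. last_entry (g x) j' ^ (2 ^ Suc m) = last_entry (q x) j' ^ (2 ^ m)) F"
        using last_entry_q[OF j'] by eventually_elim (simp add: power_mult[symmetric])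
      then show ?thesis using Suc.prems(2)[OF j'] by (rule Lim_transform_eventually[rotated])
    qed
    from Suc.IH[OF q this j] last_entry_q[OF j] show ?thesis by (rule Lim_transform_eventually)
  qed
  define s where "s j x = (if 0 \<le> Re (last_entry (g x) j) then 1 else -1 :: complex)" for j x
  define S where "S x = (\<lambda>j\<in>I. s j x \<cdot>\<^sub>m 1\<^sub>m (n j))" for x
  have s: "s j x = 1 \<or> s j x = -1" for j x by (simp add: s_def)
  have S_P: "S x \<in> carrier P" for x
  proof -
    have "s j x \<cdot>\<^sub>m 1\<^sub>m (n j) \<in> carrier (M j)" if j: "j \<in> I" for j
    proof -
      have "even (n j)" using n[OF j] k[OF j] by simp
      then have "s j x ^ n j = 1" using s[of j x] by auto
      then show ?thesis
        using s[of j x] by (auto simp: carrier_special_triangular carrier_special_linear field_K)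
    qed
    then show ?thesis by (auto simp: S_def)
  qed
  define h where "h x = g x \<otimes>\<^bsub>P\<^esub> S x" for x
  have hP: "eventually (\<lambda>x. h x \<in> carrier P) F"
    using gP unfolding h_def by eventually_elim (rule P.m_closed[OF _ S_P])
  have "limitin T h \<one>\<^bsub>P\<^esub> F"
  proof (rule limit_of_components[OF P.one_closed hP])
    fix j a b assume j: "j \<in> I" and ab: "a < n j" "b < n j"
    have sl: "((\<lambda>x. last_entry (g x) j * s j x) \<longlongrightarrow> 1) F"
      unfolding s_def by (rule sign_correction[OF sq[OF j]])
    have l: "((\<lambda>x. g x j $$ (a, b) / last_entry (g x) j * (last_entry (g x) j * s j x)) \<longlongrightarrow> (if a = b then 1 else 0) * 1) F"
      by (intro tendsto_mult limit_up_to_scalars[OF lim j] ab sl)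
    have "eventually (\<lambda>x. last_entry (g x) j * s j x \<noteq> 0) F"
      using sl by (rule tendsto_imp_eventually_ne) simp
    then have ev: "eventually (\<lambda>x. g x j $$ (a, b) / last_entry (g x) j * (last_entry (g x) j * s j x) = h x j $$ (a, b)) F"
      using gP
    proof eventually_elim
      case (elim x)
      then have "g x j \<in> carrier_mat (n j) (n j)"
        using j by (auto simp: carrier_special_triangular carrier_special_linear)
      then have "h x j = s j x \<cdot>\<^sub>m g x j"
        using j by (simp add: h_def S_def mult_smult_distrib[of _ "n j" "n j" _ "n j"])
      then show ?case using elim ab \<open>g x j \<in> carrier_mat (n j) (n j)\<close> by simp
    qed
    show "((\<lambda>x. h x j $$ (a, b)) \<longlongrightarrow> \<one>\<^bsub>P\<^esub> j $$ (a, b)) F"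
      using Lim_transform_eventually[OF l ev] j ab by simp
  qed
  then have "limitin \<tau> (\<lambda>x. inv\<^bsub>P\<^esub> (g x) \<otimes>\<^bsub>P\<^esub> h x) (inv\<^bsub>P\<^esub> \<one>\<^bsub>P\<^esub> \<otimes>\<^bsub>P\<^esub> \<one>\<^bsub>P\<^esub>) F"
    by (intro limitin_mult[OF top] limitin_inv[OF top] lim limit_coarser)
  then have "limitin \<tau> (\<lambda>x. inv\<^bsub>P\<^esub> (g x) \<otimes>\<^bsub>P\<^esub> h x) \<one>\<^bsub>P\<^esub> F"
    by (simp only: P.inv_one P.l_one[OF P.one_closed])
  moreover have "eventually (\<lambda>x. inv\<^bsub>P\<^esub> (g x) \<otimes>\<^bsub>P\<^esub> h x = S x) F"
    using gP
  proof eventually_elim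
    case (elim x)
    show ?case
      unfolding h_def using elim S_P[of x]
      by (simp only: P.m_assoc[symmetric] P.inv_closed P.l_inv P.l_one)
  qed
  ultimately have S_lim: "limitin \<tau> (\<lambda>x. S x) \<one>\<^bsub>P\<^esub> F"
    by (rule limitin_transform_eventually[rotated])
  define Z where "Z = range S - {\<one>\<^bsub>P\<^esub>}"
  have "finite Z"
  proof -
    have "range S \<subseteq> PiE I (\<lambda>j. {1 \<cdot>\<^sub>m 1\<^sub>m (n j), (-1) \<cdot>\<^sub>m 1\<^sub>m (n j)})"
    proof
      fix y assume "y \<in> range S"
      then obtain x where y: "y = S x" by blast
      show "y \<in> PiE I (\<lambda>j. {1 \<cdot>\<^sub>m 1\<^sub>m (n j), (-1) \<cdot>\<^sub>m 1\<^sub>m (n j)})"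
        unfolding y S_def restrict_PiE_iff
      proof
        fix j show "s j x \<cdot>\<^sub>m 1\<^sub>m (n j) \<in> {1 \<cdot>\<^sub>m 1\<^sub>m (n j), (-1) \<cdot>\<^sub>m 1\<^sub>m (n j)}"
          using s[of j x] by (elim disjE) (simp_all only: insertI1 insertI2)
      qed
    qed
    then have "finite (range S)"
      by (rule finite_subset) (simp add: finite_PiE finite_I)
    then show ?thesis by (simp add: Z_def)
  qed
  moreover have "Z \<subseteq> topspace \<tau>"
    using S_P topological_groupD(2)[OF top] unfolding Z_def by blast
  moreover have "t1_space \<tau>"
    using topological_groupD(3)[OF top] by (rule Hausdorff_imp_t1_space)
  ultimately have "closedin \<tau> Z" by (simp add: t1_space_closedin_finite)
  then have "openin \<tau> (topspace \<tau> - Z)" by blast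
  moreover have "\<one>\<^bsub>P\<^esub> \<in> topspace \<tau> - Z"
    using P.one_closed topological_groupD(2)[OF top] by (simp add: Z_def)
  ultimately have "eventually (\<lambda>x. S x \<in> topspace \<tau> - Z) F"
    by (rule limitinD[OF S_lim])
  then have ev1: "eventually (\<lambda>x. last_entry (g x) i * s i x = last_entry (g x) i) F"
  proof eventually_elim
    case (elim x)
    then have "S x = \<one>\<^bsub>P\<^esub>" by (auto simp: Z_def)
    then have "S x i $$ (0, 0) = \<one>\<^bsub>P\<^esub> i $$ (0, 0)" by simp
    then show ?case using n_ge[OF Suc.prems(3)] Suc.prems(3) by (simp add: S_def)
  qed
  have "((\<lambda>x. last_entry (g x) i * s i x) \<longlongrightarrow> 1) F"
    unfolding s_def by (rule sign_correction[OF sq[OF Suc.prems(3)]])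
  then show ?case using ev1 by (rule Lim_transform_eventually)
qed

lemma limit_agrees:
  assumes lim: "limitin \<tau> g \<one>\<^bsub>P\<^esub> F"
  shows "limitin T g \<one>\<^bsub>P\<^esub> F"
proof (rule limit_of_components)
  show "\<one>\<^bsub>P\<^esub> \<in> carrier P" by (rule monoid.one_closed[OF group.is_monoid[OF group_P]])
  show "eventually (\<lambda>x. g x \<in> carrier P) F"
    by (rule limitin_eventually_carrier(1)[OF top lim])
  fix i a b assume i: "i \<in> I" and ab: "a < n i" "b < n i"
  have "((\<lambda>x. last_entry (g x) j ^ (2 ^ sum k I)) \<longlongrightarrow> 1) F" if j: "j \<in> I" for j
  proof -
    have "sum k I = k j + sum k (I - {j})" using finite_I j by (rule sum.remove)
    then have "last_entry (g x) j ^ (2 ^ sum k I) = (last_entry (g x) j ^ n j) ^ (2 ^ sum k (I - {j}))" for x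
      by (simp add: n[OF j] power_add power_mult)
    moreover have "((\<lambda>x. (last_entry (g x) j ^ n j) ^ (2 ^ sum k (I - {j}))) \<longlongrightarrow> 1 ^ (2 ^ sum k (I - {j}))) F"
      by (intro tendsto_power limit_up_to_scalars(2)[OF lim j])
    ultimately show ?thesis by simp
  qed
  then have l1: "((\<lambda>x. last_entry (g x) i) \<longlongrightarrow> 1) F"
    using scalars_tend_to_one[OF lim _ i] by blast
  have l: "((\<lambda>x. g x i $$ (a, b) / last_entry (g x) i * last_entry (g x) i) \<longlongrightarrow> (if a = b then 1 else 0) * 1) F"
    by (intro tendsto_mult limit_up_to_scalars[OF lim i] ab l1)
  have "eventually (\<lambda>x. last_entry (g x) i \<noteq> 0) F"
    using l1 by (rule tendsto_imp_eventually_ne) simp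
  then have ev: "eventually (\<lambda>x. g x i $$ (a, b) / last_entry (g x) i * last_entry (g x) i = g x i $$ (a, b)) F"
    by eventually_elim simp
  show "((\<lambda>x. g x i $$ (a, b)) \<longlongrightarrow> \<one>\<^bsub>P\<^esub> i $$ (a, b)) F"
    using Lim_transform_eventually[OF l ev] i ab by simp
qed

end

context complex_subfield
begin

theorem minimal_product_triangular:
  assumes "finite I" and "\<And>i. i \<in> I \<Longrightarrow> n i = 2 ^ k i \<and> 1 \<le> k i"
  shows "minimal_group (product_group I (\<lambda>i. special_triangular_group (n i) K))
    (product_topology (\<lambda>i. special_triangular_topology (n i) K) I)" (is "minimal_group ?P ?T")
proof (rule minimal_groupI)
  show "topological_group ?P ?T"
    by (rule topological_group_product) (rule topological_group_special_triangular)
  fix Y assume Y: "topological_group ?P Y" "\<And>U. openin Y U \<Longrightarrow> openin ?T U"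
  interpret coarse_product_topology K I n k Y
    using assms Y by unfold_locales auto
  show "limitin ?T (\<lambda>x. x) \<one>\<^bsub>?P\<^esub> (nhdsin Y \<one>\<^bsub>?P\<^esub>)"
  proof (rule limit_agrees, rule limitin_nhdsin)
    show "\<one>\<^bsub>?P\<^esub> \<in> topspace Y"
      using topological_groupD(2)[OF Y(1)] monoid.one_closed[OF group.is_monoid[OF group_P]] by simp
  qed
qed

end

section \<open>Products of special linear groups\<close>

abbreviation special_linear_product :: "'i set \<Rightarrow> ('i \<Rightarrow> nat) \<Rightarrow> ('i \<Rightarrow> complex mat) monoid" where
  "special_linear_product I n \<equiv> product_group I (\<lambda>i. special_linear_group (n i) UNIV)"

abbreviation special_linear_product_topology :: "'i set \<Rightarrow> ('i \<Rightarrow> nat) \<Rightarrow> ('i \<Rightarrow> complex mat) topology" where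
  "special_linear_product_topology I n \<equiv> product_topology (\<lambda>i. special_linear_topology (n i) UNIV) I"

lemma topological_group_special_linear_product:
  "topological_group (special_linear_product I n) (special_linear_product_topology I n)"
  by (rule topological_group_product) (rule topological_group_special_linear_UNIV)

lemma product_group_restrict:
  "product_group I (\<lambda>i. special_linear_group (n i) K) =
    (special_linear_product I n)\<lparr>carrier := PiE I (\<lambda>i. carrier (special_linear_group (n i) K))\<rparr>"
  "product_group I (\<lambda>i. special_triangular_group (n i) K) =
    (special_linear_product I n)\<lparr>carrier := PiE I (\<lambda>i. carrier (special_triangular_group (n i) K))\<rparr>"
  by (simp_all add: product_group_def)

lemma product_topology_restrict:
  "product_topology (\<lambda>i. special_linear_topology (n i) K) I =
    subtopology (special_linear_product_topology I n) (PiE I (\<lambda>i. carrier (special_linear_group (n i) K)))"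
  "product_topology (\<lambda>i. special_triangular_topology (n i) K) I =
    subtopology (special_linear_product_topology I n) (PiE I (\<lambda>i. carrier (special_triangular_group (n i) K)))"
  unfolding subtopology_product_topology special_linear_topology_restrict[of _ K]
    special_triangular_topology_restrict[of _ K] by (rule refl)+

lemma subgroup_product:
  assumes "\<And>i. i \<in> I \<Longrightarrow> subgroup (H i) (special_linear_group (n i) (UNIV :: complex set))"
  shows "subgroup (PiE I H) (special_linear_product I n)"
  using assms PiE_subgroup_product_group[of I "\<lambda>i. special_linear_group (n i) UNIV" H] group_special_linear by blast

context dense_complex_subfield
begin

theorem minimal_product_special_linear:
  fixes n k :: "'i \<Rightarrow> nat"
  assumes I: "finite I" and n: "\<And>i. i \<in> I \<Longrightarrow> n i = 2 ^ k i \<and> 1 \<le> k i"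
  shows "minimal_group (product_group I (\<lambda>i. special_linear_group (n i) K))
    (product_topology (\<lambda>i. special_linear_topology (n i) K) I)"
proof -
  let ?G = "special_linear_product I n" and ?X = "special_linear_product_topology I n"
  define S where "S = PiE I (\<lambda>i. carrier (special_linear_group (n i) K))"
  define T where "T = PiE I (\<lambda>i. carrier (special_triangular_group (n i) (UNIV :: complex set)))"
  define B where "B = PiE I (\<lambda>i. carrier (special_triangular_group (n i) K))"
  note G = topological_group_special_linear_product[of I n]
  have n0: "0 < n i" if "i \<in> I" for i using n[OF that] by simp
  have S: "subgroup S ?G" and B: "subgroup B ?G"
    unfolding S_def B_def by (intro subgroup_product subgroup_special_linear subgroup_special_triangular)+
  have T: "subgroup T ?G"
    unfolding T_def by (intro subgroup_product complex_subfield.subgroup_special_triangular complex_subfield_UNIV)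
  have BS: "B \<subseteq> S" and ST: "S \<inter> T = B"
    unfolding B_def S_def T_def by (auto simp: PiE_iff carrier_special_triangular carrier_special_linear)
  interpret G: group ?G by (rule topological_groupD(1)[OF G])
  define tri where "tri m b \<longleftrightarrow> (\<forall>A \<in> carrier_mat m m. \<exists>Q B. Q \<in> carrier_mat m m \<and> B \<in> carrier_mat m m \<and>
    det Q = 1 \<and> (\<forall>i<m. \<forall>j<m. norm (Q $$ (i, j)) \<le> b) \<and> upper_triangular B \<and> A * Q = Q * (B :: complex mat))"
    for m b
  have "\<forall>i. \<exists>b. tri (n i) b"
    unfolding tri_def using bounded_triangularization by blast
  then obtain b where b: "\<And>i. tri (n i) (b i)" by metis
  define C where "C = PiE I (\<lambda>i. {A \<in> carrier (special_linear_group (n i) UNIV).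
    \<forall>l<n i. \<forall>j<n i. norm (A $$ (l, j) :: complex) \<le> b i + 1})"
  define D where "D = PiE I (\<lambda>i. {A \<in> carrier (special_linear_group (n i) UNIV).
    \<forall>l<n i. \<forall>j<n i. norm (A $$ (l, j) :: complex) < b i + 1})"
  have C: "compactin ?X C"
    unfolding C_def compactin_PiE by (intro disjI2 ballI compactin_bounded_special_linear)
  have D: "openin ?X D"
    unfolding D_def openin_PiE_gen
    by (intro disjI2 conjI ballI openin_bounded_special_linear finite_subset[OF _ I]) auto
  have DC: "D \<subseteq> C" unfolding C_def D_def by (intro PiE_mono) (auto intro: less_imp_le)
  have dense_S: "D \<subseteq> ?X closure_of S"
    unfolding D_def S_def closure_of_product_topology
    using dense_special_linear n0 by (intro PiE_mono) blast
  have dense_T: "T \<subseteq> ?X closure_of (S \<inter> T)"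
    unfolding ST unfolding T_def B_def closure_of_product_topology
    using dense_special_triangular n0 by (intro PiE_mono) blast
  have conj: "\<exists>p\<in>D. inv\<^bsub>?G\<^esub> p \<otimes>\<^bsub>?G\<^esub> g \<otimes>\<^bsub>?G\<^esub> p \<in> T" if g: "g \<in> S" for g
  proof -
    have "\<exists>Q. Q \<in> carrier (special_linear_group (n i) UNIV) \<and> (\<forall>l<n i. \<forall>j<n i. norm (Q $$ (l, j)) < b i + 1) \<and>
        inv\<^bsub>special_linear_group (n i) UNIV\<^esub> Q * g i * Q \<in> carrier (special_triangular_group (n i) UNIV)"
      if i: "i \<in> I" for i
    proof -
      have gi: "g i \<in> carrier_mat (n i) (n i)" "det (g i) = 1"
        using g i unfolding S_def by (auto simp: PiE_iff carrier_special_linear)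
      obtain Q U where Q: "Q \<in> carrier_mat (n i) (n i)" "det Q = 1" and le: "\<forall>l<n i. \<forall>j<n i. norm (Q $$ (l, j)) \<le> b i"
        and U: "U \<in> carrier_mat (n i) (n i)" "upper_triangular U" and eq: "g i * Q = Q * U"
        using b[of i] gi(1) unfolding tri_def by blast
      have QS: "Q \<in> carrier (special_linear_group (n i) UNIV)" using Q by (simp add: carrier_special_linear)
      note adj = adj_mat_special_linear[OF Q]
      have "adj_mat Q * g i * Q = adj_mat Q * (g i * Q)"
        by (rule assoc_mult_mat[OF adj(1) gi(1) Q(1)])
      also have "\<dots> = adj_mat Q * Q * U"
        unfolding eq by (rule assoc_mult_mat[OF adj(1) Q(1) U(1), symmetric])
      also have "\<dots> = U" using U(1) by (simp add: adj(2))
      finally have e: "adj_mat Q * g i * Q = U" .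
      have "det U = 1"
        using det_mult[OF gi(1) Q(1)] det_mult[OF Q(1) U(1)] eq gi(2) Q(2) by simp
      then have "U \<in> carrier (special_triangular_group (n i) UNIV)"
        using U by (auto simp: carrier_special_triangular carrier_special_linear upper_triangular_def)
      moreover have "norm (Q $$ (l, j)) < b i + 1" if "l < n i" "j < n i" for l j
      proof -
        have "norm (Q $$ (l, j)) \<le> b i" using le that by blast
        then show ?thesis by linarith
      qed
      ultimately show ?thesis
        using QS by (intro exI[of _ Q]) (simp add: inv_special_linear[OF QS] e)
    qed
    then obtain p where p: "\<And>i. i \<in> I \<Longrightarrow> p i \<in> carrier (special_linear_group (n i) UNIV) \<and>
        (\<forall>l<n i. \<forall>j<n i. norm (p i $$ (l, j)) < b i + 1) \<and>
        inv\<^bsub>special_linear_group (n i) UNIV\<^esub> (p i) * g i * p i \<in> carrier (special_triangular_group (n i) UNIV)"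
      by metis
    let ?p = "\<lambda>i\<in>I. p i"
    have pD: "?p \<in> D" unfolding D_def using p by auto
    have "inv\<^bsub>?G\<^esub> ?p = (\<lambda>i\<in>I. inv\<^bsub>special_linear_group (n i) UNIV\<^esub> (?p i))"
      using p group_special_linear by (intro inv_product_group) auto
    then have "inv\<^bsub>?G\<^esub> ?p \<otimes>\<^bsub>?G\<^esub> g \<otimes>\<^bsub>?G\<^esub> ?p \<in> T"
      unfolding T_def using p by auto
    then show ?thesis using pD by blast
  qed
  show ?thesis
    unfolding product_group_restrict[where K = K] product_topology_restrict[where K = K] S_def[symmetric]
  proof (rule minimal_groupI)
    show "topological_group (?G\<lparr>carrier := S\<rparr>) (subtopology ?X S)"
      by (rule topological_group_subgroup[OF G S])
    fix Y assume Y: "topological_group (?G\<lparr>carrier := S\<rparr>) Y"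
      and le: "\<And>U. openin Y U \<Longrightarrow> openin (subtopology ?X S) U"
    have tY: "topspace Y = S" using topological_groupD(2)[OF Y] by simp
    have eq: "subtopology Y B = subtopology ?X B"
    proof -
      have "subgroup B (?G\<lparr>carrier := S\<rparr>)"
        by (rule G.subgroup_incl[OF B S BS])
      from topological_group_subgroup[OF Y this]
      have "topological_group (?G\<lparr>carrier := B\<rparr>) (subtopology Y B)" by simp
      moreover have "openin (subtopology ?X B) V" if V: "openin (subtopology Y B) V" for V
      proof -
        obtain W where W: "openin Y W" "V = W \<inter> B" using V by (auto simp: openin_subtopology)
        then obtain W' where "openin ?X W'" "W = W' \<inter> S" using le by (auto simp: openin_subtopology)
        then have "openin ?X W'" "V = W' \<inter> B" using W(2) BS by auto
        then show ?thesis by (auto simp: openin_subtopology)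
      qed
      moreover have "minimal_group (?G\<lparr>carrier := B\<rparr>) (subtopology ?X B)"
        using minimal_product_triangular[of I n k] I n
        unfolding product_group_restrict[where K = K] product_topology_restrict[where K = K] B_def[symmetric] by blast
      ultimately show ?thesis unfolding minimal_group_def by blast
    qed
    have agree: "\<exists>V. openin Y V \<and> \<one>\<^bsub>?G\<^esub> \<in> V \<and> V \<inter> T \<subseteq> U" if U: "openin ?X U" "\<one>\<^bsub>?G\<^esub> \<in> U" for U
    proof -
      have "openin (subtopology ?X B) (U \<inter> B)" using U by (auto simp: openin_subtopology)
      then obtain V where V: "openin Y V" "U \<inter> B = V \<inter> B"
        unfolding eq[symmetric] by (auto simp: openin_subtopology)
      have "\<one>\<^bsub>?G\<^esub> \<in> V" using V(2) U(2) subgroup.one_closed[OF B] by blast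
      moreover have "V \<inter> T \<subseteq> U" using openin_subset[OF V(1)] tY ST V(2) by blast
      ultimately show ?thesis using V(1) by blast
    qed
    have "limitin (subtopology ?X S) (\<lambda>x. x) \<one>\<^bsub>?G\<^esub> (nhdsin Y \<one>\<^bsub>?G\<^esub>)"
      by (rule coarser_topology_conjugation_transfer[OF G S T Y le agree C D DC dense_S dense_T conj])
    then show "limitin (subtopology ?X S) (\<lambda>x. x) \<one>\<^bsub>?G\<lparr>carrier := S\<rparr>\<^esub> (nhdsin Y \<one>\<^bsub>?G\<lparr>carrier := S\<rparr>\<^esub>)"
      by simp
  qed
qed

end

section \<open>Infinite products\<close>

definition scalar_family :: "'i set \<Rightarrow> ('i \<Rightarrow> nat) \<Rightarrow> ('i \<Rightarrow> complex) \<Rightarrow> 'i \<Rightarrow> complex mat" where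
  "scalar_family I n w = (\<lambda>i\<in>I. w i \<cdot>\<^sub>m 1\<^sub>m (n i))"

text \<open>Roots of unity \<open>w i\<close> of order dividing \<open>2\<^sup>k\<close>, with \<open>k = k i\<close>, that are compatible under raising to
  powers of two. When \<open>k\<close> is unbounded on \<open>I\<close>, they form the inverse limit of the cyclic groups of order \<open>2\<^sup>k\<close>, a copy of
  the additive group of 2-adic integers.\<close>

definition compatible_roots :: "'i set \<Rightarrow> ('i \<Rightarrow> nat) \<Rightarrow> ('i \<Rightarrow> complex) \<Rightarrow> bool" where
  "compatible_roots I k w \<longleftrightarrow> (\<forall>i\<in>I. w i ^ (2 ^ k i) = 1) \<and>
     (\<forall>i\<in>I. \<forall>j\<in>I. k i \<le> k j \<longrightarrow> w j ^ (2 ^ (k j - k i)) = w i)"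

locale linear_product_power_of_two =
  fixes I :: "'i set" and n k :: "'i \<Rightarrow> nat"
  assumes n: "\<And>i. i \<in> I \<Longrightarrow> n i = 2 ^ k i"
begin

abbreviation "G \<equiv> special_linear_product I n"
abbreviation "X \<equiv> special_linear_product_topology I n"

definition N :: "('i \<Rightarrow> complex mat) set" where
  "N = {scalar_family I n w | w. compatible_roots I k w}"

sublocale G: group G
  by (rule topological_groupD(1)[OF topological_group_special_linear_product])

lemma n_pos: "i \<in> I \<Longrightarrow> 0 < n i"
  using n by simp

lemma scalar_family_carrier:
  assumes "\<And>i. i \<in> I \<Longrightarrow> w i ^ (2 ^ k i) = 1"
  shows "scalar_family I n w \<in> carrier G"
  using assms n by (auto simp: scalar_family_def carrier_special_linear)

lemma scalar_family_mult:
  "scalar_family I n v \<otimes>\<^bsub>G\<^esub> scalar_family I n w = scalar_family I n (\<lambda>i. v i * w i)"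
  by (auto simp: scalar_family_def fun_eq_iff intro!: eq_matI)

lemma scalar_family_one: "scalar_family I n (\<lambda>_. 1) = \<one>\<^bsub>G\<^esub>"
  by (auto simp: scalar_family_def fun_eq_iff intro!: eq_matI)

lemma compatible_rootsD:
  assumes "compatible_roots I k w"
  shows "i \<in> I \<Longrightarrow> w i ^ (2 ^ k i) = 1"
    "i \<in> I \<Longrightarrow> j \<in> I \<Longrightarrow> k i \<le> k j \<Longrightarrow> w j ^ (2 ^ (k j - k i)) = w i"
  using assms by (auto simp: compatible_roots_def)

lemma N_carrier: "N \<subseteq> carrier G"
  unfolding N_def using scalar_family_carrier compatible_rootsD(1) by blast

lemma subgroup_N: "subgroup N G"
proof (rule G.subgroupI[OF N_carrier])
  have "compatible_roots I k (\<lambda>_. 1)" by (simp add: compatible_roots_def)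
  then show "N \<noteq> {}" unfolding N_def by blast
next
  fix x assume "x \<in> N"
  then obtain w where w: "compatible_roots I k w" "x = scalar_family I n w" unfolding N_def by blast
  let ?v = "\<lambda>i. inverse (w i)"
  have v: "compatible_roots I k ?v"
    using w(1) unfolding compatible_roots_def by (simp add: power_inverse)
  have "w i \<noteq> 0" if "i \<in> I" for i
    using compatible_rootsD(1)[OF w(1) that] by (auto simp: power_0_left split: if_splits)
  then have "scalar_family I n (\<lambda>i. ?v i * w i) = scalar_family I n (\<lambda>_. 1)"
    by (auto simp: scalar_family_def fun_eq_iff)
  then have "scalar_family I n ?v \<otimes>\<^bsub>G\<^esub> x = \<one>\<^bsub>G\<^esub>"
    unfolding w(2) scalar_family_mult scalar_family_one .
  moreover have "x \<in> carrier G" "scalar_family I n ?v \<in> carrier G"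
    unfolding w(2) by (intro scalar_family_carrier compatible_rootsD(1)[OF w(1)] compatible_rootsD(1)[OF v]; assumption)+
  ultimately have "inv\<^bsub>G\<^esub> x = scalar_family I n ?v"
    by (rule G.inv_equality)
  then show "inv\<^bsub>G\<^esub> x \<in> N" unfolding N_def using v by blast
next
  fix x y assume "x \<in> N" "y \<in> N"
  then obtain v w where vw: "compatible_roots I k v" "x = scalar_family I n v"
    "compatible_roots I k w" "y = scalar_family I n w" unfolding N_def by blast
  then have "compatible_roots I k (\<lambda>i. v i * w i)"
    unfolding compatible_roots_def by (simp add: power_mult_distrib)
  then show "x \<otimes>\<^bsub>G\<^esub> y \<in> N" unfolding N_def vw(2,4) scalar_family_mult by blast
qed

lemma central_N:
  assumes "x \<in> N" "y \<in> carrier G"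
  shows "x \<otimes>\<^bsub>G\<^esub> y = y \<otimes>\<^bsub>G\<^esub> x"
proof
  fix i
  obtain w where w: "x = scalar_family I n w" using assms(1) unfolding N_def by blast
  show "(x \<otimes>\<^bsub>G\<^esub> y) i = (y \<otimes>\<^bsub>G\<^esub> x) i"
  proof (cases "i \<in> I")
    case True
    then have y: "y i \<in> carrier_mat (n i) (n i)" using assms(2) by (auto simp: carrier_special_linear)
    have "w i \<cdot>\<^sub>m 1\<^sub>m (n i) * y i = w i \<cdot>\<^sub>m y i" "y i * (w i \<cdot>\<^sub>m 1\<^sub>m (n i)) = w i \<cdot>\<^sub>m y i"
      using y by (simp_all add: mult_smult_assoc_mat[of _ "n i" "n i" _ "n i"] mult_smult_distrib[of _ "n i" "n i" _ "n i"])
    then show ?thesis using True by (simp add: w scalar_family_def)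
  qed simp
qed

lemma closed_N: "closedin X N"
proof -
  note tX = topological_groupD(2)[OF topological_group_special_linear_product[of I n]]
  have "x \<in> N" if x: "x \<in> X closure_of N" for x
  proof -
    define F where "F = inf (nhdsin X x) (principal N)"
    have xX: "x \<in> topspace X" using x by (simp add: in_closure_of)
    have F: "F \<noteq> bot"
    proof
      assume "F = bot"
      then have "eventually (\<lambda>y. y \<notin> N) (nhdsin X x)"
        unfolding F_def trivial_limit_def eventually_inf_principal by simp
      then obtain U where "openin X U" "x \<in> U" "\<forall>y\<in>U. y \<notin> N"
        using xX unfolding eventually_nhdsin by blast
      then show False using x unfolding in_closure_of by blast
    qed
    have lim: "limitin X (\<lambda>y. y) x F"
      unfolding F_def by (rule limitin_filter_mono[OF limitin_nhdsin[OF xX]]) simp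
    have entry: "((\<lambda>y. y i $$ (a, b)) \<longlongrightarrow> x i $$ (a, b)) F" if "i \<in> I" "a < n i" "b < n i" for i a b
      using lim that unfolding limitin_componentwise limitin_special_linear by blast
    have FN: "eventually (\<lambda>y. y \<in> N) F"
      unfolding F_def by (simp add: eventually_inf_principal)
    have unique: "u = v" if "(f \<longlongrightarrow> u) F" "(f' \<longlongrightarrow> v) F" "\<And>y. y \<in> N \<Longrightarrow> f y = f' y"
      for u v :: complex and f f'
    proof -
      have "eventually (\<lambda>y. f y = f' y) F" using FN by eventually_elim (rule that(3))
      then have "(f' \<longlongrightarrow> u) F" using that(1) by (rule Lim_transform_eventually[rotated])
      then show ?thesis using tendsto_unique[OF F] that(2) by blast
    qed
    define w where "w i = x i $$ (0, 0)" for i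
    have xc: "x i \<in> carrier (special_linear_group (n i) UNIV)" if "i \<in> I" for i
      using xX tX that by auto
    have entries: "x i $$ (a, b) = (if a = b then w i else 0)" if i: "i \<in> I" and ab: "a < n i" "b < n i" for i a b
      unfolding w_def
    proof (rule unique[OF entry[OF i ab]])
      show "((\<lambda>y. if a = b then y i $$ (0, 0) else 0) \<longlongrightarrow> (if a = b then x i $$ (0, 0) else 0)) F"
        using entry[OF i n_pos[OF i] n_pos[OF i]] by simp
      fix y assume "y \<in> N"
      then show "y i $$ (a, b) = (if a = b then y i $$ (0, 0) else 0)"
        using i ab by (auto simp: N_def scalar_family_def)
    qed
    have x_eq: "x = scalar_family I n w"
    proof
      fix i
      show "x i = scalar_family I n w i"
      proof (cases "i \<in> I")
        case True
        have "x i = w i \<cdot>\<^sub>m 1\<^sub>m (n i)"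
          using xc[OF True] entries[OF True] by (intro eq_matI) (auto simp: carrier_special_linear)
        then show ?thesis using True by (simp add: scalar_family_def)
      next
        case False
        then show ?thesis using xX tX by (auto simp: scalar_family_def PiE_iff extensional_def)
      qed
    qed
    have "w i ^ (2 ^ k i) = 1" if i: "i \<in> I" for i
    proof -
      have "x i = w i \<cdot>\<^sub>m 1\<^sub>m (n i)" using i by (simp add: x_eq scalar_family_def)
      then have "det (x i) = w i ^ n i" by simp
      then show ?thesis using xc[OF i] n[OF i] by (simp add: carrier_special_linear)
    qed
    moreover have "w j ^ (2 ^ (k j - k i)) = w i" if ij: "i \<in> I" "j \<in> I" "k i \<le> k j" for i j
      unfolding w_def
    proof (rule unique[OF tendsto_power[OF entry] entry])
      fix y assume "y \<in> N"
      then show "(y j $$ (0, 0)) ^ (2 ^ (k j - k i)) = y i $$ (0, 0)"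
        using ij n_pos compatible_rootsD(2) by (auto simp: N_def scalar_family_def)
    qed (use ij n_pos in auto)
    ultimately show "x \<in> N" unfolding N_def x_eq compatible_roots_def by blast
  qed
  then show ?thesis
    using N_carrier tX closure_of_subset_eq[of N X] by blast
qed

end

text \<open>If the order of \<open>w\<close> is \<open>2\<^sup>t\<close>, then \<open>t > m \<ge> 3\<close>, and a power of \<open>w\<close> is a primitive eighth root of unity.\<close>

lemma two_power_torsion:
  fixes w :: complex
  assumes "w ^ (2 ^ r) = 1" "w ^ (2 ^ m) \<noteq> 1" "3 \<le> m"
  shows "\<exists>s. (w ^ s) ^ 4 = -1"
proof -
  define t where "t = (LEAST t. w ^ (2 ^ t) = 1)"
  have t: "w ^ (2 ^ t) = 1"
    unfolding t_def by (rule LeastI[where P = "\<lambda>t. w ^ (2 ^ t) = 1"]) (rule assms(1))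
  have least: "w ^ (2 ^ t') \<noteq> 1" if "t' < t" for t' using not_less_Least that unfolding t_def by blast
  have "m < t"
  proof (rule ccontr)
    assume "\<not> m < t"
    then have "w ^ (2 ^ m) = (w ^ (2 ^ t)) ^ (2 ^ (m - t))"
      by (simp add: power_mult[symmetric] power_add[symmetric])
    then show False using assms(2) t by simp
  qed
  then obtain d where d: "t = d + 3" using assms(3) by (metis add.commute le_Suc_ex less_imp_le order_trans)
  define v where "v = w ^ (2 ^ (d + 2))"
  have "v ^ 2 = w ^ (2 ^ t)"
  proof -
    have "(2 :: nat) ^ t = 2 ^ (d + 2) * 2" by (simp add: d power_add)
    then show ?thesis by (simp only: v_def power_mult)
  qed
  then have "v ^ 2 = 1" using t by simp
  moreover have "v \<noteq> 1" unfolding v_def using least[of "d + 2"] d by simp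
  ultimately have "v = -1" by (simp add: power2_eq_1_iff)
  moreover have "v = (w ^ (2 ^ d)) ^ 4"
  proof -
    have "(2 :: nat) ^ (d + 2) = 2 ^ d * 4" by (simp add: power_add)
    then show ?thesis by (simp only: v_def power_mult)
  qed
  ultimately show ?thesis by metis
qed

text \<open>The compatible families of scalars form the central subgroup. In such a family, a component different from \<open>1\<close>
  is a power of each component with a larger exponent. If that exponent is larger by at least three, the latter
  component has a primitive eighth root of unity among its powers. So no nontrivial family has all its components in \<open>K\<close>. The family
  \<open>exp (2 \<pi> \<i> / 2\<^sup>k)\<close> is nontrivial, and it is a limit of elements with entries in \<open>K\<close>.\<close>

lemma (in dense_complex_subfield) not_minimal_infinite_product:
  fixes n k :: "'i \<Rightarrow> nat" and H :: "'i \<Rightarrow> complex mat set"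
  assumes no_root: "\<And>u. u \<in> K \<Longrightarrow> u ^ 4 \<noteq> -1"
    and I: "infinite I" and k: "inj_on k I" and n: "\<And>i. i \<in> I \<Longrightarrow> n i = 2 ^ k i \<and> 1 \<le> k i"
    and H: "\<And>i. i \<in> I \<Longrightarrow> subgroup (H i) (special_linear_group (n i) UNIV)"
    and lower: "\<And>i. i \<in> I \<Longrightarrow> carrier (special_triangular_group (n i) K) \<subseteq> H i"
    and upper: "\<And>i. i \<in> I \<Longrightarrow> H i \<subseteq> carrier (special_linear_group (n i) K)"
  shows "\<not> minimal_group ((special_linear_product I n)\<lparr>carrier := PiE I H\<rparr>)
    (subtopology (special_linear_product_topology I n) (PiE I H))"
proof -
  have k1: "\<And>i. i \<in> I \<Longrightarrow> 1 \<le> k i" using n by blast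
  interpret linear_product_power_of_two I n k by unfold_locales (use n in blast)
  have "N \<inter> PiE I H \<subseteq> {\<one>\<^bsub>G\<^esub>}"
  proof
    fix x assume x: "x \<in> N \<inter> PiE I H"
    then obtain w where w: "compatible_roots I k w" "x = scalar_family I n w" unfolding N_def by blast
    have wK: "w i \<in> K" if i: "i \<in> I" for i
    proof -
      have "x i \<in> carrier (special_linear_group (n i) K)" using x upper[OF i] i by blast
      then have "x i $$ (0, 0) \<in> K" using n_pos[OF i] by (simp add: carrier_special_linear)
      then show ?thesis using i n_pos[OF i] by (simp add: w(2) scalar_family_def)
    qed
    have "w i = 1" if i: "i \<in> I" for i
    proof (rule ccontr)
      assume ne: "w i \<noteq> 1"
      have "infinite (k ` I)" using I k by (simp add: finite_image_iff)
      then obtain j where j: "j \<in> I" "k i + 3 \<le> k j"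
        by (metis (no_types, lifting) imageE infinite_nat_iff_unbounded_le)
      have "w j ^ (2 ^ (k j - k i)) = w i" using compatible_rootsD(2)[OF w(1) i j(1)] j(2) by simp
      then have "w j ^ (2 ^ (k j - k i)) \<noteq> 1" using ne by simp
      moreover have "3 \<le> k j - k i" using j(2) by simp
      ultimately obtain s where "(w j ^ s) ^ 4 = -1"
        using two_power_torsion[OF compatible_rootsD(1)[OF w(1) j(1)]] by blast
      then show False using no_root[OF power_K[OF wK[OF j(1)]]] by blast
    qed
    then have "x = scalar_family I n (\<lambda>_. 1)"
      unfolding w(2) by (auto simp: scalar_family_def fun_eq_iff)
    then show "x \<in> {\<one>\<^bsub>G\<^esub>}" by (simp add: scalar_family_one)
  qed
  moreover have sub: "subgroup (PiE I H) G" by (intro subgroup_product H)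
  ultimately have triv: "N \<inter> PiE I H = {\<one>\<^bsub>G\<^esub>}"
    using subgroup.one_closed[OF sub] subgroup.one_closed[OF subgroup_N] by blast
  define w where "w i = cis (2 * pi / 2 ^ k i)" for i
  have w_pow: "w i ^ m = cis (real m * (2 * pi / 2 ^ k i))" for i m
    unfolding w_def by (rule DeMoivre)
  have w: "compatible_roots I k w"
    unfolding compatible_roots_def
  proof (intro conjI ballI impI)
    fix i show "w i ^ (2 ^ k i) = 1" by (simp add: w_pow)
  next
    fix i j assume "k i \<le> k j"
    then have "(2 :: real) ^ k j = 2 ^ (k j - k i) * 2 ^ k i" by (simp add: power_add[symmetric])
    then show "w j ^ (2 ^ (k j - k i)) = w i" by (simp add: w_pow w_def[of i])
  qed
  let ?c = "scalar_family I n w"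
  have cN: "?c \<in> N" unfolding N_def using w by blast
  have "I \<noteq> {}" using I by auto
  then obtain i where i: "i \<in> I" by blast
  have c1: "?c \<noteq> \<one>\<^bsub>G\<^esub>"
  proof
    assume "?c = \<one>\<^bsub>G\<^esub>"
    then have "?c i $$ (0, 0) = \<one>\<^bsub>G\<^esub> i $$ (0, 0)" by simp
    then have "w i = 1" using i n_pos[OF i] by (simp add: scalar_family_def)
    then have "w i ^ (2 ^ (k i - 1)) = 1" by simp
    moreover have "w i ^ (2 ^ (k i - 1)) = -1"
    proof -
      have "(2 :: real) ^ k i = 2 * 2 ^ (k i - 1)"
        using k1[OF i] by (cases "k i") simp_all
      then show ?thesis by (simp add: w_pow)
    qed
    ultimately show False by simp
  qed
  have "?c \<in> X closure_of (PiE I H)"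
    unfolding closure_of_product_topology
  proof (rule PiE_I)
    fix i assume i: "i \<in> I"
    have "?c i \<in> carrier (special_triangular_group (n i) UNIV)"
      using i compatible_rootsD(1)[OF w i] n[OF i]
      by (auto simp: scalar_family_def carrier_special_triangular carrier_special_linear)
    then show "?c i \<in> special_linear_topology (n i) UNIV closure_of H i"
      using dense_special_triangular[OF n_pos[OF i]] closure_of_mono[OF lower[OF i]] by blast
  qed (simp add: scalar_family_def)
  from not_minimal_of_central_subgroup[OF topological_group_special_linear_product sub subgroup_N
      closed_N central_N triv cN c1 this]
  show ?thesis by blast
qed

lemma (in dense_complex_subfield) finite_iff_minimal:
  fixes n :: "'i \<Rightarrow> nat"
  assumes no_root: "\<And>u. u \<in> K \<Longrightarrow> u ^ 4 \<noteq> -1"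
    and n: "\<And>i. i \<in> I \<Longrightarrow> \<exists>k\<ge>1. n i = 2 ^ k" and inj: "inj_on n I"
  shows "finite I \<longleftrightarrow> minimal_group (product_group I (\<lambda>i. special_linear_group (n i) K))
      (product_topology (\<lambda>i. special_linear_topology (n i) K) I)"
    "finite I \<longleftrightarrow> minimal_group (product_group I (\<lambda>i. special_triangular_group (n i) K))
      (product_topology (\<lambda>i. special_triangular_topology (n i) K) I)"
proof -
  obtain k where k: "\<And>i. i \<in> I \<Longrightarrow> n i = 2 ^ k i \<and> 1 \<le> k i"
    using n by metis
  have k_inj: "inj_on k I"
    using inj k unfolding inj_on_def by metis
  show "finite I \<longleftrightarrow> minimal_group (product_group I (\<lambda>i. special_linear_group (n i) K))
      (product_topology (\<lambda>i. special_linear_topology (n i) K) I)"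
  proof
    show "finite I" if "minimal_group (product_group I (\<lambda>i. special_linear_group (n i) K))
      (product_topology (\<lambda>i. special_linear_topology (n i) K) I)"
    proof (rule ccontr)
      assume I: "infinite I"
      have "\<not> minimal_group ((special_linear_product I n)\<lparr>carrier := PiE I (\<lambda>i. carrier (special_linear_group (n i) K))\<rparr>)
        (subtopology (special_linear_product_topology I n) (PiE I (\<lambda>i. carrier (special_linear_group (n i) K))))"
        by (rule not_minimal_infinite_product[OF no_root I k_inj k])
          (rule subgroup_special_linear triangular_subset subset_refl | assumption)+
      then show False using that unfolding product_group_restrict[where K = K] product_topology_restrict[where K = K] by blast
    qed
  qed (rule minimal_product_special_linear[OF _ k])
  show "finite I \<longleftrightarrow> minimal_group (product_group I (\<lambda>i. special_triangular_group (n i) K))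
      (product_topology (\<lambda>i. special_triangular_topology (n i) K) I)"
  proof
    show "finite I" if "minimal_group (product_group I (\<lambda>i. special_triangular_group (n i) K))
      (product_topology (\<lambda>i. special_triangular_topology (n i) K) I)"
    proof (rule ccontr)
      assume I: "infinite I"
      have "\<not> minimal_group ((special_linear_product I n)\<lparr>carrier := PiE I (\<lambda>i. carrier (special_triangular_group (n i) K))\<rparr>)
        (subtopology (special_linear_product_topology I n) (PiE I (\<lambda>i. carrier (special_triangular_group (n i) K))))"
        by (rule not_minimal_infinite_product[OF no_root I k_inj k])
          (rule subgroup_special_triangular triangular_subset subset_refl | assumption)+
      then show False using that unfolding product_group_restrict[where K = K] product_topology_restrict[where K = K] by blast
    qed
  qed (rule minimal_product_triangular[OF _ k])
qed

section \<open>The Gaussian rationals and the arithmetic families\<close>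

lemma gaussian_rationals_dense_subfield: "dense_complex_subfield gaussian_rationals"
proof unfold_locales
  show "1 \<in> gaussian_rationals" by (simp add: gaussian_rationals_def)
  show "x - y \<in> gaussian_rationals" "x * y \<in> gaussian_rationals"
    if "x \<in> gaussian_rationals" "y \<in> gaussian_rationals" for x y
    using that by (auto simp: gaussian_rationals_def)
  show "inverse x \<in> gaussian_rationals" if "x \<in> gaussian_rationals" for x
    using that by (auto simp: gaussian_rationals_def)
  show "closure gaussian_rationals = UNIV"
  proof (intro equalityI subsetI)
    fix z :: complex
    show "z \<in> closure gaussian_rationals"
      unfolding closure_approachable
    proof (intro allI impI)
      fix e :: real assume e: "0 < e"
      obtain r where r: "r \<in> \<rat>" "Re z < r" "r < Re z + e / 2"
        using Rats_dense_in_real[of "Re z" "Re z + e / 2"] e by auto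
      obtain s where s: "s \<in> \<rat>" "Im z < s" "s < Im z + e / 2"
        using Rats_dense_in_real[of "Im z" "Im z + e / 2"] e by auto
      have "dist (Complex r s) z \<le> \<bar>r - Re z\<bar> + \<bar>s - Im z\<bar>"
        using cmod_le[of "Complex r s - z"] by (simp add: dist_norm)
      also have "\<dots> < e" using r s by simp
      finally show "\<exists>y\<in>gaussian_rationals. dist y z < e"
        using r(1) s(1) by (intro bexI[of _ "Complex r s"]) (auto simp: gaussian_rationals_def)
    qed
  qed simp
qed

lemma two_not_rational_square:
  assumes "(a :: real) \<in> \<rat>"
  shows "a ^ 2 \<noteq> 2"
proof
  assume a: "a ^ 2 = 2"
  obtain m n :: nat where mn: "n \<noteq> 0" "\<bar>a\<bar> = real m / real n" "coprime m n"
    using Rats_abs_nat_div_natE[OF assms] by blast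
  have "a ^ 2 = (real m / real n) ^ 2" using mn(2) by (metis power2_abs)
  then have "real (m ^ 2) = real (2 * n ^ 2)"
    using a mn(1) by (simp add: power_divide field_simps)
  then have eq: "m ^ 2 = 2 * n ^ 2" by (simp only: of_nat_eq_iff)
  then have "even (m ^ 2)" by simp
  then have "even m" by simp
  then obtain l where l: "m = 2 * l" by blast
  then have "n ^ 2 = 2 * l ^ 2" using eq by (simp add: power_mult_distrib)
  then have "even (n ^ 2)" by simp
  then have "even n" by simp
  then show False using mn(3) \<open>even m\<close> coprime_common_divisor[of m n 2] by simp
qed

text \<open>If \<open>u\<^sup>4 = -1\<close>, then \<open>u\<^sup>2 = \<plusminus>\<i>\<close>, so the real and imaginary parts of \<open>u\<close> agree up to sign and twice their
  square is one.\<close>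

lemma gaussian_rationals_no_eighth_root:
  assumes "u \<in> gaussian_rationals"
  shows "u ^ 4 \<noteq> -1"
proof
  assume u4: "u ^ 4 = -1"
  define a b where "a = Re u" and "b = Im u"
  have ab: "a \<in> \<rat>" "b \<in> \<rat>" using assms by (auto simp: gaussian_rationals_def a_def b_def)
  have "(u ^ 2 - \<i>) * (u ^ 2 + \<i>) = u ^ 4 + 1"
    by (simp add: algebra_simps power4_eq_xxxx power2_eq_square)
  then have "u ^ 2 = \<i> \<or> u ^ 2 = - \<i>"
    using u4 by (auto simp: eq_neg_iff_add_eq_0)
  then have "Re (u ^ 2) = 0" "\<bar>Im (u ^ 2)\<bar> = 1" by auto
  then have "a ^ 2 = b ^ 2" "\<bar>2 * a * b\<bar> = 1"
    by (simp_all add: a_def b_def Re_power2 Im_power2)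
  then have "\<bar>a\<bar> = \<bar>b\<bar>" "2 * (\<bar>a\<bar> * \<bar>b\<bar>) = 1"
    by (auto simp: abs_mult power2_eq_iff)
  then have "2 * (\<bar>a\<bar> * \<bar>a\<bar>) = 1" by (simp only:)
  then have "(2 * a) ^ 2 = 2"
    by (simp add: power2_eq_square)
  moreover have "2 * a \<in> \<rat>" using ab by simp
  ultimately show False using two_not_rational_square by blast
qed

theorem theorem3p6:
  shows
    "(\<forall>\<A> \<in> {fermat_primes, composite_fermat_numbers}.
        (finite \<A> \<longleftrightarrow>
           minimal_group
             (product_group \<A> (\<lambda>m. special_linear_group (m - 1) gaussian_rationals))
             (product_topology (\<lambda>m. special_linear_topology (m - 1) gaussian_rationals) \<A>)) \<and>
        (finite \<A> \<longleftrightarrow>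
           minimal_group
             (product_group \<A> (\<lambda>m. special_triangular_group (m - 1) gaussian_rationals))
             (product_topology (\<lambda>m. special_triangular_topology (m - 1) gaussian_rationals) \<A>))) \<and>
     (\<forall>\<B> \<in> {mersenne_primes, composite_mersenne_numbers}.
        (finite \<B> \<longleftrightarrow>
           minimal_group
             (product_group \<B> (\<lambda>m. special_linear_group (m + 1) gaussian_rationals))
             (product_topology (\<lambda>m. special_linear_topology (m + 1) gaussian_rationals) \<B>)) \<and>
        (finite \<B> \<longleftrightarrow>
           minimal_group
             (product_group \<B> (\<lambda>m. special_triangular_group (m + 1) gaussian_rationals))
             (product_topology (\<lambda>m. special_triangular_topology (m + 1) gaussian_rationals) \<B>)))"
proof -
  interpret dense_complex_subfield gaussian_rationals by (rule gaussian_rationals_dense_subfield)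
  note equiv = finite_iff_minimal[OF gaussian_rationals_no_eighth_root]
  have fermat: "\<exists>k\<ge>1. m - 1 = 2 ^ k" "1 \<le> m" if m: "m \<in> fermat_numbers" for m
  proof -
    obtain e where "m = 2 ^ (2 ^ e) + 1" using m by (auto simp: fermat_numbers_def)
    then show "\<exists>k\<ge>1. m - 1 = 2 ^ k" "1 \<le> m" by (auto intro!: exI[of _ "2 ^ e"])
  qed
  have mersenne: "\<exists>k\<ge>1. m + 1 = 2 ^ k" if m: "m \<in> mersenne_numbers" for m
  proof -
    obtain p where p: "prime p" "m = 2 ^ p - 1" using m by (auto simp: mersenne_numbers_def)
    then have "m + 1 = 2 ^ p" by simp
    then show ?thesis using prime_ge_1_nat[OF p(1)] by blast
  qed
  show ?thesis
  proof (intro conjI ballI)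
    fix \<A> assume "\<A> \<in> {fermat_primes, composite_fermat_numbers}"
    then have A: "\<A> \<subseteq> fermat_numbers"
      by (auto simp: fermat_primes_def composite_fermat_numbers_def)
    have e: "\<And>m. m \<in> \<A> \<Longrightarrow> \<exists>k\<ge>1. m - 1 = 2 ^ k" using A fermat(1) by blast
    have i: "inj_on (\<lambda>m. m - 1) \<A>"
    proof (rule inj_onI)
      fix x y assume "x \<in> \<A>" "y \<in> \<A>" "x - 1 = y - 1"
      then show "x = y" using fermat(2)[of x] fermat(2)[of y] A by (auto simp: subset_iff)
    qed
    show "finite \<A> \<longleftrightarrow> minimal_group
        (product_group \<A> (\<lambda>m. special_linear_group (m - 1) gaussian_rationals))
        (product_topology (\<lambda>m. special_linear_topology (m - 1) gaussian_rationals) \<A>)"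
      by (rule equiv(1)[OF _ e i])
    show "finite \<A> \<longleftrightarrow> minimal_group
        (product_group \<A> (\<lambda>m. special_triangular_group (m - 1) gaussian_rationals))
        (product_topology (\<lambda>m. special_triangular_topology (m - 1) gaussian_rationals) \<A>)"
      by (rule equiv(2)[OF _ e i])
  next
    fix \<B> assume "\<B> \<in> {mersenne_primes, composite_mersenne_numbers}"
    then have B: "\<B> \<subseteq> mersenne_numbers"
      by (auto simp: mersenne_primes_def composite_mersenne_numbers_def)
    have e: "\<And>m. m \<in> \<B> \<Longrightarrow> \<exists>k\<ge>1. m + 1 = 2 ^ k" using B mersenne by blast
    have i: "inj_on (\<lambda>m. m + 1) \<B>" by (simp add: inj_on_def)
    show "finite \<B> \<longleftrightarrow> minimal_group
        (product_group \<B> (\<lambda>m. special_linear_group (m + 1) gaussian_rationals))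
        (product_topology (\<lambda>m. special_linear_topology (m + 1) gaussian_rationals) \<B>)"
      by (rule equiv(1)[OF _ e i])
    show "finite \<B> \<longleftrightarrow> minimal_group
        (product_group \<B> (\<lambda>m. special_triangular_group (m + 1) gaussian_rationals))
        (product_topology (\<lambda>m. special_triangular_topology (m + 1) gaussian_rationals) \<B>)"
      by (rule equiv(2)[OF _ e i])
  qed
qed

end
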